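(* $V_{\mathbb T^3}=\mathrm{Ind}_{\mathfrak g[t]\oplus\mathbb CK}^{\widehat{\mathfrak g}}C_0$, where $C_0=\bigoplus_{\rho\in\mathbb Z^3}\mathbb C\,e^{2\pi i\rho_jx^j}$, is a vertex algebra, with vacuum vector $\mathbf 1$ the constant function $1$ and the state-field correspondence $Y$ specified in the context.
   Context: **The Lie algebra.** $\mathfrak g$ is the six-dimensional complex Lie algebra with basis $\alpha^i,\beta_i$ ($i=1,2,3$) whose only nonzero brackets are $[\beta_i,\beta_j]=\epsilon_{ijk}\alpha^k$, where $\epsilon_{ijk}$ is the totally antisymmetric tensor and repeated indices are summed. It carries the nondegenerate symmetric invariant form with $\langle\beta_i,\alpha^j\rangle=\delta_{ij}$ and $\langle\alpha^i,\alpha^j\rangle=\langle\beta_i,\beta_j\rangle=0$. Let $\widehat{\mathfrak g}=\mathfrak g[t,t^{-1}]\oplus\mathbb CK$, with $K$ central, $a_n=at^n$, and $[a_m,b_n]=[a,b]_{m+n}+m\langle a,b\rangle\delta_{m,-n}K$. **The space.** $C_0$ is the space of functions on the torus $\mathbb T^3=\mathbb R^3/\mathbb Z^3$ with coordinates $x^1,x^2,x^3$ spanned by the exponentials $e^{2\pi i\rho_jx^j}$, $\rho\in\mathbb Z^3$. On it $\alpha^j$ acts by $0$ and $\beta_j$ acts by $\partial_{x^j}$. Let $a_0$ act as $a\in\mathfrak g$, $a_n$ act by $0$ for $n\ge1$, and $K$ act by $1$. Then $V_{\mathbb T^3}=\mathcal U(\widehat{\mathfrak g})\otimes_{\mathcal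 U(\mathfrak g[t]\oplus\mathbb CK)}C_0$. **The state-field correspondence.** Put $x^j_n=-\frac1n\alpha^j_n$ for $n\ne0$. Let $E_\rho$ be the operator on $V_{\mathbb T^3}$ that acts on $C_0$ as multiplication by $e^{2\pi i\rho_jx^j}$ and satisfies $[\alpha^j_n,E_\rho]=0$ and $[\beta_{j,n},E_\rho]=2\pi i\rho_j\delta_{n,0}E_\rho$. Set $Y(\alpha^j_{-1}\mathbf 1,z)=\sum_n\alpha^j_nz^{-1-n}$, $Y(\beta_{j,-1}\mathbf 1,z)=\sum_n\beta_{j,n}z^{-1-n}$, $$Y(e^{2\pi i\rho_jx^j},z)=E_\rho\exp\Big(2\pi i\rho_j\sum_{n<0}x^j_nz^{-n}\Big)\exp\Big(2\pi i\rho_j\sum_{n>0}x^j_nz^{-n}\Big),$$ and define the remaining fields by iterated normally ordered products $$Y(a^1_{-n_1}\cdots a^r_{-n_r}e^{2\pi i\rho_jx^j},z)={:}\partial_z^{(n_1-1)}Y(a^1_{-1}\mathbf 1,z)\cdots\partial_z^{(n_r-1)}Y(a^r_{-1}\mathbf 1,z)\,Y(e^{2\pi i\rho_jx^j},z){:}$$ for $a^s\in\mathfrak g$, $n_s\ge1$, where $A^{(k)}=A^k/k!$. For $a(z)=\sum_na_{(n)}z^{-1-n}$, ${:}a(z)b(z){:}=a(z)_+b(z)+b(z)a(z)_-$ with $a(z)_-=\sum_{n\ge0}a_{(n)}z^{-1-n}$ and $a(z)_+=\sum_{n\le-1}a_{(n)}z^{-1-n}$; iterated products are nested from the right. **Vertex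 algebra.** A vertex algebra is a complex vector space $V$ with a vector $\mathbf 1\in V$ and a linear map $Y:V\to\mathrm{Field}(V)=\mathrm{Hom}(V,V((z)))$ such that: $Y(\mathbf 1,z)=\mathrm{id}$, $Y(v,z)\mathbf 1\in V[[z]]$ and $Y(v,z)\mathbf 1|_{z=0}=v$; $[T,Y(v,z)]=\partial_zY(v,z)$, where $Tv=\partial_zY(v,z)\mathbf 1|_{z=0}$; and for all $v_1,v_2\in V$ there is $N$ with $(z_1-z_2)^N[Y(v_1,z_1),Y(v_2,z_2)]=0$. *)

theory Defs
  imports "HOL-Analysis.Analysis" "HOL-Library.Function_Algebras" "HOL-Library.Poly_Mapping"
begin

section \<open>Complex vector spaces\<close>

class complex_vector = ab_group_add +
  fixes scaleC :: "complex \<Rightarrow> 'a \<Rightarrow> 'a"  (infixr "*\<^sub>C" 75)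
  assumes scaleC_add_right: "c *\<^sub>C (x + y) = c *\<^sub>C x + c *\<^sub>C y"
    and scaleC_add_left: "(c + d) *\<^sub>C x = c *\<^sub>C x + d *\<^sub>C x"
    and scaleC_scaleC: "c *\<^sub>C (d *\<^sub>C x) = (c * d) *\<^sub>C x"
    and scaleC_one: "1 *\<^sub>C x = x"

global_interpretation cvs: vector_space "scaleC :: complex \<Rightarrow> 'a \<Rightarrow> 'a::complex_vector"
  by standard (simp_all add: scaleC_add_right scaleC_add_left scaleC_scaleC scaleC_one)

abbreviation clinear :: "('a::complex_vector \<Rightarrow> 'b::complex_vector) \<Rightarrow> bool" where
  "clinear \<equiv> Vector_Spaces.linear scaleC scaleC"

lemma clinear_iff:
  "clinear f \<longleftrightarrow> (\<forall>x y. f (x + y) = f x + f y) \<and> (\<forall>c x. f (c *\<^sub>C x) = c *\<^sub>C f x)"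
  by (simp add: Vector_Spaces.linear_iff cvs.vector_space_axioms)

instantiation complex :: complex_vector
begin
definition "c *\<^sub>C (x::complex) = c * x"
instance by standard (simp_all add: scaleC_complex_def algebra_simps)
end

instantiation "fun" :: (type, complex_vector) complex_vector
begin
definition "c *\<^sub>C f = (\<lambda>x. c *\<^sub>C f x)"
instance
  by standard (simp_all add: scaleC_fun_def fun_eq_iff scaleC_add_right scaleC_add_left
    scaleC_scaleC scaleC_one)
end

instantiation poly_mapping :: (type, complex_vector) complex_vector
begin
lift_definition scaleC_poly_mapping :: "complex \<Rightarrow> ('a \<Rightarrow>\<^sub>0 'b) \<Rightarrow> ('a \<Rightarrow>\<^sub>0 'b)"
  is "\<lambda>c f k. c *\<^sub>C f k"
  by (erule rev_finite_subset) auto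
instance
  by (standard; transfer; simp add: fun_eq_iff scaleC_add_right scaleC_add_left
    scaleC_scaleC scaleC_one)
end

lemma lookup_scaleC [simp]: "Poly_Mapping.lookup (c *\<^sub>C p) k = c *\<^sub>C Poly_Mapping.lookup p k"
  by transfer simp

lemma scaleC_single: "c *\<^sub>C Poly_Mapping.single k a = Poly_Mapping.single k (c *\<^sub>C a)"
  by (rule poly_mapping_eqI) (simp add: lookup_single when_def)

text \<open>The type \<^typ>\<open>'a \<Rightarrow>\<^sub>0 complex\<close> serves as the vector space with basis \<^typ>\<open>'a\<close>.\<close>

definition lin_ext :: "('a \<Rightarrow> 'b::complex_vector) \<Rightarrow> ('a \<Rightarrow>\<^sub>0 complex) \<Rightarrow> 'b" where
  "lin_ext f p = (\<Sum>k\<in>Poly_Mapping.keys p. Poly_Mapping.lookup p k *\<^sub>C f k)"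

abbreviation bas :: "'a \<Rightarrow> ('a \<Rightarrow>\<^sub>0 complex)" where
  "bas k \<equiv> Poly_Mapping.single k 1"

lemma lin_ext_superset:
  assumes "finite A" "Poly_Mapping.keys p \<subseteq> A"
  shows "lin_ext f p = (\<Sum>k\<in>A. Poly_Mapping.lookup p k *\<^sub>C f k)"
  unfolding lin_ext_def
  by (rule sum.mono_neutral_left) (use assms in \<open>auto simp: in_keys_iff\<close>)

lemma lin_ext_add: "lin_ext f (p + q) = lin_ext f p + lin_ext f q"
proof -
  let ?A = "Poly_Mapping.keys p \<union> Poly_Mapping.keys q"
  have "lin_ext f r = (\<Sum>k\<in>?A. Poly_Mapping.lookup r k *\<^sub>C f k)" if "r \<in> {p, q, p + q}" for r
    by (rule lin_ext_superset) (use that Poly_Mapping.keys_add[of p q] in auto)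
  then show ?thesis
    by (simp add: lookup_add scaleC_add_left sum.distrib)
qed

lemma lin_ext_scale: "lin_ext f (c *\<^sub>C p) = c *\<^sub>C lin_ext f p"
proof -
  have "lin_ext f (c *\<^sub>C p)
      = (\<Sum>k\<in>Poly_Mapping.keys p. Poly_Mapping.lookup (c *\<^sub>C p) k *\<^sub>C f k)"
    by (rule lin_ext_superset) (auto simp: in_keys_iff)
  then show ?thesis
    by (simp add: lin_ext_def cvs.scale_sum_right scaleC_scaleC scaleC_complex_def)
qed

lemma lin_ext_single [simp]: "lin_ext f (Poly_Mapping.single k c) = c *\<^sub>C f k"
  by (simp add: lin_ext_def)

lemma clinear_lin_ext: "clinear (lin_ext f)"
  by (simp add: clinear_iff lin_ext_add lin_ext_scale)

lemma additive_diff: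
  fixes f :: "'a::ab_group_add \<Rightarrow> 'b::ab_group_add"
  assumes "\<And>x y. f (x + y) = f x + f y"
  shows "f (x - y) = f x - f y"
  by (metis assms add_diff_cancel_right' diff_add_cancel)

lemma lin_ext_diff: "lin_ext f (p - q) = lin_ext f p - lin_ext f q"
  by (rule additive_diff) (rule lin_ext_add)

lemma poly_mapping_add_induct [case_names zero add]:
  assumes "P 0"
    and "\<And>k c p. P p \<Longrightarrow> P (Poly_Mapping.single k c + p)"
  shows "P (p :: 'a \<Rightarrow>\<^sub>0 'b::ab_group_add)"
proof (induction p rule: update_induct)
  case const
  show ?case by fact
next
  case (update f a b)
  have "Poly_Mapping.update a b f = Poly_Mapping.single a b + f"
    by (rule poly_mapping_eqI)
      (use update(1) in \<open>auto simp: lookup_update lookup_add lookup_single in_keys_iff when_def\<close>)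
  then show ?case using update assms(2) by simp
qed

lemma clinear_zero: "clinear f \<Longrightarrow> f 0 = 0"
  by (metis add_cancel_right_right clinear_iff)

lemma clinear_diff: "clinear f \<Longrightarrow> f (x - y) = f x - f y"
  by (rule additive_diff) (simp add: clinear_iff)

lemma clinear_compose: "clinear f \<Longrightarrow> clinear g \<Longrightarrow> clinear (\<lambda>x. f (g x))"
  by (simp add: clinear_iff)

lemma clinear_kernel_span:
  assumes "clinear f" "\<And>x. x \<in> S \<Longrightarrow> f x = 0" "x \<in> cvs.span S"
  shows "f x = 0"
proof -
  have "cvs.subspace {x. f x = 0}"
    using assms(1) clinear_zero[OF assms(1)]
    by (auto simp: cvs.subspace_def clinear_iff)
  then show ?thesis
    using cvs.span_minimal[of S "{x. f x = 0}"] assms(2,3) by blast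
qed

lemma clinear_preserves_span:
  assumes "clinear f" "\<And>x. x \<in> S \<Longrightarrow> f x \<in> cvs.span T" "x \<in> cvs.span S"
  shows "f x \<in> cvs.span T"
proof -
  have "cvs.subspace {x. f x \<in> cvs.span T}"
    using assms(1) clinear_zero[OF assms(1)]
    by (auto simp: cvs.subspace_def clinear_iff cvs.span_zero cvs.span_add cvs.span_scale)
  then show ?thesis
    using cvs.span_minimal[of S "{x. f x \<in> cvs.span T}"] assms(2,3) by blast
qed


section \<open>Lie algebras and their universal enveloping algebras\<close>

class lie_algebra = complex_vector +
  fixes lie :: "'a \<Rightarrow> 'a \<Rightarrow> 'a"
  assumes lie_add_left: "lie (x + y) z = lie x z + lie y z"
    and lie_add_right: "lie x (y + z) = lie x y + lie x z"
    and lie_scale_left: "lie (c *\<^sub>C x) y = c *\<^sub>C lie x y"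
    and lie_scale_right: "lie x (c *\<^sub>C y) = c *\<^sub>C lie x y"
    and lie_self: "lie x x = 0"
    and jacobi: "lie x (lie y z) + lie y (lie z x) + lie z (lie x y) = 0"

text \<open>A Lie algebra with a nondegenerate symmetric invariant bilinear form.\<close>

class quadratic_lie_algebra = lie_algebra +
  fixes bform :: "'a \<Rightarrow> 'a \<Rightarrow> complex"
  assumes bform_add_left: "bform (x + y) z = bform x z + bform y z"
    and bform_scale_left: "bform (c *\<^sub>C x) y = c * bform x y"
    and bform_sym: "bform x y = bform y x"
    and bform_invariant: "bform (lie x y) z = bform x (lie y z)"
    and bform_nondegenerate: "(\<And>y. bform x y = 0) \<Longrightarrow> x = 0"

definition lie_rep :: "('l::lie_algebra \<Rightarrow> 'v::complex_vector \<Rightarrow> 'v) \<Rightarrow> bool" where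
  "lie_rep \<rho> \<longleftrightarrow>
     (\<forall>x. clinear (\<rho> x)) \<and> (\<forall>v. clinear (\<lambda>x. \<rho> x v)) \<and>
     (\<forall>x y v. \<rho> (lie x y) v = \<rho> x (\<rho> y v) - \<rho> y (\<rho> x v))"

definition lie_hom :: "('l::lie_algebra \<Rightarrow> 'm::lie_algebra) \<Rightarrow> bool" where
  "lie_hom \<phi> \<longleftrightarrow> clinear \<phi> \<and> (\<forall>x y. \<phi> (lie x y) = lie (\<phi> x) (\<phi> y))"

text \<open>Lists under concatenation are the free monoid, so that \<^typ>\<open>'l list \<Rightarrow>\<^sub>0 complex\<close>
  with the convolution product of \<^theory>\<open>HOL-Library.Poly_Mapping\<close> is the free associative
  unital algebra on the set \<^typ>\<open>'l\<close>.\<close>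

instantiation list :: (type) monoid_add
begin
definition "0 = []"
definition "xs + ys = xs @ ys"
instance by standard (simp_all add: zero_list_def plus_list_def)
end

type_synonym 'l free_alg = "'l list \<Rightarrow>\<^sub>0 complex"

lemma one_free_alg: "(1 :: 'l free_alg) = bas []"
  by (simp add: zero_list_def[symmetric])

lemma bas_mult_bas: "bas xs * bas ys = (bas (xs @ ys) :: 'l free_alg)"
  by (simp add: mult_single plus_list_def)

lemma single_Nil_mult: "Poly_Mapping.single [] c * (p :: 'l free_alg) = c *\<^sub>C p"
proof (induction p rule: poly_mapping_add_induct)
  case zero
  then show ?case by (simp add: cvs.scale_zero_right)
next
  case (add k d p)
  then show ?case
    by (simp add: distrib_left mult_single plus_list_def scaleC_add_right scaleC_single
      scaleC_complex_def)
qed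

lemma mult_single_Nil: "(p :: 'l free_alg) * Poly_Mapping.single [] c = c *\<^sub>C p"
proof (induction p rule: poly_mapping_add_induct)
  case zero
  then show ?case by (simp add: cvs.scale_zero_right)
next
  case (add k d p)
  then show ?case
    by (simp add: distrib_right mult_single plus_list_def scaleC_add_right scaleC_single
      scaleC_complex_def mult.commute)
qed

lemma free_alg_scale_left: "(c *\<^sub>C p) * (q :: 'l free_alg) = c *\<^sub>C (p * q)"
  by (simp add: single_Nil_mult[symmetric] mult.assoc)

lemma free_alg_scale_right: "p * (c *\<^sub>C q) = c *\<^sub>C (p * q :: 'l free_alg)"
  by (simp add: mult_single_Nil[symmetric] mult.assoc)

text \<open>The tensor algebra is the free algebra modulo linearity of the generators. The enveloping
  algebra is therefore the quotient by the two-sided ideal generated by linearity together with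
  \<open>x y - y x - [x, y]\<close>.\<close>

definition uea_relators :: "'l::lie_algebra free_alg set" where
  "uea_relators =
     {bas [x + y] - bas [x] - bas [y] | x y. True} \<union>
     {bas [c *\<^sub>C x] - c *\<^sub>C bas [x] | c x. True} \<union>
     {bas [x] * bas [y] - bas [y] * bas [x] - bas [lie x y] | x y. True}"

definition uea_ideal :: "'l::lie_algebra free_alg set" where
  "uea_ideal = cvs.span {a * r * b | a r b. r \<in> uea_relators}"

definition uea_rel :: "'l::lie_algebra free_alg \<Rightarrow> 'l free_alg \<Rightarrow> bool" where
  "uea_rel p q \<longleftrightarrow> p - q \<in> uea_ideal"

lemma equivp_span_diff: "equivp (\<lambda>p q. p - q \<in> cvs.span S)"
proof (rule equivpI)
  show "reflp (\<lambda>p q. p - q \<in> cvs.span S)"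
    by (simp add: reflp_def cvs.span_zero)
  show "symp (\<lambda>p q. p - q \<in> cvs.span S)"
    by (metis (no_types, lifting) cvs.span_neg minus_diff_eq sympI)
  show "transp (\<lambda>p q. p - q \<in> cvs.span S)"
  proof (rule transpI)
    fix x y z assume "x - y \<in> cvs.span S" "y - z \<in> cvs.span S"
    then have "(x - y) + (y - z) \<in> cvs.span S" by (rule cvs.span_add)
    then show "x - z \<in> cvs.span S" by simp
  qed
qed

lemma span_diff_diff:
  assumes "p - p' \<in> cvs.span S" "q - q' \<in> cvs.span S"
  shows "p - q - (p' - q') \<in> cvs.span S"
proof -
  have "(p - p') - (q - q') \<in> cvs.span S" using assms by (rule cvs.span_diff)
  moreover have "(p - p') - (q - q') = p - q - (p' - q')" by simp
  ultimately show ?thesis by simp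
qed

quotient_type (overloaded) 'l uea = "'l::lie_algebra free_alg" / uea_rel
  unfolding uea_rel_def uea_ideal_def by (rule equivp_span_diff)

lemma uea_ideal_mult_left:
  fixes p q :: "'l::lie_algebra free_alg"
  assumes p: "p \<in> uea_ideal"
  shows "q * p \<in> uea_ideal"
proof -
  have "clinear ((*) q)"
    by (simp add: clinear_iff distrib_left free_alg_scale_right)
  from this _ p[unfolded uea_ideal_def] show ?thesis
    unfolding uea_ideal_def
  proof (rule clinear_preserves_span)
    fix x :: "'l free_alg" assume "x \<in> {a * r * b | a r b. r \<in> uea_relators}"
    then obtain a r b where "x = a * r * b" "r \<in> uea_relators" by blast
    then have "q * x = (q * a) * r * b" by (simp add: mult.assoc)
    with \<open>r \<in> uea_relators\<close> show "q * x \<in> cvs.span {a * r * b | a r b. r \<in> uea_relators}"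
      by (intro cvs.span_base) blast
  qed
qed

lemma uea_ideal_mult_right:
  fixes p q :: "'l::lie_algebra free_alg"
  assumes p: "p \<in> uea_ideal"
  shows "p * q \<in> uea_ideal"
proof -
  have "clinear (\<lambda>p. p * q)"
    by (simp add: clinear_iff distrib_right free_alg_scale_left)
  from this _ p[unfolded uea_ideal_def] show ?thesis
    unfolding uea_ideal_def
  proof (rule clinear_preserves_span)
    fix x :: "'l free_alg" assume "x \<in> {a * r * b | a r b. r \<in> uea_relators}"
    then obtain a r b where "x = a * r * b" "r \<in> uea_relators" by blast
    then have "x * q = a * r * (b * q)" by (simp add: mult.assoc)
    with \<open>r \<in> uea_relators\<close> show "x * q \<in> cvs.span {a * r * b | a r b. r \<in> uea_relators}"
      by (intro cvs.span_base) blast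
  qed
qed

text \<open>The action of the free algebra on a module, where \<open>[x\<^sub>1, \<dots>, x\<^sub>n]\<close> acts as
  \<open>\<rho> x\<^sub>1 \<circ> \<dots> \<circ> \<rho> x\<^sub>n\<close>; it descends to the enveloping algebra when \<open>\<rho>\<close> is a
  representation.\<close>

definition free_act :: "('l \<Rightarrow> 'v::complex_vector \<Rightarrow> 'v) \<Rightarrow> 'l free_alg \<Rightarrow> 'v \<Rightarrow> 'v" where
  "free_act \<rho> p v = lin_ext (\<lambda>w. foldr \<rho> w v) p"

lemma clinear_free_act:
  assumes "\<And>x. clinear (\<rho> x)"
  shows "clinear (free_act \<rho> p)"
proof -
  have "clinear (foldr \<rho> w)" for w
    by (induction w) (use assms in \<open>simp_all add: clinear_iff\<close>)
  then show ?thesis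
    by (simp add: clinear_iff free_act_def lin_ext_def scaleC_add_right sum.distrib
      cvs.scale_sum_right scaleC_scaleC mult.commute)
qed

lemma free_act_add: "free_act \<rho> (p + q) v = free_act \<rho> p v + free_act \<rho> q v"
  by (simp add: free_act_def lin_ext_add)

lemma free_act_diff: "free_act \<rho> (p - q) v = free_act \<rho> p v - free_act \<rho> q v"
  by (simp add: free_act_def lin_ext_diff)

lemma free_act_scale: "free_act \<rho> (c *\<^sub>C p) v = c *\<^sub>C free_act \<rho> p v"
  by (simp add: free_act_def lin_ext_scale)

lemma free_act_single: "free_act \<rho> (Poly_Mapping.single w c) v = c *\<^sub>C foldr \<rho> w v"
  by (simp add: free_act_def)

lemma free_act_zero: "free_act \<rho> 0 v = 0"
  by (simp add: free_act_def lin_ext_def)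

lemma free_act_mult:
  assumes "\<And>x. clinear (\<rho> x)"
  shows "free_act \<rho> (p * q) v = free_act \<rho> p (free_act \<rho> q v)"
proof (induction p rule: poly_mapping_add_induct)
  case zero
  then show ?case by (simp add: free_act_zero)
next
  case (add w c p)
  have lin: "clinear (foldr \<rho> w)"
    by (induction w) (use assms in \<open>simp_all add: clinear_iff\<close>)
  have "free_act \<rho> (Poly_Mapping.single w c * q) v = c *\<^sub>C foldr \<rho> w (free_act \<rho> q v)"
  proof (induction q rule: poly_mapping_add_induct)
    case zero
    then show ?case by (simp add: free_act_zero clinear_zero[OF lin] cvs.scale_zero_right)
  next
    case (add w' d q)
    then show ?case
      using lin by (simp add: distrib_left free_act_add mult_single plus_list_def free_act_single
        clinear_iff scaleC_add_right scaleC_scaleC)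
  qed
  with add show ?case
    by (simp add: distrib_right free_act_add free_act_single)
qed

lemma free_act_ideal:
  fixes p :: "'l::lie_algebra free_alg" and \<rho> :: "'l \<Rightarrow> 'v::complex_vector \<Rightarrow> 'v"
  assumes "lie_rep \<rho>" "p \<in> uea_ideal"
  shows "free_act \<rho> p v = 0"
proof -
  have lin: "clinear (\<rho> x)" for x using assms(1) by (simp add: lie_rep_def)
  have "clinear (\<lambda>p. free_act \<rho> p v)"
    by (simp add: clinear_iff free_act_add free_act_scale)
  from this _ assms(2)[unfolded uea_ideal_def] show ?thesis
  proof (rule clinear_kernel_span)
    fix x :: "'l free_alg" assume "x \<in> {a * r * b | a r b. r \<in> uea_relators}"
    then obtain a r b where x: "x = a * r * b" "r \<in> uea_relators" by blast
    have "free_act \<rho> r u = 0" for u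
      using x(2) assms(1)
      by (auto simp: uea_relators_def free_act_diff free_act_scale free_act_single bas_mult_bas
        lie_rep_def clinear_iff scaleC_one)
    then show "free_act \<rho> x v = 0"
      using clinear_zero[OF clinear_free_act[of \<rho> a, OF lin]]
      by (simp add: x(1) free_act_mult lin)
  qed
qed

lemma one_notin_uea_ideal: "(1 :: 'l::lie_algebra free_alg) \<notin> uea_ideal"
proof
  assume "(1 :: 'l free_alg) \<in> uea_ideal"
  moreover have "lie_rep (\<lambda>(x::'l) (v::complex). 0)"
    by (simp add: lie_rep_def clinear_iff cvs.scale_zero_right)
  ultimately have "free_act (\<lambda>(x::'l) (v::complex). 0) 1 1 = 0"
    by (rule free_act_ideal[rotated])
  then show False
    by (simp add: one_free_alg free_act_single scaleC_one)
qed

instantiation uea :: (lie_algebra) "{complex_vector, ring_1}"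
begin

lift_definition zero_uea :: "'a uea" is 0 .
lift_definition one_uea :: "'a uea" is 1 .
lift_definition plus_uea :: "'a uea \<Rightarrow> 'a uea \<Rightarrow> 'a uea" is "(+)"
  unfolding uea_rel_def uea_ideal_def by (simp add: add_diff_add cvs.span_add)
lift_definition uminus_uea :: "'a uea \<Rightarrow> 'a uea" is uminus
  unfolding uea_rel_def uea_ideal_def by (simp only: minus_diff_minus cvs.span_neg)
lift_definition minus_uea :: "'a uea \<Rightarrow> 'a uea \<Rightarrow> 'a uea" is "(-)"
  unfolding uea_rel_def uea_ideal_def
  by (rule span_diff_diff)
lift_definition scaleC_uea :: "complex \<Rightarrow> 'a uea \<Rightarrow> 'a uea" is scaleC
  unfolding uea_rel_def uea_ideal_def
  by (simp add: cvs.scale_right_diff_distrib[symmetric] cvs.span_scale)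
lift_definition times_uea :: "'a uea \<Rightarrow> 'a uea \<Rightarrow> 'a uea" is "(*)"
proof -
  fix p p' q q' :: "'a free_alg"
  assume "uea_rel p p'" "uea_rel q q'"
  then have "(p - p') * q \<in> uea_ideal" "p' * (q - q') \<in> uea_ideal"
    by (simp_all add: uea_rel_def uea_ideal_mult_left uea_ideal_mult_right)
  then have "(p - p') * q + p' * (q - q') \<in> uea_ideal"
    unfolding uea_ideal_def by (rule cvs.span_add)
  then show "uea_rel (p * q) (p' * q')"
    by (simp add: uea_rel_def algebra_simps)
qed

instance
proof
  have rel: "uea_rel p q" if "p = q" for p q :: "'a free_alg"
    using that by (simp add: uea_rel_def uea_ideal_def cvs.span_zero)
  show "(0::'a uea) \<noteq> 1"
  proof
    assume "(0::'a uea) = 1"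
    then have "uea_rel (0 :: 'a free_alg) 1" by transfer
    then have "- (0 - (1 :: 'a free_alg)) \<in> uea_ideal"
      unfolding uea_rel_def uea_ideal_def by (rule cvs.span_neg)
    then show False by (simp add: one_notin_uea_ideal)
  qed
  fix a b c :: "'a uea" and k l :: complex
  show "a + b + c = a + (b + c)" by transfer (rule rel, rule add.assoc)
  show "a + b = b + a" by transfer (rule rel, rule add.commute)
  show "0 + a = a" by transfer (rule rel, simp)
  show "- a + a = 0" by transfer (rule rel, simp)
  show "a - b = a + - b" by transfer (rule rel, simp)
  show "a * b * c = a * (b * c)" by transfer (rule rel, rule mult.assoc)
  show "1 * a = a" by transfer (rule rel, simp)
  show "a * 1 = a" by transfer (rule rel, simp)
  show "(a + b) * c = a * c + b * c" by transfer (rule rel, rule distrib_right)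
  show "a * (b + c) = a * b + a * c" by transfer (rule rel, rule distrib_left)
  show "k *\<^sub>C (a + b) = k *\<^sub>C a + k *\<^sub>C b" by transfer (rule rel, rule scaleC_add_right)
  show "(k + l) *\<^sub>C a = k *\<^sub>C a + l *\<^sub>C a" by transfer (rule rel, rule scaleC_add_left)
  show "k *\<^sub>C l *\<^sub>C a = (k * l) *\<^sub>C a" by transfer (rule rel, rule scaleC_scaleC)
  show "1 *\<^sub>C a = a" by transfer (rule rel, rule scaleC_one)
qed

end

lift_definition uea_gen :: "'l::lie_algebra \<Rightarrow> 'l uea" is "\<lambda>x. bas [x]" .

lemma uea_gen_lie: "uea_gen x * uea_gen y - uea_gen y * uea_gen x = uea_gen (lie x y)"
proof (transfer, unfold uea_rel_def uea_ideal_def)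
  fix x y :: 'a
  let ?r = "bas [x] * bas [y] - bas [y] * bas [x] - bas [lie x y] :: 'a free_alg"
  have "?r \<in> uea_relators" by (auto simp: uea_relators_def)
  then have "1 * ?r * 1 \<in> {a * r * b | a r b. r \<in> uea_relators}" by blast
  then show "?r \<in> cvs.span {a * r * b | a r b. r \<in> uea_relators}"
    by (simp add: cvs.span_base)
qed

definition free_map :: "('l \<Rightarrow> 'm) \<Rightarrow> 'l free_alg \<Rightarrow> 'm free_alg" where
  "free_map \<phi> = lin_ext (\<lambda>w. bas (map \<phi> w))"

lemma free_map_mult: "free_map \<phi> (p * q) = free_map \<phi> p * free_map \<phi> q"
proof (induction p rule: poly_mapping_add_induct)
  case zero
  then show ?case by (simp add: free_map_def lin_ext_def)
next
  case (add w c p)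
  have "free_map \<phi> (Poly_Mapping.single w c * q)
      = free_map \<phi> (Poly_Mapping.single w c) * free_map \<phi> q"
  proof (induction q rule: poly_mapping_add_induct)
    case zero
    then show ?case by (simp add: free_map_def lin_ext_def)
  next
    case (add w' d q)
    then show ?case
      by (simp add: distrib_left free_map_def lin_ext_add mult_single plus_list_def scaleC_single
        scaleC_complex_def)
  qed
  with add show ?case
    by (simp add: distrib_right free_map_def lin_ext_add)
qed

lemma free_map_ideal:
  fixes \<phi> :: "'l::lie_algebra \<Rightarrow> 'm::lie_algebra"
  assumes "lie_hom \<phi>" "p \<in> uea_ideal"
  shows "free_map \<phi> p \<in> uea_ideal"
proof -
  have "clinear (free_map \<phi>)"
    by (simp add: free_map_def clinear_lin_ext)
  from this _ assms(2)[unfolded uea_ideal_def] show ?thesis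
    unfolding uea_ideal_def
  proof (rule clinear_preserves_span)
    fix x :: "'l free_alg" assume "x \<in> {a * r * b | a r b. r \<in> uea_relators}"
    then obtain a r b where x: "x = a * r * b" "r \<in> uea_relators" by blast
    from x(2) consider
        y z where "r = bas [y + z] - bas [y] - bas [z]"
      | c y where "r = bas [c *\<^sub>C y] - c *\<^sub>C bas [y]"
      | y z where "r = bas [y] * bas [z] - bas [z] * bas [y] - bas [lie y z]"
      unfolding uea_relators_def by blast
    then have "free_map \<phi> r \<in> uea_relators"
    proof cases
      case (1 y z)
      then have "free_map \<phi> r = bas [\<phi> y + \<phi> z] - bas [\<phi> y] - bas [\<phi> z]"
        using assms(1) by (simp add: free_map_def lin_ext_diff scaleC_one lie_hom_def clinear_iff)
      then show ?thesis unfolding uea_relators_def by blast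
    next
      case (2 c y)
      then have "free_map \<phi> r = bas [c *\<^sub>C \<phi> y] - c *\<^sub>C bas [\<phi> y]"
        using assms(1)
        by (simp add: free_map_def lin_ext_diff lin_ext_scale scaleC_one lie_hom_def clinear_iff)
      then show ?thesis unfolding uea_relators_def by blast
    next
      case (3 y z)
      then have "free_map \<phi> r
          = bas [\<phi> y] * bas [\<phi> z] - bas [\<phi> z] * bas [\<phi> y] - bas [lie (\<phi> y) (\<phi> z)]"
        using assms(1)
        by (simp add: free_map_def lin_ext_diff scaleC_one lie_hom_def bas_mult_bas)
      then show ?thesis unfolding uea_relators_def by blast
    qed
    then have "free_map \<phi> a * free_map \<phi> r * free_map \<phi> b
        \<in> {a * r * b | a r b. r \<in> uea_relators}" by blast
    then show "free_map \<phi> x \<in> cvs.span {a * r * b | a r b. r \<in> uea_relators}"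
      unfolding x(1) free_map_mult by (rule cvs.span_base)
  qed
qed


section \<open>Affine Lie algebras\<close>

text \<open>The affinization \<open>\<gg>[t, t\<^sup>-\<^sup>1] \<oplus> \<complex>K\<close>: the coefficient of \<open>t\<^sup>n\<close> is the value at \<open>n\<close> of
  the first component.\<close>

context notes [[typedef_overloaded]]
begin
datatype 'g affine = Affine (loop_part: "int \<Rightarrow>\<^sub>0 'g::zero") (central_part: complex)
end

instantiation affine :: (complex_vector) complex_vector
begin
definition "0 = Affine 0 0"
definition "x + y = Affine (loop_part x + loop_part y) (central_part x + central_part y)"
definition "- x = Affine (- loop_part x) (- central_part x)"
definition "x - y = Affine (loop_part x - loop_part y) (central_part x - central_part y)"
definition "c *\<^sub>C x = Affine (c *\<^sub>C loop_part x) (c * central_part x)"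
instance
  by standard (simp_all add: zero_affine_def plus_affine_def uminus_affine_def minus_affine_def
    scaleC_affine_def algebra_simps scaleC_add_right scaleC_add_left scaleC_scaleC scaleC_one)
end

definition loop_bracket :: "(int \<Rightarrow>\<^sub>0 'g) \<Rightarrow> (int \<Rightarrow>\<^sub>0 'g) \<Rightarrow> (int \<Rightarrow>\<^sub>0 'g::quadratic_lie_algebra)" where
  "loop_bracket f g = (\<Sum>m\<in>Poly_Mapping.keys f. \<Sum>n\<in>Poly_Mapping.keys g.
     Poly_Mapping.single (m + n) (lie (Poly_Mapping.lookup f m) (Poly_Mapping.lookup g n)))"

definition loop_cocycle :: "(int \<Rightarrow>\<^sub>0 'g) \<Rightarrow> (int \<Rightarrow>\<^sub>0 'g::quadratic_lie_algebra) \<Rightarrow> complex" where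
  "loop_cocycle f g = (\<Sum>m\<in>Poly_Mapping.keys f.
     of_int m * bform (Poly_Mapping.lookup f m) (Poly_Mapping.lookup g (- m)))"

lemma lie_zero_left [simp]: "lie 0 x = 0"
  by (metis add_cancel_right_right lie_add_left)

lemma lie_zero_right [simp]: "lie x 0 = 0"
  by (metis add_cancel_right_right lie_add_right)

lemma lie_skew: "lie x y = - lie y x"
proof -
  have "lie (x + y) (x + y) = lie x x + lie y x + (lie x y + lie y y)"
    by (simp only: lie_add_left lie_add_right)
  then have "lie x y + lie y x = 0"
    by (simp add: lie_self add.commute)
  then show ?thesis by (rule eq_neg_iff_add_eq_0[THEN iffD2])
qed

lemma bform_add_right: "bform x (y + z) = bform x y + bform x z"
  by (metis bform_add_left bform_sym)

lemma bform_scale_right: "bform x (c *\<^sub>C y) = c * bform x y"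
  by (metis bform_scale_left bform_sym)

lemma bform_zero_left [simp]: "bform 0 x = 0"
  by (metis add_cancel_right_right bform_add_left)

lemma bform_zero_right [simp]: "bform x 0 = 0"
  by (metis bform_sym bform_zero_left)

lemma loop_bracket_superset:
  assumes "finite A" "finite B" "Poly_Mapping.keys f \<subseteq> A" "Poly_Mapping.keys g \<subseteq> B"
  shows "loop_bracket f g = (\<Sum>m\<in>A. \<Sum>n\<in>B.
     Poly_Mapping.single (m + n) (lie (Poly_Mapping.lookup f m) (Poly_Mapping.lookup g n)))"
proof -
  have "loop_bracket f g = (\<Sum>m\<in>A. \<Sum>n\<in>Poly_Mapping.keys g.
     Poly_Mapping.single (m + n) (lie (Poly_Mapping.lookup f m) (Poly_Mapping.lookup g n)))"
    unfolding loop_bracket_def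
    by (rule sum.mono_neutral_left) (use assms in \<open>auto simp: in_keys_iff\<close>)
  also have "\<dots> = (\<Sum>m\<in>A. \<Sum>n\<in>B.
     Poly_Mapping.single (m + n) (lie (Poly_Mapping.lookup f m) (Poly_Mapping.lookup g n)))"
    by (intro sum.cong refl sum.mono_neutral_left) (use assms in \<open>auto simp: in_keys_iff\<close>)
  finally show ?thesis .
qed

lemma loop_cocycle_superset:
  assumes "finite A" "Poly_Mapping.keys f \<subseteq> A"
  shows "loop_cocycle f g = (\<Sum>m\<in>A.
     of_int m * bform (Poly_Mapping.lookup f m) (Poly_Mapping.lookup g (- m)))"
  unfolding loop_cocycle_def
  by (rule sum.mono_neutral_left) (use assms in \<open>auto simp: in_keys_iff\<close>)

lemma loop_bracket_add_left: "loop_bracket (f + f') g = loop_bracket f g + loop_bracket f' g"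
proof -
  let ?A = "Poly_Mapping.keys f \<union> Poly_Mapping.keys f'"
  have "loop_bracket h g = (\<Sum>m\<in>?A. \<Sum>n\<in>Poly_Mapping.keys g.
     Poly_Mapping.single (m + n) (lie (Poly_Mapping.lookup h m) (Poly_Mapping.lookup g n)))"
    if "h \<in> {f, f', f + f'}" for h
    by (rule loop_bracket_superset) (use that Poly_Mapping.keys_add[of f f'] in auto)
  then show ?thesis
    by (simp add: lookup_add lie_add_left single_add sum.distrib)
qed

lemma loop_bracket_add_right: "loop_bracket f (g + g') = loop_bracket f g + loop_bracket f g'"
proof -
  let ?B = "Poly_Mapping.keys g \<union> Poly_Mapping.keys g'"
  have "loop_bracket f h = (\<Sum>m\<in>Poly_Mapping.keys f. \<Sum>n\<in>?B.
     Poly_Mapping.single (m + n) (lie (Poly_Mapping.lookup f m) (Poly_Mapping.lookup h n)))"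
    if "h \<in> {g, g', g + g'}" for h
    by (rule loop_bracket_superset) (use that Poly_Mapping.keys_add[of g g'] in auto)
  then show ?thesis
    by (simp add: lookup_add lie_add_right single_add sum.distrib)
qed

lemma loop_cocycle_add_left: "loop_cocycle (f + f') g = loop_cocycle f g + loop_cocycle f' g"
proof -
  let ?A = "Poly_Mapping.keys f \<union> Poly_Mapping.keys f'"
  have "loop_cocycle h g = (\<Sum>m\<in>?A.
     of_int m * bform (Poly_Mapping.lookup h m) (Poly_Mapping.lookup g (- m)))"
    if "h \<in> {f, f', f + f'}" for h
    by (rule loop_cocycle_superset) (use that Poly_Mapping.keys_add[of f f'] in auto)
  then show ?thesis
    by (simp add: lookup_add bform_add_left distrib_left sum.distrib)
qed

lemma loop_cocycle_add_right: "loop_cocycle f (g + g') = loop_cocycle f g + loop_cocycle f g'"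
  by (simp add: loop_cocycle_def lookup_add bform_add_right distrib_left sum.distrib)

lemma loop_bracket_single [simp]:
  "loop_bracket (Poly_Mapping.single m a) (Poly_Mapping.single n b)
     = Poly_Mapping.single (m + n) (lie a b)"
  using loop_bracket_superset[of "{m}" "{n}" "Poly_Mapping.single m a" "Poly_Mapping.single n b"]
  by (simp split: if_splits)

lemma loop_cocycle_single [simp]:
  "loop_cocycle (Poly_Mapping.single m a) (Poly_Mapping.single n b)
     = (if m = - n then of_int m * bform a b else 0)"
  using loop_cocycle_superset[of "{m}" "Poly_Mapping.single m a" "Poly_Mapping.single n b"]
  by (auto simp: lookup_single when_def split: if_splits)

lemma loop_bracket_zero [simp]: "loop_bracket 0 g = 0" "loop_bracket f 0 = 0"
  by (simp_all add: loop_bracket_def)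

lemma loop_cocycle_zero [simp]: "loop_cocycle 0 g = 0" "loop_cocycle f 0 = 0"
  by (simp_all add: loop_cocycle_def)

lemma loop_bracket_scale_left: "loop_bracket (c *\<^sub>C f) g = c *\<^sub>C loop_bracket f g"
proof -
  have "loop_bracket (c *\<^sub>C f) g = (\<Sum>m\<in>Poly_Mapping.keys f. \<Sum>n\<in>Poly_Mapping.keys g.
     Poly_Mapping.single (m + n)
       (lie (Poly_Mapping.lookup (c *\<^sub>C f) m) (Poly_Mapping.lookup g n)))"
    by (rule loop_bracket_superset) (auto simp: in_keys_iff)
  then show ?thesis
    by (simp add: loop_bracket_def cvs.scale_sum_right scaleC_single lie_scale_left)
qed

lemma loop_bracket_scale_right: "loop_bracket f (c *\<^sub>C g) = c *\<^sub>C loop_bracket f g"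
proof -
  have "loop_bracket f (c *\<^sub>C g) = (\<Sum>m\<in>Poly_Mapping.keys f. \<Sum>n\<in>Poly_Mapping.keys g.
     Poly_Mapping.single (m + n)
       (lie (Poly_Mapping.lookup f m) (Poly_Mapping.lookup (c *\<^sub>C g) n)))"
    by (rule loop_bracket_superset) (auto simp: in_keys_iff)
  then show ?thesis
    by (simp add: loop_bracket_def cvs.scale_sum_right scaleC_single lie_scale_right)
qed

lemma loop_cocycle_scale_left: "loop_cocycle (c *\<^sub>C f) g = c * loop_cocycle f g"
proof -
  have "loop_cocycle (c *\<^sub>C f) g = (\<Sum>m\<in>Poly_Mapping.keys f.
     of_int m * bform (Poly_Mapping.lookup (c *\<^sub>C f) m) (Poly_Mapping.lookup g (- m)))"
    by (rule loop_cocycle_superset) (auto simp: in_keys_iff)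
  then show ?thesis
    by (simp add: loop_cocycle_def sum_distrib_left bform_scale_left mult.left_commute)
qed

lemma loop_cocycle_scale_right: "loop_cocycle f (c *\<^sub>C g) = c * loop_cocycle f g"
  by (simp add: loop_cocycle_def sum_distrib_left bform_scale_right mult.left_commute)

lemma loop_bracket_skew: "loop_bracket f g = - loop_bracket g f"
proof (induction f rule: poly_mapping_add_induct)
  case zero
  then show ?case by simp
next
  case (add m a f)
  have "loop_bracket (Poly_Mapping.single m a) g = - loop_bracket g (Poly_Mapping.single m a)"
  proof (induction g rule: poly_mapping_add_induct)
    case (add n b g)
    then show ?case
      by (simp add: loop_bracket_add_left loop_bracket_add_right add.commute
        single_uminus[symmetric] lie_skew[of b a])
  qed simp
  with add show ?case
    by (simp add: loop_bracket_add_left loop_bracket_add_right)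
qed

lemma loop_cocycle_skew: "loop_cocycle f g = - loop_cocycle g f"
proof (induction f rule: poly_mapping_add_induct)
  case zero
  then show ?case by simp
next
  case (add m a f)
  have "loop_cocycle (Poly_Mapping.single m a) g = - loop_cocycle g (Poly_Mapping.single m a)"
  proof (induction g rule: poly_mapping_add_induct)
    case (add n b g)
    then show ?case
      by (auto simp: loop_cocycle_add_left loop_cocycle_add_right bform_sym[of b a])
  qed simp
  with add show ?case
    by (simp add: loop_cocycle_add_left loop_cocycle_add_right)
qed

lemma loop_bracket_jacobi:
  "loop_bracket f (loop_bracket g h) + loop_bracket g (loop_bracket h f)
     + loop_bracket h (loop_bracket f g) = 0" (is "?J f g h = 0")
proof -
  have J1: "?J (f + f') g h = ?J f g h + ?J f' g h" for f f' g h :: "int \<Rightarrow>\<^sub>0 'a"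
    by (simp add: loop_bracket_add_left loop_bracket_add_right algebra_simps)
  have J2: "?J f (g + g') h = ?J f g h + ?J f g' h" for f g g' h :: "int \<Rightarrow>\<^sub>0 'a"
    by (simp add: loop_bracket_add_left loop_bracket_add_right algebra_simps)
  have J3: "?J f g (h + h') = ?J f g h + ?J f g h'" for f g h h' :: "int \<Rightarrow>\<^sub>0 'a"
    by (simp add: loop_bracket_add_left loop_bracket_add_right algebra_simps)
  have S3: "?J (Poly_Mapping.single l a) (Poly_Mapping.single m b) h = 0" for l m and a b :: 'a and h
  proof (induction h rule: poly_mapping_add_induct)
    case (add n c h)
    have e: "m + (n + l) = l + (m + n)" "n + (l + m) = l + (m + n)" by simp_all
    have "?J (Poly_Mapping.single l a) (Poly_Mapping.single m b) (Poly_Mapping.single n c)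
        = Poly_Mapping.single (l + (m + n)) (lie a (lie b c) + lie b (lie c a) + lie c (lie a b))"
      by (simp only: loop_bracket_single e single_add)
    then show ?case unfolding J3 add by (simp only: jacobi single_zero add_0_right)
  qed simp
  have S2: "?J (Poly_Mapping.single l a) g h = 0" for l and a :: 'a and g h
  proof (induction g rule: poly_mapping_add_induct)
    case (add n c g)
    then show ?case by (simp only: J2 S3 add_0_right)
  qed simp
  show ?thesis
  proof (induction f rule: poly_mapping_add_induct)
    case (add n c f)
    then show ?case by (simp only: J1 S2 add_0_right)
  qed simp
qed

lemma loop_cocycle_jacobi:
  "loop_cocycle f (loop_bracket g h) + loop_cocycle g (loop_bracket h f)
     + loop_cocycle h (loop_bracket f g) = 0" (is "?J f g h = 0")
proof -
  have J1: "?J (f + f') g h = ?J f g h + ?J f' g h" for f f' g h :: "int \<Rightarrow>\<^sub>0 'a"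
    by (simp add: loop_bracket_add_left loop_bracket_add_right loop_cocycle_add_left
      loop_cocycle_add_right)
  have J2: "?J f (g + g') h = ?J f g h + ?J f g' h" for f g g' h :: "int \<Rightarrow>\<^sub>0 'a"
    by (simp add: loop_bracket_add_left loop_bracket_add_right loop_cocycle_add_left
      loop_cocycle_add_right)
  have J3: "?J f g (h + h') = ?J f g h + ?J f g h'" for f g h h' :: "int \<Rightarrow>\<^sub>0 'a"
    by (simp add: loop_bracket_add_left loop_bracket_add_right loop_cocycle_add_left
      loop_cocycle_add_right)
  have S3: "?J (Poly_Mapping.single l a) (Poly_Mapping.single m b) h = 0" for l m and a b :: 'a and h
  proof (induction h rule: poly_mapping_add_induct)
    case (add n c h)
    have i: "bform b (lie c a) = bform a (lie b c)" "bform c (lie a b) = bform a (lie b c)"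
      by (metis bform_invariant bform_sym)+
    have e: "(l = - (m + n)) = (l + m + n = 0)" "(m = - (n + l)) = (l + m + n = 0)"
      "(n = - (l + m)) = (l + m + n = 0)" by auto
    have "(of_int l + of_int m + of_int n :: complex) = 0" if "l + m + n = 0"
      using that by (metis of_int_0 of_int_add)
    then have "?J (Poly_Mapping.single l a) (Poly_Mapping.single m b)
        (Poly_Mapping.single n c) = 0"
      by (simp only: loop_bracket_single loop_cocycle_single e i distrib_right[symmetric]
        mult_zero_left add_0_right split: if_split) simp
    with add show ?case unfolding J3 by simp
  qed simp
  have S2: "?J (Poly_Mapping.single l a) g h = 0" for l and a :: 'a and g h
  proof (induction g rule: poly_mapping_add_induct)
    case (add n c g)
    then show ?case by (simp only: J2 S3 add_0_right)
  qed simp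
  show ?thesis
  proof (induction f rule: poly_mapping_add_induct)
    case (add n c f)
    then show ?case by (simp only: J1 S2 add_0_right)
  qed simp
qed

lemma eq_uminus_self_iff:
  fixes x :: "'a::complex_vector"
  assumes "x = - x" shows "x = 0"
proof -
  have "x + x = 0" using assms by (metis add.right_inverse)
  then have "(2::complex) *\<^sub>C x = 0"
    using scaleC_add_left[of 1 1 x] by (simp add: scaleC_one)
  then show ?thesis by (simp add: cvs.scale_eq_0_iff)
qed

instantiation affine :: (quadratic_lie_algebra) lie_algebra
begin
definition "lie x y = Affine (loop_bracket (loop_part x) (loop_part y))
  (loop_cocycle (loop_part x) (loop_part y))"
instance
proof
  fix x y z :: "'a affine" and c :: complex
  show "lie (x + y) z = lie x z + lie y z" "lie x (y + z) = lie x y + lie x z"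
    by (simp_all add: lie_affine_def plus_affine_def loop_bracket_add_left loop_cocycle_add_left
      loop_bracket_add_right loop_cocycle_add_right)
  show "lie (c *\<^sub>C x) y = c *\<^sub>C lie x y" "lie x (c *\<^sub>C y) = c *\<^sub>C lie x y"
    by (simp_all add: lie_affine_def scaleC_affine_def loop_bracket_scale_left
      loop_cocycle_scale_left loop_bracket_scale_right loop_cocycle_scale_right)
  show "lie x x = 0"
    using eq_uminus_self_iff[OF loop_bracket_skew[of "loop_part x" "loop_part x"]]
      loop_cocycle_skew[of "loop_part x" "loop_part x"]
    by (simp add: lie_affine_def zero_affine_def)
  show "lie x (lie y z) + lie y (lie z x) + lie z (lie x y) = 0"
    using loop_bracket_jacobi[of "loop_part x" "loop_part y" "loop_part z"]
      loop_cocycle_jacobi[of "loop_part x" "loop_part y" "loop_part z"]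
    by (simp add: lie_affine_def plus_affine_def zero_affine_def)
qed
end

definition affine_mode :: "'g::quadratic_lie_algebra \<Rightarrow> int \<Rightarrow> 'g affine" where
  "affine_mode a n = Affine (Poly_Mapping.single n a) 0"

definition affine_K :: "'g::quadratic_lie_algebra affine" where
  "affine_K = Affine 0 1"

lemma lie_affine_mode:
  "lie (affine_mode a m) (affine_mode b n)
     = affine_mode (lie a b) (m + n)
       + (if m = - n then of_int m * bform a b else 0) *\<^sub>C affine_K"
  by (simp add: affine_mode_def affine_K_def lie_affine_def plus_affine_def scaleC_affine_def
    cvs.scale_zero_right)

lemma lie_affine_K: "lie affine_K x = 0" "lie x affine_K = 0"
  by (simp_all add: affine_K_def lie_affine_def zero_affine_def)

text \<open>The subalgebra \<open>\<gg>[t] \<oplus> \<complex>K\<close>.\<close>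

typedef (overloaded) 'g affine_pos =
  "{x :: 'g::quadratic_lie_algebra affine. \<forall>n<0. Poly_Mapping.lookup (loop_part x) n = 0}"
  morphisms pos_incl Abs_affine_pos
  by (rule exI[of _ 0]) (simp add: zero_affine_def)

setup_lifting type_definition_affine_pos

lemma loop_bracket_pos:
  assumes "\<forall>n<0. Poly_Mapping.lookup f n = 0" "\<forall>n<0. Poly_Mapping.lookup g n = 0" "n < 0"
  shows "Poly_Mapping.lookup (loop_bracket f g) n = 0"
proof -
  have "k \<ge> 0" if "k \<in> Poly_Mapping.keys f \<union> Poly_Mapping.keys g" for k
    using that assms(1,2) by (auto simp: in_keys_iff not_less[symmetric])
  then have "k + l \<noteq> n" if "k \<in> Poly_Mapping.keys f" "l \<in> Poly_Mapping.keys g" for k l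
    using that assms(3) by (metis UnI1 UnI2 add_nonneg_nonneg not_less)
  then show ?thesis
    by (simp add: loop_bracket_def lookup_sum lookup_single when_def)
qed

instantiation affine_pos :: (quadratic_lie_algebra) lie_algebra
begin
lift_definition zero_affine_pos :: "'a affine_pos" is 0
  by (simp add: zero_affine_def)
lift_definition plus_affine_pos :: "'a affine_pos \<Rightarrow> 'a affine_pos \<Rightarrow> 'a affine_pos" is "(+)"
  by (simp add: plus_affine_def lookup_add)
lift_definition uminus_affine_pos :: "'a affine_pos \<Rightarrow> 'a affine_pos" is uminus
  by (simp add: uminus_affine_def)
lift_definition minus_affine_pos :: "'a affine_pos \<Rightarrow> 'a affine_pos \<Rightarrow> 'a affine_pos" is "(-)"
  by (simp add: minus_affine_def lookup_minus)
lift_definition scaleC_affine_pos :: "complex \<Rightarrow> 'a affine_pos \<Rightarrow> 'a affine_pos" is scaleC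
  by (simp add: scaleC_affine_def cvs.scale_zero_right)
lift_definition lie_affine_pos :: "'a affine_pos \<Rightarrow> 'a affine_pos \<Rightarrow> 'a affine_pos" is lie
  by (simp add: lie_affine_def loop_bracket_pos)
instance
proof
  fix x y z :: "'a affine_pos" and c d :: complex
  show "x + y + z = x + (y + z)" by transfer (rule add.assoc)
  show "x + y = y + x" by transfer (rule add.commute)
  show "0 + x = x" "- x + x = 0" "x - y = x + - y" by (transfer, simp)+
  show "c *\<^sub>C (x + y) = c *\<^sub>C x + c *\<^sub>C y" by transfer (rule scaleC_add_right)
  show "(c + d) *\<^sub>C x = c *\<^sub>C x + d *\<^sub>C x" by transfer (rule scaleC_add_left)
  show "c *\<^sub>C d *\<^sub>C x = (c * d) *\<^sub>C x" by transfer (rule scaleC_scaleC)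
  show "1 *\<^sub>C x = x" by transfer (rule scaleC_one)
  show "lie (x + y) z = lie x z + lie y z" by transfer (rule lie_add_left)
  show "lie x (y + z) = lie x y + lie x z" by transfer (rule lie_add_right)
  show "lie (c *\<^sub>C x) y = c *\<^sub>C lie x y" by transfer (rule lie_scale_left)
  show "lie x (c *\<^sub>C y) = c *\<^sub>C lie x y" by transfer (rule lie_scale_right)
  show "lie x x = 0" by transfer (rule lie_self)
  show "lie x (lie y z) + lie y (lie z x) + lie z (lie x y) = 0" by transfer (rule jacobi)
qed
end

lemma lie_hom_pos_incl: "lie_hom pos_incl"
  by (simp add: lie_hom_def clinear_iff plus_affine_pos.rep_eq scaleC_affine_pos.rep_eq
    lie_affine_pos.rep_eq)

lift_definition uea_pos_incl ::
  "'g::quadratic_lie_algebra affine_pos uea \<Rightarrow> 'g affine uea" is "free_map pos_incl"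
proof -
  fix p q :: "'g affine_pos free_alg"
  assume "uea_rel p q"
  then have "free_map pos_incl (p - q) \<in> uea_ideal"
    unfolding uea_rel_def by (rule free_map_ideal[OF lie_hom_pos_incl])
  then show "uea_rel (free_map pos_incl p) (free_map pos_incl q)"
    by (simp add: uea_rel_def free_map_def lin_ext_diff)
qed


section \<open>The six-dimensional Lie algebra\<close>

datatype torus_lie = Torus_Lie (alpha_part: "complex ^ 3") (beta_part: "complex ^ 3")

definition levi_civita :: "3 \<Rightarrow> 3 \<Rightarrow> 3 \<Rightarrow> complex" where
  "levi_civita i j k =
     (if (i, j, k) \<in> {(1, 2, 3), (2, 3, 1), (3, 1, 2)} then 1
      else if (i, j, k) \<in> {(1, 3, 2), (3, 2, 1), (2, 1, 3)} then - 1 else 0)"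

instantiation torus_lie :: quadratic_lie_algebra
begin
definition "0 = Torus_Lie 0 0"
definition "x + y = Torus_Lie (alpha_part x + alpha_part y) (beta_part x + beta_part y)"
definition "- x = Torus_Lie (- alpha_part x) (- beta_part x)"
definition "x - y = Torus_Lie (alpha_part x - alpha_part y) (beta_part x - beta_part y)"
definition "c *\<^sub>C x = Torus_Lie (c *s alpha_part x) (c *s beta_part x)"
definition "lie x y = Torus_Lie
  (\<chi> k. \<Sum>i\<in>UNIV. \<Sum>j\<in>UNIV. levi_civita i j k * (beta_part x $ i * beta_part y $ j)) 0"
definition "bform x y =
  (\<Sum>j\<in>UNIV. beta_part x $ j * alpha_part y $ j + alpha_part x $ j * beta_part y $ j)"
instance
proof
  fix x y z :: torus_lie and c d :: complex
  show "x + y + z = x + (y + z)" "x + y = y + x" "0 + x = x" "- x + x = 0" "x - y = x + - y"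
    by (simp_all add: plus_torus_lie_def zero_torus_lie_def uminus_torus_lie_def
      minus_torus_lie_def add.assoc add.commute)
  show "c *\<^sub>C (x + y) = c *\<^sub>C x + c *\<^sub>C y" "(c + d) *\<^sub>C x = c *\<^sub>C x + d *\<^sub>C x"
    "c *\<^sub>C d *\<^sub>C x = (c * d) *\<^sub>C x" "1 *\<^sub>C x = x"
    by (simp_all add: scaleC_torus_lie_def plus_torus_lie_def vec_eq_iff algebra_simps)
  show "lie (x + y) z = lie x z + lie y z" "lie x (y + z) = lie x y + lie x z"
    "lie (c *\<^sub>C x) y = c *\<^sub>C lie x y" "lie x (c *\<^sub>C y) = c *\<^sub>C lie x y"
    by (simp_all add: lie_torus_lie_def plus_torus_lie_def scaleC_torus_lie_def vec_eq_iff
      sum_distrib_left sum.distrib distrib_left distrib_right mult_ac)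
  show "lie x x = 0"
    by (simp add: lie_torus_lie_def zero_torus_lie_def vec_eq_iff forall_3 sum_3
      levi_civita_def)
  show "lie x (lie y z) + lie y (lie z x) + lie z (lie x y) = 0"
    by (simp add: lie_torus_lie_def zero_torus_lie_def plus_torus_lie_def vec_eq_iff)
  show "bform (x + y) z = bform x z + bform y z" "bform (c *\<^sub>C x) y = c * bform x y"
    by (simp_all add: bform_torus_lie_def plus_torus_lie_def scaleC_torus_lie_def
      sum_distrib_left sum.distrib algebra_simps)
  show "bform x y = bform y x"
    by (simp add: bform_torus_lie_def algebra_simps)
  show "bform (lie x y) z = bform x (lie y z)"
    by (simp add: bform_torus_lie_def lie_torus_lie_def sum_3 levi_civita_def algebra_simps)
  show "x = 0" if "\<And>y. bform x y = 0"
  proof -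
    have "beta_part x $ k = 0" "alpha_part x $ k = 0" for k
      using that[of "Torus_Lie (axis k 1) 0"] that[of "Torus_Lie 0 (axis k 1)"]
      by (simp_all add: bform_torus_lie_def axis_def if_distrib[of "(*) _"] cong: if_cong)
    then show ?thesis
      by (cases x) (simp add: zero_torus_lie_def vec_eq_iff)
  qed
qed
end

definition alpha :: "3 \<Rightarrow> torus_lie" where
  "alpha j = Torus_Lie (axis j 1) 0"

definition beta :: "3 \<Rightarrow> torus_lie" where
  "beta j = Torus_Lie 0 (axis j 1)"

lemma torus_lie_basis:
  "x = (\<Sum>j\<in>UNIV. alpha_part x $ j *\<^sub>C alpha j) + (\<Sum>j\<in>UNIV. beta_part x $ j *\<^sub>C beta j)"
  by (cases x) (simp add: sum_3 alpha_def beta_def scaleC_torus_lie_def plus_torus_lie_def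
    vec_eq_iff forall_3 axis_def)

lemma lie_alpha_beta:
  "lie (beta i) (beta j) = (\<Sum>k\<in>UNIV. levi_civita i j k *\<^sub>C alpha k)"
  "lie (alpha i) x = 0" "lie x (alpha i) = 0"
  using exhaust_3[of i] exhaust_3[of j]
  by (auto simp: lie_torus_lie_def alpha_def beta_def zero_torus_lie_def vec_eq_iff
    sum_3 scaleC_torus_lie_def plus_torus_lie_def forall_3 axis_def)

lemma bform_alpha_beta:
  "bform (beta i) (alpha j) = (if i = j then 1 else 0)"
  "bform (alpha i) (alpha j) = 0" "bform (beta i) (beta j) = 0"
  by (simp_all add: bform_torus_lie_def alpha_def beta_def axis_def if_distrib[of "(*) _"]
    cong: if_cong)


section \<open>Trigonometric polynomials on the torus\<close>

text \<open>A function on \<open>\<real>\<^sup>3 / \<int>\<^sup>3\<close> is a periodic function on \<^typ>\<open>real ^ 3\<close>.\<close>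

definition fourier :: "int ^ 3 \<Rightarrow> real ^ 3 \<Rightarrow> complex" where
  "fourier \<rho> x = exp (2 * of_real pi * \<i> * (\<Sum>j\<in>UNIV. of_int (\<rho> $ j) * of_real (x $ j)))"

lemma fourier_periodic: "fourier \<rho> (x + (\<chi> j. of_int (k $ j))) = fourier \<rho> x"
proof -
  have "fourier \<rho> (x + (\<chi> j. of_int (k $ j)))
      = exp (2 * of_real pi * \<i> * (\<Sum>j\<in>UNIV. of_int (\<rho> $ j) * of_real (x $ j))
          + 2 * of_real pi * \<i> * of_int (\<Sum>j\<in>UNIV. \<rho> $ j * k $ j))"
    by (simp add: fourier_def sum_3 algebra_simps)
  also have "\<dots> = fourier \<rho> x"
    unfolding fourier_def exp_add
    using exp_integer_2pi[of "of_int (\<Sum>j\<in>UNIV. \<rho> $ j * k $ j)"]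
    by (simp add: mult_ac del: of_int_sum)
  finally show ?thesis .
qed

lemma fourier_add: "fourier \<rho> * fourier \<sigma> = fourier (\<rho> + \<sigma>)"
  by (simp add: fun_eq_iff fourier_def exp_add[symmetric] sum.distrib algebra_simps)

lemma fourier_zero: "fourier 0 = 1"
  by (simp add: fun_eq_iff fourier_def)

lemma span_fourier_mult:
  assumes "f \<in> cvs.span (range fourier)" "g \<in> cvs.span (range fourier)"
  shows "f * g \<in> cvs.span (range fourier)"
proof -
  have lin: "clinear (\<lambda>f :: real ^ 3 \<Rightarrow> complex. f * g)" "clinear ((*) g)"
    for g :: "real ^ 3 \<Rightarrow> complex"
    by (simp_all add: clinear_iff fun_eq_iff scaleC_fun_def scaleC_complex_def algebra_simps)
  have "fourier \<rho> * g \<in> cvs.span (range fourier)" for \<rho>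
    by (rule clinear_preserves_span[OF lin(2) _ assms(2)])
      (auto simp: fourier_add intro: cvs.span_base)
  then show ?thesis
    by (intro clinear_preserves_span[OF lin(1) _ assms(1)]) auto
qed

definition partial :: "3 \<Rightarrow> (real ^ 3 \<Rightarrow> complex) \<Rightarrow> real ^ 3 \<Rightarrow> complex" where
  "partial j f x = vector_derivative (\<lambda>t. f (x + t *\<^sub>R axis j 1)) (at 0)"

definition has_partial ::
  "3 \<Rightarrow> (real ^ 3 \<Rightarrow> complex) \<Rightarrow> (real ^ 3 \<Rightarrow> complex) \<Rightarrow> bool" where
  "has_partial j f f' \<longleftrightarrow>
     (\<forall>x. ((\<lambda>t. f (x + t *\<^sub>R axis j 1)) has_vector_derivative f' x) (at 0))"

lemma has_partial_imp_partial: "has_partial j f f' \<Longrightarrow> partial j f = f'"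
  by (auto simp: has_partial_def partial_def fun_eq_iff intro: vector_derivative_at)

lemma has_partial_add:
  "has_partial j f f' \<Longrightarrow> has_partial j g g' \<Longrightarrow> has_partial j (f + g) (f' + g')"
  by (auto simp: has_partial_def intro: has_vector_derivative_add)

lemma has_partial_scale: "has_partial j f f' \<Longrightarrow> has_partial j (c *\<^sub>C f) (c *\<^sub>C f')"
  by (auto simp: has_partial_def scaleC_fun_def scaleC_complex_def
    intro: has_vector_derivative_mult_right)

lemma has_partial_fourier:
  "has_partial j (fourier \<rho>) ((2 * of_real pi * \<i> * of_int (\<rho> $ j)) *\<^sub>C fourier \<rho>)"
  unfolding has_partial_def
proof
  fix x :: "real ^ 3"
  let ?c = "2 * of_real pi * \<i> * of_int (\<rho> $ j) :: complex"
  have "fourier \<rho> (x + t *\<^sub>R axis j 1) = exp (of_real t * ?c) * fourier \<rho> x" for t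
    using exhaust_3[of j]
    by (auto simp: fourier_def exp_add[symmetric] sum_3 axis_def algebra_simps)
  moreover have "((\<lambda>t. exp (of_real t * ?c) * fourier \<rho> x) has_vector_derivative
      (?c * exp (of_real 0 * ?c)) * fourier \<rho> x) (at 0)"
    by (rule has_vector_derivative_mult_left, rule has_vector_derivative_real_field)
      (auto intro!: derivative_eq_intros)
  ultimately show "((\<lambda>t. fourier \<rho> (x + t *\<^sub>R axis j 1)) has_vector_derivative
      (?c *\<^sub>C fourier \<rho>) x) (at 0)"
    by (simp add: scaleC_fun_def scaleC_complex_def)
qed

lemma span_fourier_has_partial:
  assumes "f \<in> cvs.span (range fourier)"
  shows "partial j f \<in> cvs.span (range fourier) \<and> has_partial j f (partial j f)"
proof -
  let ?S = "{f. \<exists>f'\<in>cvs.span (range fourier). has_partial j f f'}"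
  have "has_partial j 0 0"
    by (simp add: has_partial_def)
  then have "cvs.subspace ?S"
    by (auto simp: cvs.subspace_def
      intro: bexI[OF _ cvs.span_zero] bexI[OF _ cvs.span_add] bexI[OF _ cvs.span_scale]
        has_partial_add has_partial_scale)
  moreover have "range fourier \<subseteq> ?S"
    using has_partial_fourier by (blast intro: cvs.span_scale cvs.span_base)
  ultimately have "f \<in> ?S"
    using cvs.span_minimal[of "range fourier" ?S] assms by blast
  then show ?thesis
    using has_partial_imp_partial by auto
qed

typedef torus_fun = "cvs.span (range fourier)"
  morphisms fun_of Abs_torus_fun
  using cvs.span_zero by blast

setup_lifting type_definition_torus_fun

instantiation torus_fun :: "{complex_vector, comm_ring_1}"
begin
lift_definition zero_torus_fun :: torus_fun is 0 by (rule cvs.span_zero)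
lift_definition one_torus_fun :: torus_fun is "\<lambda>x. 1"
  using cvs.span_base[OF rangeI, of fourier 0] by (simp add: fourier_zero one_fun_def)
lift_definition plus_torus_fun :: "torus_fun \<Rightarrow> torus_fun \<Rightarrow> torus_fun" is "(+)"
  by (rule cvs.span_add)
lift_definition uminus_torus_fun :: "torus_fun \<Rightarrow> torus_fun" is uminus
  by (rule cvs.span_neg)
lift_definition minus_torus_fun :: "torus_fun \<Rightarrow> torus_fun \<Rightarrow> torus_fun" is "(-)"
  by (rule cvs.span_diff)
lift_definition times_torus_fun :: "torus_fun \<Rightarrow> torus_fun \<Rightarrow> torus_fun" is "(*)"
  by (rule span_fourier_mult)
lift_definition scaleC_torus_fun :: "complex \<Rightarrow> torus_fun \<Rightarrow> torus_fun" is scaleC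
  by (rule cvs.span_scale)
instance
proof
  fix f g h :: torus_fun and c d :: complex
  show "f + g + h = f + (g + h)" by transfer (rule add.assoc)
  show "f + g = g + f" by transfer (rule add.commute)
  show "0 + f = f" "- f + f = 0" "f - g = f + - g" by (transfer, simp)+
  show "c *\<^sub>C (f + g) = c *\<^sub>C f + c *\<^sub>C g" by transfer (rule scaleC_add_right)
  show "(c + d) *\<^sub>C f = c *\<^sub>C f + d *\<^sub>C f" by transfer (rule scaleC_add_left)
  show "c *\<^sub>C d *\<^sub>C f = (c * d) *\<^sub>C f" by transfer (rule scaleC_scaleC)
  show "1 *\<^sub>C f = f" by transfer (rule scaleC_one)
  show "f * g * h = f * (g * h)" by transfer (rule mult.assoc)
  show "f * g = g * f" by transfer (rule mult.commute)
  show "1 * f = f" by transfer (simp add: fun_eq_iff)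
  show "(f + g) * h = f * h + g * h" by transfer (rule distrib_right)
  show "(0::torus_fun) \<noteq> 1" by transfer (simp add: fun_eq_iff)
qed
end

lift_definition expo :: "int ^ 3 \<Rightarrow> torus_fun" is fourier
  by (rule cvs.span_base) simp

lift_definition torus_partial :: "3 \<Rightarrow> torus_fun \<Rightarrow> torus_fun" is partial
  using span_fourier_has_partial by blast

lemma torus_fun_induct [case_names expo add scale]:
  assumes "\<And>\<rho>. P (expo \<rho>)" "\<And>f g. P f \<Longrightarrow> P g \<Longrightarrow> P (f + g)" "\<And>c f. P f \<Longrightarrow> P (c *\<^sub>C f)"
  shows "P f"
proof -
  let ?S = "{f. \<exists>g. f = fun_of g \<and> P g}"
  have "P 0" using assms(3)[of "expo 0" 0, OF assms(1)] by (simp add: cvs.scale_zero_left)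
  then have "0 \<in> ?S" by (metis (mono_tags) mem_Collect_eq zero_torus_fun.rep_eq)
  moreover have "x + y \<in> ?S" if "x \<in> ?S" "y \<in> ?S" for x y
    using that assms(2) plus_torus_fun.rep_eq by (smt (verit) mem_Collect_eq)
  moreover have "c *\<^sub>C x \<in> ?S" if "x \<in> ?S" for x c
    using that assms(3) scaleC_torus_fun.rep_eq by (smt (verit) mem_Collect_eq)
  ultimately have "cvs.subspace ?S"
    unfolding cvs.subspace_def by blast
  moreover have "range fourier \<subseteq> ?S"
    using assms(1) by (auto simp: expo.rep_eq[symmetric])
  ultimately have "fun_of f \<in> ?S"
    using cvs.span_minimal[of "range fourier" ?S] fun_of[of f] by blast
  then show ?thesis
    by (auto simp: fun_of_inject)
qed

lemma torus_partial_expo: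
  "torus_partial j (expo \<rho>) = (2 * of_real pi * \<i> * of_int (\<rho> $ j)) *\<^sub>C expo \<rho>"
  by transfer (rule has_partial_imp_partial[OF has_partial_fourier])

lemma clinear_torus_partial: "clinear (torus_partial j)"
  unfolding clinear_iff
proof (intro conjI allI)
  fix f g c
  show "torus_partial j (f + g) = torus_partial j f + torus_partial j g"
    by transfer
      (simp add: has_partial_imp_partial has_partial_add span_fourier_has_partial)
  show "torus_partial j (c *\<^sub>C f) = c *\<^sub>C torus_partial j f"
    by transfer
      (simp add: has_partial_imp_partial has_partial_scale span_fourier_has_partial)
qed

lemma torus_partial_commute:
  "torus_partial i (torus_partial j f) = torus_partial j (torus_partial i f)"
proof (induction f rule: torus_fun_induct)
  case (expo \<rho>)
  show ?case
    using clinear_torus_partial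
    by (simp add: torus_partial_expo clinear_iff scaleC_scaleC mult.commute)
next
  case (add f g)
  then show ?case using clinear_torus_partial by (simp add: clinear_iff)
next
  case (scale c f)
  then show ?case using clinear_torus_partial by (simp add: clinear_iff)
qed


section \<open>The induced module\<close>

definition C0_act :: "torus_lie \<Rightarrow> torus_fun \<Rightarrow> torus_fun" where
  "C0_act a f = (\<Sum>j\<in>UNIV. beta_part a $ j *\<^sub>C torus_partial j f)"

lemma C0_act_alpha: "C0_act (alpha j) f = 0"
  by (simp add: C0_act_def alpha_def cvs.scale_zero_left)

lemma C0_act_beta: "C0_act (beta j) f = torus_partial j f"
proof -
  have "C0_act (beta j) f = (\<Sum>k\<in>UNIV. if k = j then torus_partial k f else 0)"
    unfolding C0_act_def
    by (rule sum.cong) (auto simp: beta_def axis_def scaleC_one cvs.scale_zero_left)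
  then show ?thesis by simp
qed

text \<open>The action of \<open>\<gg>[t] \<oplus> \<complex>K\<close>: the coefficient of \<open>t\<^sup>0\<close> acts through \<^const>\<open>C0_act\<close>, those
  of higher powers by zero, and \<open>K\<close> by the identity.\<close>

definition C0_pos_act :: "torus_lie affine_pos \<Rightarrow> torus_fun \<Rightarrow> torus_fun" where
  "C0_pos_act x f = C0_act (Poly_Mapping.lookup (loop_part (pos_incl x)) 0) f
     + central_part (pos_incl x) *\<^sub>C f"

lemma C0_act_bilinear:
  "C0_act (a + b) f = C0_act a f + C0_act b f" "C0_act (c *\<^sub>C a) f = c *\<^sub>C C0_act a f"
  "C0_act a (f + g) = C0_act a f + C0_act a g" "C0_act a (c *\<^sub>C f) = c *\<^sub>C C0_act a f"
  using clinear_torus_partial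
  by (simp_all add: C0_act_def plus_torus_lie_def scaleC_torus_lie_def clinear_iff
    scaleC_add_left scaleC_add_right sum.distrib cvs.scale_sum_right scaleC_scaleC mult.commute)

lemma C0_act_commute: "C0_act a (C0_act b f) = C0_act b (C0_act a f)"
proof -
  have expand: "C0_act a (C0_act b f) = (\<Sum>j\<in>UNIV. \<Sum>k\<in>UNIV.
      (beta_part a $ j * beta_part b $ k) *\<^sub>C torus_partial j (torus_partial k f))" for a b
  proof -
    have "torus_partial j (sum g UNIV) = (\<Sum>k\<in>UNIV. torus_partial j (g k))"
      for j and g :: "3 \<Rightarrow> torus_fun"
      using clinear_torus_partial by (simp add: sum_3 clinear_iff)
    then show ?thesis
      using clinear_torus_partial
      by (simp add: C0_act_def clinear_iff cvs.scale_sum_right scaleC_scaleC)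
  qed
  show ?thesis
    unfolding expand by (subst sum.swap) (simp add: torus_partial_commute mult.commute)
qed

lemma lie_rep_C0_pos_act: "lie_rep C0_pos_act"
  unfolding lie_rep_def
proof (intro conjI allI)
  fix x y :: "torus_lie affine_pos" and f :: torus_fun
  show "clinear (C0_pos_act x)"
    by (simp add: clinear_iff C0_pos_act_def C0_act_bilinear scaleC_add_right scaleC_scaleC
      mult.commute)
  show "clinear (\<lambda>x. C0_pos_act x f)"
    by (simp add: clinear_iff C0_pos_act_def C0_act_bilinear scaleC_add_left scaleC_add_right
      scaleC_scaleC plus_affine_pos.rep_eq scaleC_affine_pos.rep_eq plus_affine_def
      scaleC_affine_def lookup_add)
  let ?f = "loop_part (pos_incl x)" and ?g = "loop_part (pos_incl y)"
  have pos: "Poly_Mapping.lookup ?f n = 0" "Poly_Mapping.lookup ?g n = 0" if "n < 0" for n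
    using pos_incl[of x] pos_incl[of y] that by auto
  have "of_int m * bform (Poly_Mapping.lookup ?f m) (Poly_Mapping.lookup ?g (- m)) = 0" for m
    using pos[of m] pos[of "- m"] by (cases m "0::int" rule: linorder_cases) auto
  then have cocycle: "loop_cocycle ?f ?g = 0"
    unfolding loop_cocycle_def by (intro sum.neutral ballI)
  have beta_sum: "beta_part (sum h A) = (\<Sum>a\<in>A. beta_part (h a))"
    for h :: "int \<Rightarrow> torus_lie" and A
    by (induction A rule: infinite_finite_induct) (simp_all add: zero_torus_lie_def plus_torus_lie_def)
  have "beta_part (Poly_Mapping.lookup (loop_bracket ?f ?g) 0) = 0"
    by (simp add: loop_bracket_def lookup_sum beta_sum lookup_single when_def lie_torus_lie_def
      zero_torus_lie_def if_distrib[of beta_part] cong: if_cong)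
  then have "C0_pos_act (lie x y) f = 0"
    by (simp add: C0_pos_act_def lie_affine_pos.rep_eq lie_affine_def cocycle C0_act_def
      cvs.scale_zero_left)
  moreover have "C0_pos_act x (C0_pos_act y f) = C0_pos_act y (C0_pos_act x f)"
    by (simp add: C0_pos_act_def C0_act_bilinear scaleC_add_right scaleC_scaleC mult.commute
      C0_act_commute[of "Poly_Mapping.lookup ?f 0"])
  ultimately show "C0_pos_act (lie x y) f
      = C0_pos_act x (C0_pos_act y f) - C0_pos_act y (C0_pos_act x f)"
    by simp
qed

lift_definition C0_uea_act :: "torus_lie affine_pos uea \<Rightarrow> torus_fun \<Rightarrow> torus_fun"
  is "free_act C0_pos_act"
proof
  fix p q :: "torus_lie affine_pos free_alg" and f
  assume "uea_rel p q"
  then have "free_act C0_pos_act (p - q) f = 0"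
    unfolding uea_rel_def by (rule free_act_ideal[OF lie_rep_C0_pos_act])
  then show "free_act C0_pos_act p f = free_act C0_pos_act q f"
    by (simp add: free_act_diff)
qed

text \<open>The tensor product of the right module \<open>U(\<gg>\<^sup>^)\<close> with the left module \<open>C\<^sub>0\<close> over
  \<open>U(\<gg>[t] \<oplus> \<complex>K)\<close>: the vector space with basis all pairs \<open>(u, f)\<close>, modulo bilinearity and
  \<open>u h \<otimes> f = u \<otimes> h f\<close>.\<close>

definition ind_relators :: "(torus_lie affine uea \<times> torus_fun \<Rightarrow>\<^sub>0 complex) set" where
  "ind_relators =
     {bas (u + u', f) - bas (u, f) - bas (u', f) | u u' f. True} \<union>
     {bas (u, f + f') - bas (u, f) - bas (u, f') | u f f'. True} \<union>
     {bas (c *\<^sub>C u, f) - c *\<^sub>C bas (u, f) | c u f. True} \<union>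
     {bas (u, c *\<^sub>C f) - c *\<^sub>C bas (u, f) | c u f. True} \<union>
     {bas (u * uea_pos_incl h, f) - bas (u, C0_uea_act h f) | u h f. True}"

definition ind_rel where
  "ind_rel p q \<longleftrightarrow> p - q \<in> cvs.span ind_relators"

quotient_type V_torus = "torus_lie affine uea \<times> torus_fun \<Rightarrow>\<^sub>0 complex" / ind_rel
  unfolding ind_rel_def by (rule equivp_span_diff)

instantiation V_torus :: complex_vector
begin
lift_definition zero_V_torus :: V_torus is 0 .
lift_definition plus_V_torus :: "V_torus \<Rightarrow> V_torus \<Rightarrow> V_torus" is "(+)"
  unfolding ind_rel_def by (simp only: add_diff_add cvs.span_add)
lift_definition uminus_V_torus :: "V_torus \<Rightarrow> V_torus" is uminus
  unfolding ind_rel_def by (simp only: minus_diff_minus cvs.span_neg)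
lift_definition minus_V_torus :: "V_torus \<Rightarrow> V_torus \<Rightarrow> V_torus" is "(-)"
  unfolding ind_rel_def by (rule span_diff_diff)
lift_definition scaleC_V_torus :: "complex \<Rightarrow> V_torus \<Rightarrow> V_torus" is scaleC
  unfolding ind_rel_def by (simp only: cvs.scale_right_diff_distrib[symmetric] cvs.span_scale)
instance
proof
  have rel: "ind_rel p q" if "p = q" for p q
    using that by (simp add: ind_rel_def cvs.span_zero)
  fix a b c :: V_torus and k l :: complex
  show "a + b + c = a + (b + c)" by transfer (rule rel, rule add.assoc)
  show "a + b = b + a" by transfer (rule rel, rule add.commute)
  show "0 + a = a" by transfer (rule rel, simp)
  show "- a + a = 0" by transfer (rule rel, simp)
  show "a - b = a + - b" by transfer (rule rel, simp)
  show "k *\<^sub>C (a + b) = k *\<^sub>C a + k *\<^sub>C b" by transfer (rule rel, rule scaleC_add_right)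
  show "(k + l) *\<^sub>C a = k *\<^sub>C a + l *\<^sub>C a" by transfer (rule rel, rule scaleC_add_left)
  show "k *\<^sub>C l *\<^sub>C a = (k * l) *\<^sub>C a" by transfer (rule rel, rule scaleC_scaleC)
  show "1 *\<^sub>C a = a" by transfer (rule rel, rule scaleC_one)
qed
end

definition ind_tensor :: "torus_lie affine uea \<Rightarrow> torus_fun \<Rightarrow> V_torus" where
  "ind_tensor u f = abs_V_torus (bas (u, f))"

text \<open>The action \<open>u \<cdot> (u' \<otimes> f) = u u' \<otimes> f\<close>, computed on a representative.\<close>

definition V_act :: "torus_lie affine uea \<Rightarrow> V_torus \<Rightarrow> V_torus" where
  "V_act u v = abs_V_torus (lin_ext (\<lambda>(u', f). bas (u * u', f)) (rep_V_torus v))"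

lemma ind_rel_left_mult:
  fixes u :: "torus_lie affine uea"
  assumes "ind_rel p q"
  shows "ind_rel (lin_ext (\<lambda>(u', f). bas (u * u', f)) p)
    (lin_ext (\<lambda>(u', f). bas (u * u', f)) q)"
proof -
  let ?F = "lin_ext (\<lambda>(u', f). bas (u * u', f)) ::
    (torus_lie affine uea \<times> torus_fun \<Rightarrow>\<^sub>0 complex) \<Rightarrow> _"
  have uscale: "u * (c *\<^sub>C u') = c *\<^sub>C (u * u')" for c u'
    by transfer (simp add: free_alg_scale_right uea_rel_def uea_ideal_def cvs.span_zero)
  have "p - q \<in> cvs.span ind_relators" using assms by (simp add: ind_rel_def)
  then have "?F (p - q) \<in> cvs.span ind_relators"
  proof (rule clinear_preserves_span[OF clinear_lin_ext, rotated])
    fix r :: "torus_lie affine uea \<times> torus_fun \<Rightarrow>\<^sub>0 complex"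
    assume "r \<in> ind_relators"
    then consider
        v v' f where "r = bas (v + v', f) - bas (v, f) - bas (v', f)"
      | v f f' where "r = bas (v, f + f') - bas (v, f) - bas (v, f')"
      | c v f where "r = bas (c *\<^sub>C v, f) - c *\<^sub>C bas (v, f)"
      | c v f where "r = bas (v, c *\<^sub>C f) - c *\<^sub>C bas (v, f)"
      | v h f where "r = bas (v * uea_pos_incl h, f) - bas (v, C0_uea_act h f)"
      unfolding ind_relators_def by blast
    then have "?F r \<in> ind_relators"
    proof cases
      case (1 v v' f)
      then have "?F r = bas (u * v + u * v', f) - bas (u * v, f) - bas (u * v', f)"
        by (simp add: lin_ext_diff scaleC_one distrib_left)
      then show ?thesis unfolding ind_relators_def by blast
    next
      case (2 v f f')
      then have "?F r = bas (u * v, f + f') - bas (u * v, f) - bas (u * v, f')"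
        by (simp add: lin_ext_diff scaleC_one)
      then show ?thesis unfolding ind_relators_def by blast
    next
      case (3 c v f)
      then have "?F r = bas (c *\<^sub>C (u * v), f) - c *\<^sub>C bas (u * v, f)"
        by (simp add: lin_ext_diff lin_ext_scale scaleC_one uscale)
      then show ?thesis unfolding ind_relators_def by blast
    next
      case (4 c v f)
      then have "?F r = bas (u * v, c *\<^sub>C f) - c *\<^sub>C bas (u * v, f)"
        by (simp add: lin_ext_diff lin_ext_scale scaleC_one)
      then show ?thesis unfolding ind_relators_def by blast
    next
      case (5 v h f)
      then have "?F r = bas (u * v * uea_pos_incl h, f) - bas (u * v, C0_uea_act h f)"
        by (simp add: lin_ext_diff scaleC_one mult.assoc)
      then show ?thesis unfolding ind_relators_def by blast
    qed
    then show "?F r \<in> cvs.span ind_relators" by (rule cvs.span_base)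
  qed
  then show "ind_rel (?F p) (?F q)"
    by (simp add: ind_rel_def lin_ext_diff)
qed

lemma V_act_abs: "V_act u (abs_V_torus p) = abs_V_torus (lin_ext (\<lambda>(u', f). bas (u * u', f)) p)"
proof -
  have "ind_rel (rep_V_torus (abs_V_torus p)) p"
    by (rule Quotient3_rep_abs[OF Quotient3_V_torus]) (simp add: ind_rel_def cvs.span_zero)
  then show ?thesis
    unfolding V_act_def V_torus.abs_eq_iff by (rule ind_rel_left_mult)
qed

lemma V_act_tensor: "V_act u (ind_tensor u' f) = ind_tensor (u * u') f"
  by (simp add: ind_tensor_def V_act_abs scaleC_one)

lemma ind_tensor_balanced:
  "ind_tensor (u * uea_pos_incl h) f = ind_tensor u (C0_uea_act h f)"
  unfolding ind_tensor_def V_torus.abs_eq_iff ind_rel_def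
  by (rule cvs.span_base) (unfold ind_relators_def, blast)

text \<open>The operators \<open>a\<^sub>n\<close> on the induced module.\<close>

definition act :: "torus_lie \<Rightarrow> int \<Rightarrow> V_torus \<Rightarrow> V_torus" where
  "act a n = V_act (uea_gen (affine_mode a n))"

definition of_C0 :: "torus_fun \<Rightarrow> V_torus" where
  "of_C0 f = ind_tensor 1 f"

definition vac :: V_torus where
  "vac = of_C0 1"


section \<open>Vertex algebras\<close>

text \<open>An operator-valued formal distribution \<open>a(z) = \<Sum>\<^sub>n a\<^sub>n z\<^sup>-\<^sup>1\<^sup>-\<^sup>n\<close> is represented by the
  function \<open>n \<mapsto> a\<^sub>n\<close>. It lies in \<open>Hom(V, V((z)))\<close> if every mode is linear and every vector is
  annihilated by all modes of sufficiently high index.\<close>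

type_synonym 'v distribution = "int \<Rightarrow> 'v \<Rightarrow> 'v"

definition is_field :: "'v::complex_vector distribution \<Rightarrow> bool" where
  "is_field a \<longleftrightarrow> (\<forall>n. clinear (a n)) \<and> (\<forall>v. \<exists>N. \<forall>n\<ge>N. a n v = 0)"

definition id_field :: "'v::complex_vector distribution" where
  "id_field n v = (if n = -1 then v else 0)"

definition dz :: "'v::complex_vector distribution \<Rightarrow> 'v distribution" where
  "dz a n v = - of_int n *\<^sub>C a (n - 1) v"

text \<open>The coefficient of \<open>z\<^sub>1\<^sup>-\<^sup>1\<^sup>-\<^sup>m z\<^sub>2\<^sup>-\<^sup>1\<^sup>-\<^sup>n\<close> in \<open>[a(z\<^sub>1), b(z\<^sub>2)]\<close>, and multiplication of a
  distribution in two variables, indexed in the same way, by \<open>z\<^sub>1 - z\<^sub>2\<close>.\<close>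

definition commutator ::
  "'v::complex_vector distribution \<Rightarrow> 'v distribution \<Rightarrow> int \<Rightarrow> int \<Rightarrow> 'v \<Rightarrow> 'v" where
  "commutator a b m n v = a m (b n v) - b n (a m v)"

definition mult_z1_minus_z2 ::
  "(int \<Rightarrow> int \<Rightarrow> 'v \<Rightarrow> 'v::complex_vector) \<Rightarrow> int \<Rightarrow> int \<Rightarrow> 'v \<Rightarrow> 'v" where
  "mult_z1_minus_z2 D m n v = D (m + 1) n v - D m (n + 1) v"

text \<open>\<open>T v = \<partial>\<^sub>z Y(v, z) \<one> |\<^bsub>z = 0\<^esub>\<close>; the constant coefficient is the mode of index \<open>-1\<close>.\<close>

definition translation ::
  "'v::complex_vector \<Rightarrow> ('v \<Rightarrow> 'v distribution) \<Rightarrow> 'v \<Rightarrow> 'v" where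
  "translation one Y v = dz (Y v) (-1) one"

locale vertex_algebra =
  fixes one :: "'v::complex_vector" and Y :: "'v \<Rightarrow> 'v distribution"
  assumes Y_linear: "clinear Y"
    and Y_field: "is_field (Y v)"
    and Y_vacuum: "Y one = id_field"
    and Y_creation: "n \<ge> 0 \<Longrightarrow> Y v n one = 0"
    and Y_creation_value: "Y v (-1) one = v"
    and Y_translation: "translation one Y (Y v n w) - Y v n (translation one Y w) = dz (Y v) n w"
    and Y_local: "\<exists>N. (mult_z1_minus_z2 ^^ N) (commutator (Y v1) (Y v2)) = (\<lambda>m n w. 0)"


section \<open>The state-field correspondence\<close>

text \<open>The sums below have only finitely many nonzero terms whenever \<open>a\<close> and \<open>b\<close> are fields; the
  first is \<open>a(z)\<^sub>+ b(z)\<close> and the second is \<open>b(z) a(z)\<^sub>-\<close>.\<close>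

definition normal_product ::
  "'v::complex_vector distribution \<Rightarrow> 'v distribution \<Rightarrow> 'v distribution" where
  "normal_product a b n v =
     Sum_any (\<lambda>j. if j \<le> -1 then a j (b (n - 1 - j) v) else 0) +
     Sum_any (\<lambda>j. if j \<ge> 0 then b (n - 1 - j) (a j v) else 0)"

definition dz_divided :: "nat \<Rightarrow> 'v::complex_vector distribution \<Rightarrow> 'v distribution" where
  "dz_divided k a = (1 / fact k) *\<^sub>C (dz ^^ k) a"

text \<open>For a formal power series \<open>A(w) = \<Sum>\<^sub>m A\<^sub>m w\<^sup>m\<close> of operators, \<open>series_power A k m\<close> is the
  coefficient of \<open>w\<^sup>m\<close> in \<open>A(w)\<^sup>k\<close>. If \<open>A\<^sub>0 = 0\<close> then this vanishes for \<open>k > m\<close>, hence the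
  truncated sum in the exponential.\<close>

primrec series_power :: "(nat \<Rightarrow> 'v \<Rightarrow> 'v::complex_vector) \<Rightarrow> nat \<Rightarrow> nat \<Rightarrow> 'v \<Rightarrow> 'v" where
  "series_power A 0 m v = (if m = 0 then v else 0)"
| "series_power A (Suc k) m v = (\<Sum>i\<le>m. A i (series_power A k (m - i) v))"

definition series_exp :: "(nat \<Rightarrow> 'v \<Rightarrow> 'v::complex_vector) \<Rightarrow> nat \<Rightarrow> 'v \<Rightarrow> 'v" where
  "series_exp A m v = (\<Sum>k\<le>m. (1 / fact k) *\<^sub>C series_power A k m v)"

definition x_mode :: "3 \<Rightarrow> int \<Rightarrow> V_torus \<Rightarrow> V_torus" where
  "x_mode j n v = (- 1 / of_int n) *\<^sub>C act (alpha j) n v"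

definition rho_x :: "int ^ 3 \<Rightarrow> int \<Rightarrow> V_torus \<Rightarrow> V_torus" where
  "rho_x \<rho> n v = (\<Sum>j\<in>UNIV. (2 * of_real pi * \<i> * of_int (\<rho> $ j)) *\<^sub>C x_mode j n v)"

definition is_shift_operator :: "int ^ 3 \<Rightarrow> (V_torus \<Rightarrow> V_torus) \<Rightarrow> bool" where
  "is_shift_operator \<rho> E \<longleftrightarrow>
     clinear E \<and>
     (\<forall>f. E (of_C0 f) = of_C0 (expo \<rho> * f)) \<and>
     (\<forall>j n v. act (alpha j) n (E v) - E (act (alpha j) n v) = 0) \<and>
     (\<forall>j n v. act (beta j) n (E v) - E (act (beta j) n v)
        = (2 * of_real pi * \<i> * of_int (\<rho> $ j) * (if n = 0 then 1 else 0)) *\<^sub>C E v)"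

definition shift_operator :: "int ^ 3 \<Rightarrow> V_torus \<Rightarrow> V_torus" where
  "shift_operator \<rho> = (THE E. is_shift_operator \<rho> E)"

text \<open>The coefficients of \<open>z\<^sup>p\<close> and of \<open>z\<^sup>-\<^sup>q\<close> in the two exponentials.\<close>

definition exp_neg :: "int ^ 3 \<Rightarrow> nat \<Rightarrow> V_torus \<Rightarrow> V_torus" where
  "exp_neg \<rho> p = series_exp (\<lambda>m v. if m = 0 then 0 else rho_x \<rho> (- int m) v) p"

definition exp_pos :: "int ^ 3 \<Rightarrow> nat \<Rightarrow> V_torus \<Rightarrow> V_torus" where
  "exp_pos \<rho> q = series_exp (\<lambda>m v. if m = 0 then 0 else rho_x \<rho> (int m) v) q"

text \<open>The mode of index \<open>n\<close> collects the terms with \<open>p - q = -1 - n\<close>; on each vector only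
  finitely many \<open>q\<close> contribute.\<close>

definition expo_field :: "int ^ 3 \<Rightarrow> V_torus distribution" where
  "expo_field \<rho> n v = shift_operator \<rho> (Sum_any (\<lambda>q.
     if int q - 1 - n \<ge> 0 then exp_neg \<rho> (nat (int q - 1 - n)) (exp_pos \<rho> q v) else 0))"

definition is_state_field :: "(V_torus \<Rightarrow> V_torus distribution) \<Rightarrow> bool" where
  "is_state_field Y \<longleftrightarrow>
     clinear Y \<and>
     (\<forall>j. Y (act (alpha j) (-1) vac) = act (alpha j)) \<and>
     (\<forall>j. Y (act (beta j) (-1) vac) = act (beta j)) \<and>
     (\<forall>\<rho>. Y (of_C0 (expo \<rho>)) = expo_field \<rho>) \<and>
     (\<forall>as \<rho>. (\<forall>(a, n)\<in>set as. n \<ge> 1) \<longrightarrow>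
        Y (foldr (\<lambda>(a, n). act a (- int n)) as (of_C0 (expo \<rho>)))
        = foldr (\<lambda>(a, n). normal_product (dz_divided (n - 1) (Y (act a (-1) vac))))
            as (Y (of_C0 (expo \<rho>))))"

definition Y_torus :: "V_torus \<Rightarrow> V_torus distribution" where
  "Y_torus = (THE Y. is_state_field Y)"

end

theory Submission
  imports Defs
begin

text \<open>
  Everything follows from three facts about the generating fields, namely the currents \<open>a(z)\<close> and
  the fields of the exponentials: they are mutually local, they are covariant under one translation
  operator \<open>T\<close> that annihilates the vacuum, and they create their states from the vacuum.

  Derivatives and normally ordered products of such fields are again of this kind; the only hard
  part of this is Dong's lemma (\<open>mutually_local_normal_product\<close>). A field of this kind is
  determined by the state that it creates (Goddard's uniqueness theorem,
  \<open>field_zero_if_state_zero\<close>). The iterated normally ordered products create the vectors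
  \<open>a\<^sup>1\<^sub>-\<^sub>n\<^sub>1 \<dots> a\<^sup>r\<^sub>-\<^sub>n\<^sub>r e\<close>, which span the space, so that every vector is created by exactly
  one field in the span of these products, the currents and the identity field. This defines \<open>Y\<close>, and the axioms of a
  vertex algebra are then the properties just listed. It is consistent although one vector can be
  written in terms of the spanning vectors in many ways, because uniqueness forces every linear
  relation between states on the fields that create them.

  The operators needed on the induced module come from its universal property
  (\<open>level_one_module\<close>). The shift operator of \<open>\<rho>\<close> is the homomorphism into the same module with
  the zero modes of the currents shifted by scalars, and \<open>T\<close> is a homomorphism into the module
  over the dual numbers that encodes the derivation \<open>a\<^sub>n \<mapsto> - n a\<^sub>n\<^sub>-\<^sub>1\<close>.

  For the exponential fields \<open>F(z) = \<Sum>\<^sub>n F\<^sub>n z\<^sup>-\<^sup>1\<^sup>-\<^sup>n\<close> the one essential computation is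
  \<open>[a\<^sub>m, F\<^sub>n] = c F\<^sub>m\<^sub>+\<^sub>n\<close>, where \<open>c\<close> is the eigenvalue of \<open>a\<close> on the exponential
  (\<open>act_expo_field\<close>). Since \<open>C\<^sub>0\<close> generates the module, this reduces every other assertion about
  \<open>F\<close>, such as commutativity of two exponential fields and covariance, to the subspace \<open>C\<^sub>0\<close>, where
  the annihilation modes in \<open>F\<close> drop out.
\<close>

section \<open>Linear maps and fields\<close>

lemma clinear_add: "clinear f \<Longrightarrow> f (x + y) = f x + f y"
  by (simp add: clinear_iff)

lemma clinear_scale: "clinear f \<Longrightarrow> f (c *\<^sub>C x) = c *\<^sub>C f x"
  by (simp add: clinear_iff)

lemma clinear_uminus: "clinear f \<Longrightarrow> f (- x) = - f x"
  using clinear_diff[of f 0 x] by (simp add: clinear_zero)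

lemma clinear_sum: "clinear f \<Longrightarrow> f (sum g A) = (\<Sum>x\<in>A. f (g x))"
  by (induction A rule: infinite_finite_induct) (simp_all add: clinear_zero clinear_add)

lemmas clinear_simps = clinear_add clinear_scale clinear_diff clinear_uminus clinear_zero
  clinear_sum

lemma clinearI: "(\<And>x y. f (x + y) = f x + f y) \<Longrightarrow> (\<And>c x. f (c *\<^sub>C x) = c *\<^sub>C f x) \<Longrightarrow> clinear f"
  by (simp add: clinear_iff)

lemma clinear_funpow:
  fixes f :: "'a::complex_vector \<Rightarrow> 'a"
  shows "clinear f \<Longrightarrow> clinear (f ^^ n)"
  by (induction n) (simp_all add: clinear_iff)

lemma is_field_linear: "is_field A \<Longrightarrow> clinear (A n)"
  by (simp add: is_field_def)

lemma is_field_truncated: "is_field A \<Longrightarrow> \<exists>N. \<forall>n\<ge>N. A n v = 0"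
  by (simp add: is_field_def)

lemma is_field_truncated_below:
  assumes "is_field A"
  shows "\<exists>N. \<forall>k\<ge>N. A (m + int k) v = 0"
proof -
  obtain N where "\<forall>n\<ge>N. A n v = 0" using is_field_truncated[OF assms] by blast
  then show ?thesis by (intro exI[of _ "nat (N - m)"]) (simp add: nat_le_iff)
qed

lemma is_fieldI:
  "(\<And>n. clinear (A n)) \<Longrightarrow> (\<And>v. \<exists>N. \<forall>n\<ge>N. A n v = 0) \<Longrightarrow> is_field A"
  by (simp add: is_field_def)

lemma is_field_shift:
  assumes "is_field A"
  shows "is_field (\<lambda>j. A (p + j))"
proof (rule is_fieldI)
  fix v
  obtain N where "\<forall>n\<ge>N. A n v = 0" using is_field_truncated[OF assms] by blast
  then show "\<exists>N. \<forall>n\<ge>N. A (p + n) v = 0" by (intro exI[of _ "N - p"]) simp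
qed (rule is_field_linear[OF assms])

lemma subspace_is_field: "cvs.subspace {A :: 'v::complex_vector distribution. is_field A}"
  unfolding cvs.subspace_def
proof (intro conjI allI ballI)
  show "0 \<in> {A :: 'v distribution. is_field A}"
    by (simp add: is_field_def clinear_iff zero_fun_def cvs.scale_zero_right)
  fix A B :: "'v distribution" and c
  assume AB: "A \<in> {A. is_field A}"
  then have A: "is_field A" by simp
  show "c *\<^sub>C A \<in> {A. is_field A}"
    using A by (force simp: is_field_def clinear_iff scaleC_fun_def scaleC_add_right
      scaleC_scaleC mult.commute cvs.scale_zero_right)
  assume "B \<in> {A. is_field A}"
  then have B: "is_field B" by simp
  have "is_field (A + B)"
  proof (rule is_fieldI)
    show "clinear ((A + B) n)" for n
      using A B by (simp add: is_field_def clinear_iff plus_fun_def scaleC_add_right algebra_simps)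
    fix v
    obtain M N where "\<forall>n\<ge>M. A n v = 0" "\<forall>n\<ge>N. B n v = 0"
      using is_field_truncated[OF A] is_field_truncated[OF B] by blast
    then show "\<exists>N. \<forall>n\<ge>N. (A + B) n v = 0"
      by (intro exI[of _ "max M N"]) (simp add: plus_fun_def)
  qed
  then show "A + B \<in> {A. is_field A}" by simp
qed

lemma is_field_dz:
  assumes "is_field A"
  shows "is_field (dz A)"
proof (rule is_fieldI)
  show "clinear (dz A n)" for n
    using is_field_linear[OF assms]
    by (simp add: clinear_iff dz_def scaleC_add_right scaleC_scaleC mult.commute)
  fix v
  obtain N where "\<forall>n\<ge>N. A n v = 0" using is_field_truncated[OF assms] by blast
  then show "\<exists>N. \<forall>n\<ge>N. dz A n v = 0"
    by (intro exI[of _ "N + 1"]) (simp add: dz_def cvs.scale_zero_right)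
qed

text \<open>The field property turns the two infinite sums of the normally ordered product into one
  finite sum whose length may be enlarged at will; identities between such sums can then be
  checked for all sufficiently large lengths at once.\<close>

lemma normal_product_eventually:
  assumes A: "is_field A" and B: "is_field B"
  shows "\<forall>\<^sub>F K in sequentially. normal_product A B n v
    = (\<Sum>k<K. A (- 1 - int k) (B (n + int k) v) + B (n - 1 - int k) (A (int k) v))"
proof -
  obtain M where M: "\<And>k. k \<ge> M \<Longrightarrow> B (n + int k) v = 0"
    using is_field_truncated_below[OF B, where m = n] by blast
  obtain N where N: "\<And>k. k \<ge> N \<Longrightarrow> A (int k) v = 0"
    using is_field_truncated_below[OF A, where m = 0] by auto
  have "normal_product A B n v
    = (\<Sum>k<K. A (- 1 - int k) (B (n + int k) v) + B (n - 1 - int k) (A (int k) v))"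
    if K: "K \<ge> max M N" for K
  proof -
    let ?f = "\<lambda>j. if j \<le> -1 then A j (B (n - 1 - j) v) else 0"
    let ?g = "\<lambda>j. if j \<ge> 0 then B (n - 1 - j) (A j v) else 0"
    have "{j. ?f j \<noteq> 0} \<subseteq> (\<lambda>k. - 1 - int k) ` {..<K}"
    proof
      fix j assume "j \<in> {j. ?f j \<noteq> 0}"
      then have j: "j \<le> -1" "B (n - 1 - j) v \<noteq> 0"
        using clinear_zero[OF is_field_linear[OF A]] by (auto split: if_splits)
      have e: "n - 1 - j = n + int (nat (- 1 - j))" using j(1) by simp
      have "nat (- 1 - j) < M" using M[of "nat (- 1 - j)"] j(2) unfolding e by (meson not_le)
      then show "j \<in> (\<lambda>k. - 1 - int k) ` {..<K}"
        using j(1) K by (intro image_eqI[of _ _ "nat (- 1 - j)"]) auto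
    qed
    then have 1: "Sum_any ?f = (\<Sum>k<K. A (- 1 - int k) (B (n + int k) v))"
      by (subst Sum_any.expand_superset[of "(\<lambda>k. - 1 - int k) ` {..<K}"])
        (auto simp: sum.reindex inj_on_def)
    have "{j. ?g j \<noteq> 0} \<subseteq> int ` {..<K}"
    proof
      fix j assume "j \<in> {j. ?g j \<noteq> 0}"
      then have j: "j \<ge> 0" "A j v \<noteq> 0"
        using clinear_zero[OF is_field_linear[OF B]] by (auto split: if_splits)
      have "nat j < N" using N[of "nat j"] j by (auto simp: not_le[symmetric])
      then show "j \<in> int ` {..<K}"
        using j(1) K by (intro image_eqI[of _ _ "nat j"]) auto
    qed
    then have 2: "Sum_any ?g = (\<Sum>k<K. B (n - 1 - int k) (A (int k) v))"
      by (subst Sum_any.expand_superset[of "int ` {..<K}"])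
        (auto simp: sum.reindex inj_on_def)
    show ?thesis
      unfolding normal_product_def 1 2 by (simp add: sum.distrib)
  qed
  then show ?thesis
    unfolding eventually_sequentially by blast
qed

lemma is_field_normal_product:
  assumes A: "is_field A" and B: "is_field B"
  shows "is_field (normal_product A B)"
proof (rule is_fieldI)
  note lin = is_field_linear[OF A] is_field_linear[OF B]
  note ev = normal_product_eventually[OF A B]
  fix n
  show "clinear (normal_product A B n)"
  proof (rule clinearI)
    fix u v
    have "\<forall>\<^sub>F K in sequentially. normal_product A B n (u + v)
        = normal_product A B n u + normal_product A B n v"
      using ev[of n "u + v"] ev[of n u] ev[of n v]
      by eventually_elim (simp add: clinear_simps[OF lin(1)] clinear_simps[OF lin(2)] sum.distrib
        algebra_simps)
    then show "normal_product A B n (u + v) = normal_product A B n u + normal_product A B n v"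
      by simp
  next
    fix c v
    have "\<forall>\<^sub>F K in sequentially. normal_product A B n (c *\<^sub>C v) = c *\<^sub>C normal_product A B n v"
      using ev[of n "c *\<^sub>C v"] ev[of n v]
      by eventually_elim (simp add: clinear_simps[OF lin(1)] clinear_simps[OF lin(2)]
        cvs.scale_sum_right scaleC_add_right)
    then show "normal_product A B n (c *\<^sub>C v) = c *\<^sub>C normal_product A B n v" by simp
  qed
next
  note lin = is_field_linear[OF A] is_field_linear[OF B]
  note ev = normal_product_eventually[OF A B]
  fix v
  obtain M where M: "\<And>n. n \<ge> M \<Longrightarrow> B n v = 0"
    using is_field_truncated[OF B] by blast
  obtain N where N: "\<And>k. k \<ge> N \<Longrightarrow> A (int k) v = 0"
    using is_field_truncated_below[OF A, where m = 0] by auto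
  have "\<forall>k. \<exists>L. \<forall>n\<ge>L. B n (A (int k) v) = 0"
    using is_field_truncated[OF B] by blast
  then have "\<exists>L. \<forall>k. \<forall>n\<ge>L k. B n (A (int k) v) = 0"
    by (rule choice)
  then obtain L where L: "\<And>k n. n \<ge> L k \<Longrightarrow> B n (A (int k) v) = 0" by blast
  have "normal_product A B n v = 0" if n: "n \<ge> \<bar>M\<bar> + (\<Sum>k<N. \<bar>L k + int k + 1\<bar>)" for n
  proof -
    have S: "(\<Sum>k<N. \<bar>L k + int k + 1\<bar>) \<ge> 0" by (simp add: sum_nonneg)
    have "A (- 1 - int k) (B (n + int k) v) + B (n - 1 - int k) (A (int k) v) = 0" for k
    proof -
      have "B (n + int k) v = 0" using n S by (intro M) linarith
      moreover have "B (n - 1 - int k) (A (int k) v) = 0"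
      proof (cases "k < N")
        case True
        have "\<bar>L k + int k + 1\<bar> \<le> (\<Sum>k<N. \<bar>L k + int k + 1\<bar>)"
          by (rule member_le_sum) (use True in auto)
        with n show ?thesis by (intro L) simp
      next
        case False
        then show ?thesis using N by (simp add: clinear_zero[OF lin(2)])
      qed
      ultimately show ?thesis by (simp add: clinear_zero[OF lin(1)])
    qed
    then have "\<forall>\<^sub>F K in sequentially. normal_product A B n v = 0"
      using ev[of n v] by (auto elim: eventually_mono)
    then show ?thesis by simp
  qed
  then show "\<exists>N. \<forall>n\<ge>N. normal_product A B n v = 0" by blast
qed

section \<open>Locality\<close>

definition mutually_local :: "'v::complex_vector distribution \<Rightarrow> 'v distribution \<Rightarrow> bool" where
  "mutually_local A B \<longleftrightarrow> (\<exists>N. (mult_z1_minus_z2 ^^ N) (commutator A B) = 0)"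

lemma clinear_mult_z1_minus_z2: "clinear mult_z1_minus_z2"
  by (rule clinearI) (simp_all add: fun_eq_iff mult_z1_minus_z2_def scaleC_fun_def
    cvs.scale_right_diff_distrib)

lemmas mult_z1_minus_z2_simps = clinear_simps[OF clinear_mult_z1_minus_z2]
  clinear_simps[OF clinear_funpow[OF clinear_mult_z1_minus_z2]]

lemma mult_z1_minus_z2_vanish_mono:
  assumes "(mult_z1_minus_z2 ^^ M) D = 0" "M \<le> N"
  shows "(mult_z1_minus_z2 ^^ N) D = 0"
proof -
  have "(mult_z1_minus_z2 ^^ N) D = (mult_z1_minus_z2 ^^ (N - M)) ((mult_z1_minus_z2 ^^ M) D)"
    using assms(2) by (simp add: funpow_add[symmetric, THEN fun_cong, simplified])
  then show ?thesis using assms(1) by (simp add: mult_z1_minus_z2_simps)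
qed

lemma mutually_local_sym:
  assumes "mutually_local A B"
  shows "mutually_local B A"
proof -
  have swap: "(mult_z1_minus_z2 ^^ N) (\<lambda>m n. D n m) = 0" if "(mult_z1_minus_z2 ^^ N) D = 0"
    for N and D :: "int \<Rightarrow> int \<Rightarrow> 'a \<Rightarrow> 'a"
    using that
  proof (induction N arbitrary: D)
    case 0
    then show ?case by (simp add: zero_fun_def)
  next
    case (Suc N)
    have flip: "mult_z1_minus_z2 (\<lambda>m n. D n m) = (\<lambda>m n. (- mult_z1_minus_z2 D) n m)"
      by (simp add: fun_eq_iff mult_z1_minus_z2_def)
    have "(mult_z1_minus_z2 ^^ N) (mult_z1_minus_z2 D) = 0"
      using Suc.prems by (simp only: funpow_Suc_right o_apply)
    then have "(mult_z1_minus_z2 ^^ N) (- mult_z1_minus_z2 D) = 0"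
      by (simp only: mult_z1_minus_z2_simps minus_zero)
    then show ?case
      unfolding funpow_Suc_right o_apply flip by (rule Suc.IH)
  qed
  obtain N where "(mult_z1_minus_z2 ^^ N) (commutator A B) = 0"
    using assms by (auto simp: mutually_local_def)
  then have "(mult_z1_minus_z2 ^^ N) (- commutator A B) = 0"
    by (simp only: mult_z1_minus_z2_simps minus_zero)
  moreover have "commutator B A = (\<lambda>m n. (- commutator A B) n m)"
    by (simp add: fun_eq_iff commutator_def)
  ultimately show ?thesis
    unfolding mutually_local_def using swap by (intro exI[of _ N]) (simp only:)
qed

lemma mutually_local_add:
  assumes "is_field B" "mutually_local A B" "mutually_local A' B"
  shows "mutually_local (A + A') B"
proof -
  obtain M N where "(mult_z1_minus_z2 ^^ M) (commutator A B) = 0"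
    "(mult_z1_minus_z2 ^^ N) (commutator A' B) = 0"
    using assms by (auto simp: mutually_local_def)
  then have "(mult_z1_minus_z2 ^^ max M N) (commutator A B) = 0"
    "(mult_z1_minus_z2 ^^ max M N) (commutator A' B) = 0"
    by (auto intro: mult_z1_minus_z2_vanish_mono)
  moreover have "commutator (A + A') B = commutator A B + commutator A' B"
    by (simp add: fun_eq_iff commutator_def clinear_simps[OF is_field_linear[OF assms(1)]])
  ultimately show ?thesis
    unfolding mutually_local_def by (intro exI[of _ "max M N"]) (simp add: mult_z1_minus_z2_simps)
qed

lemma mutually_local_scale:
  assumes "is_field B" "mutually_local A B"
  shows "mutually_local (c *\<^sub>C A) B"
proof -
  have "commutator (c *\<^sub>C A) B = c *\<^sub>C commutator A B"
    by (simp add: fun_eq_iff commutator_def scaleC_fun_def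
      clinear_simps[OF is_field_linear[OF assms(1)]] cvs.scale_right_diff_distrib)
  with assms(2) show ?thesis
    by (auto simp: mutually_local_def mult_z1_minus_z2_simps cvs.scale_zero_right)
qed

lemma mutually_local_zero:
  assumes "is_field B"
  shows "mutually_local 0 B"
proof -
  have "commutator 0 B = 0"
    by (simp add: fun_eq_iff commutator_def clinear_simps[OF is_field_linear[OF assms(1)]])
  then show ?thesis
    unfolding mutually_local_def by (intro exI[of _ 0]) simp
qed

lemma subspace_mutually_local:
  assumes "is_field B"
  shows "cvs.subspace {A. mutually_local A B}"
  using assms
  by (simp add: cvs.subspace_def mutually_local_add mutually_local_scale mutually_local_zero)

lemma mutually_local_dz:
  assumes B: "is_field B" and loc: "mutually_local A B"
  shows "mutually_local (dz A) B"
proof -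
  define d :: "(int \<Rightarrow> int \<Rightarrow> 'a \<Rightarrow> 'a) \<Rightarrow> int \<Rightarrow> int \<Rightarrow> 'a \<Rightarrow> 'a"
    where "d D = (\<lambda>m n v. - of_int m *\<^sub>C D (m - 1) n v)" for D
  \<comment> \<open>The product rule for \<open>\<partial>\<close> applied to \<open>(z\<^sub>1 - z\<^sub>2) D\<close>.\<close>
  have leibniz: "mult_z1_minus_z2 (d D) = d (mult_z1_minus_z2 D) - D" for D
    by (simp add: fun_eq_iff mult_z1_minus_z2_def d_def scaleC_add_left cvs.scale_right_diff_distrib
      cvs.scale_left_diff_distrib cvs.scale_minus_left scaleC_one algebra_simps)
  have vanish: "(mult_z1_minus_z2 ^^ Suc N) (d D) = 0" if "(mult_z1_minus_z2 ^^ N) D = 0" for N D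
    using that
  proof (induction N arbitrary: D)
    case 0
    then show ?case
      by (simp add: fun_eq_iff mult_z1_minus_z2_def d_def zero_fun_def)
  next
    case (Suc N)
    have "(mult_z1_minus_z2 ^^ Suc N) (d (mult_z1_minus_z2 D)) = 0"
      by (rule Suc.IH) (use Suc.prems in \<open>simp only: funpow_Suc_right o_apply\<close>)
    moreover have "(mult_z1_minus_z2 ^^ Suc (Suc N)) (d D)
        = (mult_z1_minus_z2 ^^ Suc N) (d (mult_z1_minus_z2 D) - D)"
      by (simp only: funpow_Suc_right o_apply leibniz)
    ultimately show ?case
      using Suc.prems by (simp only: mult_z1_minus_z2_simps) simp
  qed
  have "commutator (dz A) B = d (commutator A B)"
    by (simp add: fun_eq_iff commutator_def dz_def d_def clinear_simps[OF is_field_linear[OF B]]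
      cvs.scale_right_diff_distrib cvs.scale_minus_left)
  with loc vanish show ?thesis
    by (metis mutually_local_def)
qed

section \<open>Dong's lemma\<close>

text \<open>Every term of the binomial expansion contains \<open>P\<^sup>a\<close> or \<open>Q\<^sup>b\<close>.\<close>

lemma commuting_sum_nilpotent:
  fixes P Q :: "'a::ab_group_add \<Rightarrow> 'a"
  assumes P: "\<And>x y. P (x + y) = P x + P y" and Q: "\<And>x y. Q (x + y) = Q x + Q y"
    and comm: "\<And>x. P (Q x) = Q (P x)"
    and "(P ^^ a) x = 0" "(Q ^^ b) x = 0"
  shows "((\<lambda>x. P x + Q x) ^^ (a + b)) x = 0"
  using assms(4,5)
proof (induction "a + b" arbitrary: a b x)
  case 0
  then show ?case by simp
next
  case (Suc n)
  let ?R = "\<lambda>x. P x + Q x"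
  have R: "(?R ^^ n) (x + y) = (?R ^^ n) x + (?R ^^ n) y" for n x y
    by (induction n) (simp_all add: P Q algebra_simps)
  have PQ: "(P ^^ n) (Q x) = Q ((P ^^ n) x)" "(Q ^^ n) (P x) = P ((Q ^^ n) x)" for n x
    by (induction n) (simp_all add: comm)
  have zero: "P 0 = 0" "Q 0 = 0"
    using P[of 0 0] Q[of 0 0] by simp_all
  have R0: "(?R ^^ n) 0 = 0" for n
    by (induction n) (simp_all add: zero)
  consider "x = 0" | a' b' where "a = Suc a'" "b = Suc b'"
    using Suc.prems by (cases a; cases b) auto
  then show ?case
  proof cases
    case 1
    then show ?thesis using R0 by simp
  next
    case 2
    have "(?R ^^ n) (P x) = 0"
      unfolding \<open>a = Suc a'\<close>
    proof -
      have "n = a' + b" using Suc.hyps(2) 2 by simp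
      then show "(?R ^^ n) (P x) = 0"
        using Suc.hyps(1)[of a' b "P x"] Suc.prems 2(1)
        by (simp add: PQ zero funpow_swap1)
    qed
    moreover have "(?R ^^ n) (Q x) = 0"
    proof -
      have "n = a + b'" using Suc.hyps(2) 2 by simp
      then show "(?R ^^ n) (Q x) = 0"
        using Suc.hyps(1)[of a b' "Q x"] Suc.prems 2(2)
        by (simp add: PQ zero funpow_swap1)
    qed
    ultimately show ?thesis
      unfolding Suc.hyps(2)[symmetric] funpow_Suc_right o_apply R by simp
  qed
qed

text \<open>Distributions in three variables \<open>z, w, u\<close>, indexed by the modes of \<open>z, w, u\<close> in this
  order, and multiplication by \<open>w - z\<close>, by \<open>z - u\<close> and by \<open>w - u\<close>.\<close>

type_synonym 'v distribution3 = "int \<Rightarrow> int \<Rightarrow> int \<Rightarrow> 'v \<Rightarrow> 'v"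

definition mult_wz :: "'v::complex_vector distribution3 \<Rightarrow> 'v distribution3" where
  "mult_wz D p m n v = D p (m + 1) n v - D (p + 1) m n v"

definition mult_zu :: "'v::complex_vector distribution3 \<Rightarrow> 'v distribution3" where
  "mult_zu D p m n v = D (p + 1) m n v - D p m (n + 1) v"

definition mult_wu :: "'v::complex_vector distribution3 \<Rightarrow> 'v distribution3" where
  "mult_wu D p m n v = D p (m + 1) n v - D p m (n + 1) v"

lemma mult_wu_eq: "mult_wu = (\<lambda>D. mult_wz D + mult_zu D)"
  by (simp add: fun_eq_iff mult_wu_def mult_wz_def mult_zu_def)

lemma clinear_mult3: "clinear mult_wz" "clinear mult_zu" "clinear mult_wu"
  by (rule clinearI; simp add: fun_eq_iff mult_wu_def mult_wz_def mult_zu_def scaleC_fun_def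
    cvs.scale_right_diff_distrib)+

lemma mult3_commute: "mult_wz (mult_zu D) = mult_zu (mult_wz D)"
  "mult_zu (mult_wu D) = mult_wu (mult_zu D)"
  by (simp_all add: fun_eq_iff mult_wu_def mult_wz_def mult_zu_def algebra_simps)

text \<open>The equation \<open>D = \<Sum>\<^sub>k G\<^sub>k\<close>, without a bound on the number of terms that is uniform in the
  indices and the vector.\<close>

definition locally_finite_sum ::
  "'v::complex_vector distribution3 \<Rightarrow> (nat \<Rightarrow> 'v distribution3) \<Rightarrow> bool" where
  "locally_finite_sum D G \<longleftrightarrow>
     (\<forall>p m n v. \<forall>\<^sub>F K in sequentially. D p m n v = (\<Sum>k<K. G k p m n v))"

lemma locally_finite_sum_mult:
  assumes "locally_finite_sum D G"
  shows "locally_finite_sum ((mult_wu ^^ M) ((mult_zu ^^ N) D))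
    (\<lambda>k. (mult_wu ^^ M) ((mult_zu ^^ N) (G k)))"
proof -
  have wu: "locally_finite_sum (mult_wu D) (\<lambda>k. mult_wu (G k))"
    and zu: "locally_finite_sum (mult_zu D) (\<lambda>k. mult_zu (G k))"
    if "locally_finite_sum D G" for D :: "'a distribution3" and G
  proof -
    have ev: "\<forall>\<^sub>F K in sequentially. D p m n v = (\<Sum>k<K. G k p m n v)" for p m n v
      using that by (simp add: locally_finite_sum_def)
    show "locally_finite_sum (mult_wu D) (\<lambda>k. mult_wu (G k))"
      unfolding locally_finite_sum_def mult_wu_def
    proof (intro allI)
      fix p m n v
      show "\<forall>\<^sub>F K in sequentially. D p (m + 1) n v - D p m (n + 1) v
          = (\<Sum>k<K. G k p (m + 1) n v - G k p m (n + 1) v)"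
        using ev[of p "m + 1" n v] ev[of p m "n + 1" v]
        by eventually_elim (simp add: sum_subtractf)
    qed
    show "locally_finite_sum (mult_zu D) (\<lambda>k. mult_zu (G k))"
      unfolding locally_finite_sum_def mult_zu_def
    proof (intro allI)
      fix p m n v
      show "\<forall>\<^sub>F K in sequentially. D (p + 1) m n v - D p m (n + 1) v
          = (\<Sum>k<K. G k (p + 1) m n v - G k p m (n + 1) v)"
        using ev[of "p + 1" m n v] ev[of p m "n + 1" v]
        by eventually_elim (simp add: sum_subtractf)
    qed
  qed
  have "locally_finite_sum ((mult_zu ^^ N) D) (\<lambda>k. (mult_zu ^^ N) (G k))"
    by (induction N) (use assms zu in simp_all)
  then show ?thesis
    by (induction M) (use wu in simp_all)
qed

lemma locally_finite_sum_zero: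
  assumes "locally_finite_sum D G" "\<And>k. G k = 0"
  shows "D = 0"
  using assms by (simp add: locally_finite_sum_def fun_eq_iff)

text \<open>Let \<open>N(z, w) = (z - w)\<^sup>-\<^sup>1 A(z) B(w) - (z - w)\<^sup>-\<^sup>1 B(w) A(z)\<close>, with the first fraction expanded
  for large \<open>z\<close> and the second for large \<open>w\<close>; its residue in \<open>z\<close> is the normally ordered product.
  The commutator \<open>[N(z, w), C(u)]\<close> is annihilated by a power of \<open>w - z\<close>, because \<open>A\<close> and \<open>B\<close> are
  local, and by a product of powers of \<open>w - u\<close> and \<open>z - u\<close>, because \<open>C\<close> is local with both. Since
  \<open>w - u = (w - z) + (z - u)\<close>, a power of \<open>w - u\<close> alone annihilates it, and this survives the
  residue in \<open>z\<close>.\<close>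

lemma mutually_local_normal_product:
  assumes A: "is_field A" and B: "is_field B" and C: "is_field C"
    and AB: "mutually_local A B" and AC: "mutually_local A C" and BC: "mutually_local B C"
  shows "mutually_local (normal_product A B) C"
proof -
  note lin = is_field_linear[OF A] is_field_linear[OF B] is_field_linear[OF C]
  note lins = clinear_simps[OF lin(1)] clinear_simps[OF lin(2)] clinear_simps[OF lin(3)]
  obtain NBA NAC NBC where
    NBA: "(mult_z1_minus_z2 ^^ NBA) (commutator B A) = 0" and
    NAC: "(mult_z1_minus_z2 ^^ NAC) (commutator A C) = 0" and
    NBC: "(mult_z1_minus_z2 ^^ NBC) (commutator B C) = 0"
    using mutually_local_sym[OF AB] AC BC by (auto simp: mutually_local_def)
  define N where "N p m = normal_product (\<lambda>j. A (p + j)) B m" for p m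
  define D where "D p m n v = N p m (C n v) - C n (N p m v)" for p m n v
  have N_sum: "\<forall>\<^sub>F K in sequentially. N p m v
      = (\<Sum>k<K. A (p - 1 - int k) (B (m + int k) v) + B (m - 1 - int k) (A (p + int k) v))" for p m v
    using normal_product_eventually[OF is_field_shift[OF A, of p] B, of m v]
    by (simp add: N_def algebra_simps)

  \<comment> \<open>\<open>(w - z) N(z, w) = [B(w), A(z)]\<close>: the sum telescopes.\<close>
  have N_diff: "N p (m + 1) v - N (p + 1) m v = commutator B A m p v" for p m v
  proof -
    let ?g = "\<lambda>k. A (p - int k) (B (m + int k) v) - B (m - int k) (A (p + int k) v)"
    obtain K1 where K1: "\<And>k. k \<ge> K1 \<Longrightarrow> B (m + int k) v = 0"
      using is_field_truncated_below[OF B, where m = m] by blast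
    obtain K2 where K2: "\<And>k. k \<ge> K2 \<Longrightarrow> A (p + int k) v = 0"
      using is_field_truncated_below[OF A, where m = p] by blast
    have "\<forall>\<^sub>F K in sequentially. K \<ge> max K1 K2" by (rule eventually_ge_at_top)
    then have "\<forall>\<^sub>F K in sequentially. N p (m + 1) v - N (p + 1) m v = commutator B A m p v"
      using N_sum[of p "m + 1" v] N_sum[of "p + 1" m v]
    proof eventually_elim
      case (elim K)
      have "N p (m + 1) v - N (p + 1) m v = (\<Sum>k<K. ?g (Suc k) - ?g k)"
        unfolding elim(2,3) sum_subtractf[symmetric]
        by (rule sum.cong) (simp_all add: algebra_simps)
      also have "\<dots> = ?g K - ?g 0" by (rule sum_lessThan_telescope)
      also have "?g K = 0" using elim(1) K1 K2 by (simp add: lins)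
      finally show ?case by (simp add: commutator_def)
    qed
    then show ?thesis by simp
  qed

  \<comment> \<open>A power of \<open>w - z\<close> annihilates \<open>[N(z, w), C(u)]\<close>.\<close>
  have slot: "(mult_wz ^^ k) (\<lambda>p m n v. E m p (C n v) - C n (E m p v))
      = (\<lambda>p m n v. (mult_z1_minus_z2 ^^ k) E m p (C n v) - C n ((mult_z1_minus_z2 ^^ k) E m p v))"
    for k and E :: "int \<Rightarrow> int \<Rightarrow> 'a \<Rightarrow> 'a"
  proof (induction k)
    case (Suc k)
    then show ?case
      by (simp add: fun_eq_iff mult_wz_def mult_z1_minus_z2_def lins)
  qed simp
  have wz_D: "mult_wz D = (\<lambda>p m n v. commutator B A m p (C n v) - C n (commutator B A m p v))"
    by (simp add: fun_eq_iff mult_wz_def D_def N_diff[symmetric] lins)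
  have wz: "(mult_wz ^^ Suc NBA) D = 0"
    unfolding funpow_Suc_right o_apply wz_D slot NBA by (simp add: lins fun_eq_iff)

  \<comment> \<open>Expanding \<open>[A B, C] = A [B, C] + [A, C] B\<close> and \<open>[B A, C]\<close> likewise gives four sums; a power
    of \<open>w - u\<close> annihilates the terms with \<open>[B, C]\<close>, a power of \<open>z - u\<close> those with \<open>[A, C]\<close>.\<close>
  define G1 where "G1 k p m n v = A (p - 1 - int k) (commutator B C (m + int k) n v)" for k p m n v
  define G2 where "G2 k p m n v = commutator A C (p - 1 - int k) n (B (m + int k) v)" for k p m n v
  define G3 where "G3 k p m n v = B (m - 1 - int k) (commutator A C (p + int k) n v)" for k p m n v
  define G4 where "G4 k p m n v = commutator B C (m - 1 - int k) n (A (p + int k) v)" for k p m n v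
  have "locally_finite_sum D (\<lambda>k. G1 k + G2 k + G3 k + G4 k)"
    unfolding locally_finite_sum_def
  proof (intro allI)
    fix p m n v
    show "\<forall>\<^sub>F K in sequentially. D p m n v = (\<Sum>k<K. (G1 k + G2 k + G3 k + G4 k) p m n v)"
      using N_sum[of p m "C n v"] N_sum[of p m v]
    proof eventually_elim
      case (elim K)
      show ?case
        unfolding D_def elim clinear_sum[OF lin(3)] sum_subtractf[symmetric]
        by (rule sum.cong) (simp_all add: G1_def G2_def G3_def G4_def commutator_def lins)
    qed
  qed
  then have sum: "locally_finite_sum ((mult_wu ^^ NBC) ((mult_zu ^^ NAC) D))
      (\<lambda>k. (mult_wu ^^ NBC) ((mult_zu ^^ NAC) (G1 k + G2 k + G3 k + G4 k)))"
    by (rule locally_finite_sum_mult)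
  have zu_wu: "(mult_wu ^^ j) ((mult_zu ^^ i) E) = (mult_zu ^^ i) ((mult_wu ^^ j) E)"
    for i j and E :: "'a distribution3"
  proof (induction j)
    case (Suc j)
    have "mult_wu ((mult_zu ^^ i) E') = (mult_zu ^^ i) (mult_wu E')" for E' :: "'a distribution3"
      by (induction i) (simp_all add: mult3_commute(2)[symmetric])
    with Suc show ?case by simp
  qed simp
  note mult3_simps = clinear_simps[OF clinear_funpow[OF clinear_mult3(2)]]
    clinear_simps[OF clinear_funpow[OF clinear_mult3(3)]]
  have index: "i + 1 + int k = i + int k + 1" "i + 1 - 1 - int k = i - 1 - int k + 1" for i k
    by simp_all
  have "(mult_wu ^^ i) (G1 k)
      = (\<lambda>p m n v. A (p - 1 - int k) ((mult_z1_minus_z2 ^^ i) (commutator B C) (m + int k) n v))" for i k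
    by (induction i) (simp_all add: G1_def fun_eq_iff mult_wu_def mult_z1_minus_z2_def lins index)
  then have 1: "(mult_wu ^^ NBC) (G1 k) = 0" for k by (simp add: NBC lins fun_eq_iff)
  have "(mult_zu ^^ i) (G2 k)
      = (\<lambda>p m n v. (mult_z1_minus_z2 ^^ i) (commutator A C) (p - 1 - int k) n (B (m + int k) v))" for i k
    by (induction i) (simp_all add: G2_def fun_eq_iff mult_zu_def mult_z1_minus_z2_def index)
  then have 2: "(mult_zu ^^ NAC) (G2 k) = 0" for k by (simp add: NAC fun_eq_iff)
  have "(mult_zu ^^ i) (G3 k)
      = (\<lambda>p m n v. B (m - 1 - int k) ((mult_z1_minus_z2 ^^ i) (commutator A C) (p + int k) n v))" for i k
    by (induction i) (simp_all add: G3_def fun_eq_iff mult_zu_def mult_z1_minus_z2_def lins index)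
  then have 3: "(mult_zu ^^ NAC) (G3 k) = 0" for k by (simp add: NAC lins fun_eq_iff)
  have "(mult_wu ^^ i) (G4 k)
      = (\<lambda>p m n v. (mult_z1_minus_z2 ^^ i) (commutator B C) (m - 1 - int k) n (A (p + int k) v))" for i k
    by (induction i) (simp_all add: G4_def fun_eq_iff mult_wu_def mult_z1_minus_z2_def index)
  then have 4: "(mult_wu ^^ NBC) (G4 k) = 0" for k by (simp add: NBC fun_eq_iff)
  have "(mult_wu ^^ NBC) ((mult_zu ^^ NAC) (G1 k + G2 k + G3 k + G4 k)) = 0" for k
    by (simp add: mult3_simps 2 3) (simp add: zu_wu mult3_simps 1 4)
  with sum have "(mult_wu ^^ NBC) ((mult_zu ^^ NAC) D) = 0"
    by (rule locally_finite_sum_zero)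
  then have zu: "(mult_zu ^^ NAC) ((mult_wu ^^ NBC) D) = 0"
    by (simp add: zu_wu)

  have wz_wu: "(mult_wz ^^ i) ((mult_wu ^^ j) E) = (mult_wu ^^ j) ((mult_wz ^^ i) E)"
    for i j and E :: "'a distribution3"
  proof (induction i)
    case (Suc i)
    have "mult_wz (mult_wu E') = mult_wu (mult_wz E')" for E' :: "'a distribution3"
      by (simp add: mult_wu_eq clinear_add[OF clinear_mult3(1)] mult3_commute(1))
    then have "mult_wz ((mult_wu ^^ j) E') = (mult_wu ^^ j) (mult_wz E')" for E' :: "'a distribution3"
      by (induction j) simp_all
    with Suc show ?case by simp
  qed simp
  have wz': "(mult_wz ^^ Suc NBA) ((mult_wu ^^ NBC) D) = 0"
    unfolding wz_wu wz by (rule clinear_zero[OF clinear_funpow[OF clinear_mult3(3)]])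
  have "((\<lambda>E. mult_wz E + mult_zu E) ^^ (Suc NBA + NAC)) ((mult_wu ^^ NBC) D) = 0"
    using clinear_add[OF clinear_mult3(1)] clinear_add[OF clinear_mult3(2)] mult3_commute(1) wz' zu
    by (rule commuting_sum_nilpotent)
  then have "(mult_wu ^^ (Suc NBA + NAC)) ((mult_wu ^^ NBC) D) = 0"
    by (fold mult_wu_eq)
  then have zero: "(mult_wu ^^ (Suc NBA + NAC + NBC)) D = 0"
    by (simp only: funpow_add o_apply)

  \<comment> \<open>Multiplication by \<open>w - u\<close> does not affect the modes of \<open>z\<close>; mode \<open>0\<close> is the residue.\<close>
  have slice: "(mult_wu ^^ k) E 0 = (mult_z1_minus_z2 ^^ k) (E 0)" for k and E :: "'a distribution3"
    by (induction k) (simp_all add: fun_eq_iff mult_wu_def mult_z1_minus_z2_def)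
  have D_0: "commutator (normal_product A B) C = D 0"
    by (simp add: fun_eq_iff D_def N_def commutator_def)
  have "(mult_z1_minus_z2 ^^ (Suc NBA + NAC + NBC)) (commutator (normal_product A B) C) = 0"
    unfolding D_0 slice[symmetric] zero by (rule zero_fun_apply)
  then show ?thesis
    unfolding mutually_local_def by (rule exI)
qed

section \<open>Translation covariance and the creation property\<close>

definition translation_covariant ::
  "('v \<Rightarrow> 'v) \<Rightarrow> 'v::complex_vector distribution \<Rightarrow> bool" where
  "translation_covariant T A \<longleftrightarrow> (\<forall>n v. T (A n v) - A n (T v) = dz A n v)"

definition creative :: "'v \<Rightarrow> 'v::complex_vector distribution \<Rightarrow> bool" where
  "creative one A \<longleftrightarrow> (\<forall>n\<ge>0. A n one = 0)"

lemma translation_covariantD: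
  "translation_covariant T A \<Longrightarrow> T (A n v) = A n (T v) + dz A n v"
  by (simp add: translation_covariant_def algebra_simps)

lemma translation_covariant_scale:
  assumes "clinear T" "translation_covariant T A"
  shows "translation_covariant T (c *\<^sub>C A)"
  using assms(2) by (simp add: translation_covariant_def scaleC_fun_def clinear_simps[OF assms(1)]
    cvs.scale_right_diff_distrib[symmetric]) (simp add: dz_def scaleC_scaleC mult.commute)

lemma subspace_translation_covariant:
  assumes T: "clinear T"
  shows "cvs.subspace {A. translation_covariant T A}"
  unfolding cvs.subspace_def
proof (intro conjI allI ballI)
  show "0 \<in> {A. translation_covariant T A}"
    by (simp add: translation_covariant_def dz_def clinear_simps[OF T])
  fix A B c
  assume A: "A \<in> {A. translation_covariant T A}"
  then show "c *\<^sub>C A \<in> {A. translation_covariant T A}"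
    using translation_covariant_scale[OF T] by simp
  assume B: "B \<in> {A. translation_covariant T A}"
  have "dz (A + B) n v = dz A n v + dz B n v" for n v
    by (simp add: dz_def scaleC_add_right)
  with A B show "A + B \<in> {A. translation_covariant T A}"
    by (simp add: translation_covariant_def clinear_simps[OF T])
      (simp add: add_diff_add)
qed

lemma subspace_creative: "cvs.subspace {A. creative one A}"
  by (simp add: cvs.subspace_def creative_def scaleC_fun_def)

lemma translation_covariant_dz:
  assumes "clinear T" "translation_covariant T A"
  shows "translation_covariant T (dz A)"
  unfolding translation_covariant_def
proof (intro allI)
  fix n v
  have "T (dz A n v) - dz A n (T v) = - of_int n *\<^sub>C (T (A (n - 1) v) - A (n - 1) (T v))"
    by (simp only: dz_def clinear_scale[OF assms(1)] cvs.scale_right_diff_distrib)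
  also have "\<dots> = dz (dz A) n v"
    using assms(2) by (simp only: translation_covariant_def) (simp only: dz_def[of "dz A"])
  finally show "T (dz A n v) - dz A n (T v) = dz (dz A) n v" .
qed

lemma creative_dz: "creative one A \<Longrightarrow> creative one (dz A)"
proof (unfold creative_def, intro allI impI)
  fix n :: int
  assume A: "\<forall>n\<ge>0. A n one = 0" and n: "n \<ge> 0"
  show "dz A n one = 0"
    using A n by (cases "n = 0") (simp_all add: dz_def)
qed

lemma translation_covariant_normal_product:
  assumes A: "is_field A" and B: "is_field B" and T: "clinear T"
    and TA: "translation_covariant T A" and TB: "translation_covariant T B"
  shows "translation_covariant T (normal_product A B)"
  unfolding translation_covariant_def
proof (intro allI)
  fix n v
  note linA = is_field_linear[OF A] and linB = is_field_linear[OF B]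
  note ev = normal_product_eventually[OF A B]
  obtain K1 where K1: "\<And>k. k \<ge> K1 \<Longrightarrow> B (n - 1 + int k) v = 0"
    using is_field_truncated_below[OF B, where m = "n - 1"] by blast
  obtain K2 where K2: "\<And>k. k \<ge> K2 \<Longrightarrow> A (- 1 + int k) v = 0"
    using is_field_truncated_below[OF A, where m = "- 1"] by blast
  let ?f = "\<lambda>k. A (- 1 - int k) (B (n - 1 + int k) v) + B (n - 2 - int k) (A (int k) v)"
  \<comment> \<open>Covariance of the factors gives \<open>- n\<close> times the wanted sum up to a telescoping sum.\<close>
  let ?g = "\<lambda>k. of_nat k *\<^sub>C A (- 1 - int k) (B (n - 1 + int k) v)
    + of_nat k *\<^sub>C B (n - 1 - int k) (A (- 1 + int k) v)"
  have "\<forall>\<^sub>F K in sequentially. K \<ge> max K1 K2" by (rule eventually_ge_at_top)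
  then have "\<forall>\<^sub>F K in sequentially.
      T (normal_product A B n v) - normal_product A B n (T v) = dz (normal_product A B) n v"
    using ev[of n v] ev[of n "T v"] ev[of "n - 1" v]
  proof eventually_elim
    case (elim K)
    have "T (normal_product A B n v) - normal_product A B n (T v)
        = (\<Sum>k<K. - of_int n *\<^sub>C ?f k + (?g (Suc k) - ?g k))"
      unfolding elim clinear_sum[OF T] sum_subtractf[symmetric]
    proof (rule sum.cong)
      fix k
      have s: "- 1 - int k - 1 = - 2 - int k" "n - 1 - int k - 1 = n - 2 - int k"
        "n + int k - 1 = n - 1 + int k" "int k - 1 = - 1 + int k"
        "- 1 - int (Suc k) = - 2 - int k" "n - 1 - int (Suc k) = n - 2 - int k"
        "n - 1 + int (Suc k) = n + int k" "- 1 + int (Suc k) = int k" by simp_all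
      show "T (A (- 1 - int k) (B (n + int k) v) + B (n - 1 - int k) (A (int k) v))
          - (A (- 1 - int k) (B (n + int k) (T v)) + B (n - 1 - int k) (A (int k) (T v)))
        = - of_int n *\<^sub>C ?f k + (?g (Suc k) - ?g k)"
        unfolding s clinear_add[OF T] translation_covariantD[OF TA] translation_covariantD[OF TB]
          clinear_add[OF linA] clinear_add[OF linB] dz_def clinear_scale[OF linA]
          clinear_scale[OF linB]
        by (simp add: scaleC_add_left scaleC_add_right cvs.scale_left_diff_distrib scaleC_one
          algebra_simps)
    qed simp
    also have "\<dots> = - of_int n *\<^sub>C (\<Sum>k<K. ?f k) + (?g K - ?g 0)"
      by (subst sum.distrib, subst sum_lessThan_telescope, subst cvs.scale_sum_right) (rule refl)
    also have "?g K - ?g 0 = 0"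
      using elim(1) K1[of K] K2[of K] by (simp add: clinear_zero[OF linA] clinear_zero[OF linB])
    also have "(\<Sum>k<K. ?f k) = normal_product A B (n - 1) v"
      unfolding elim by (rule sum.cong) (simp_all add: algebra_simps)
    finally show ?case by (simp add: dz_def)
  qed
  then show "T (normal_product A B n v) - normal_product A B n (T v) = dz (normal_product A B) n v"
    by simp
qed

lemma creative_normal_product:
  assumes A: "is_field A" and B: "is_field B" and "creative one A" "creative one B"
  shows "creative one (normal_product A B)"
    and "normal_product A B (- 1) one = A (- 1) (B (- 1) one)"
proof -
  note lin = clinear_zero[OF is_field_linear[OF A]] clinear_zero[OF is_field_linear[OF B]]
  have AB: "A n one = 0" "B n one = 0" if "n \<ge> 0" for n
    using assms(3,4) that by (simp_all add: creative_def)
  have "normal_product A B n one = 0" if "n \<ge> 0" for n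
  proof -
    have "\<forall>\<^sub>F K in sequentially. normal_product A B n one = 0"
      using normal_product_eventually[OF A B, of n one]
      by eventually_elim (use that in \<open>simp add: AB lin\<close>)
    then show ?thesis by simp
  qed
  then show "creative one (normal_product A B)" by (simp add: creative_def)
  have "\<forall>\<^sub>F K in sequentially. K \<ge> Suc 0" by (rule eventually_ge_at_top)
  then have "\<forall>\<^sub>F K in sequentially. normal_product A B (- 1) one = A (- 1) (B (- 1) one)"
    using normal_product_eventually[OF A B, of "- 1" one]
  proof eventually_elim
    case (elim K)
    then obtain K' where "K = Suc K'" by (cases K) auto
    then show ?case
      unfolding elim(2) by (simp add: sum.lessThan_Suc_shift AB lin del: sum.lessThan_Suc)
  qed
  then show "normal_product A B (- 1) one = A (- 1) (B (- 1) one)" by simp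
qed

text \<open>The modes of \<open>\<partial>\<^sup>k A / k!\<close> are those of \<open>A\<close> times binomial coefficients, which is why an
  induction on \<open>k\<close> has to treat all negative indices at once; at index \<open>-1\<close> the coefficient is one.\<close>

lemma dz_divided_minus_one:
  "dz_divided k A (- 1) v = A (- 1 - int k) v"
proof -
  have "fact m *\<^sub>C (dz ^^ k) A (- 1 - int m) v = fact (m + k) *\<^sub>C A (- 1 - int m - int k) v" for m
  proof (induction k arbitrary: m)
    case (Suc k)
    have "fact m *\<^sub>C (dz ^^ Suc k) A (- 1 - int m) v
        = fact (Suc m) *\<^sub>C (dz ^^ k) A (- 1 - int (Suc m)) v"
      by (simp add: dz_def scaleC_scaleC algebra_simps)
    also have "\<dots> = fact (Suc m + k) *\<^sub>C A (- 1 - int (Suc m) - int k) v"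
      by (rule Suc.IH)
    also have "Suc m + k = m + Suc k" by simp
    also have "- 1 - int (Suc m) - int k = - 1 - int m - int (Suc k)" by simp
    finally show ?case .
  qed simp
  from this[of 0] have "(dz ^^ k) A (- 1) v = fact k *\<^sub>C A (- 1 - int k) v"
    by (simp add: scaleC_one)
  then show ?thesis
    by (simp add: dz_divided_def scaleC_fun_def scaleC_scaleC scaleC_one)
qed

lemma is_field_dz_divided:
  assumes "is_field A"
  shows "is_field (dz_divided k A)"
proof -
  have "is_field ((dz ^^ k) A)"
    by (induction k) (use assms is_field_dz in simp_all)
  then show ?thesis
    using cvs.subspace_scale[OF subspace_is_field] by (simp add: dz_divided_def)
qed

lemma translation_covariant_dz_divided:
  assumes "clinear T" "translation_covariant T A"
  shows "translation_covariant T (dz_divided k A)"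
proof -
  have "translation_covariant T ((dz ^^ k) A)"
    by (induction k) (use assms translation_covariant_dz in simp_all)
  then show ?thesis
    using translation_covariant_scale[OF assms(1)] by (simp add: dz_divided_def)
qed

lemma creative_dz_divided:
  assumes "creative one A"
  shows "creative one (dz_divided k A)"
proof -
  have "creative one ((dz ^^ k) A)"
    by (induction k) (use assms creative_dz in simp_all)
  then show ?thesis
    using cvs.subspace_scale[OF subspace_creative] by (simp add: dz_divided_def)
qed

lemma mutually_local_dz_divided:
  assumes "is_field B" "mutually_local A B"
  shows "mutually_local (dz_divided k A) B"
proof -
  have "mutually_local ((dz ^^ k) A) B"
    by (induction k) (use assms mutually_local_dz in simp_all)
  then show ?thesis
    using mutually_local_scale[OF assms(1)] by (simp add: dz_divided_def)
qed

section \<open>Reconstruction from a generating set of fields\<close>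

lemma is_field_id_field: "is_field id_field"
proof (rule is_fieldI)
  show "clinear (id_field n)" for n
    by (simp add: id_field_def clinear_iff)
  show "\<exists>N. \<forall>n\<ge>N. id_field n v = 0" for v
    by (rule exI[of _ 0]) (simp add: id_field_def)
qed

lemma translation_covariant_id_field: "clinear T \<Longrightarrow> translation_covariant T id_field"
  by (simp add: translation_covariant_def id_field_def dz_def clinear_zero)

lemma creative_id_field: "creative one id_field"
  by (simp add: creative_def id_field_def)

lemma mutually_local_id_field: "is_field B \<Longrightarrow> mutually_local id_field B"
  unfolding mutually_local_def
  by (intro exI[of _ 0])
    (simp add: fun_eq_iff commutator_def id_field_def clinear_zero[OF is_field_linear])

locale field_system =
  fixes one :: "'v::complex_vector" and T :: "'v \<Rightarrow> 'v" and G :: "'v distribution set"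
  assumes T_linear: "clinear T"
    and T_one: "T one = 0"
    and G_field: "A \<in> G \<Longrightarrow> is_field A"
    and G_covariant: "A \<in> G \<Longrightarrow> translation_covariant T A"
    and G_creative: "A \<in> G \<Longrightarrow> creative one A"
    and G_local: "A \<in> G \<Longrightarrow> B \<in> G \<Longrightarrow> mutually_local A B"
    and G_span: "v \<in> cvs.span ((\<lambda>A. A (- 1) one) ` G)"
begin

text \<open>Goddard's uniqueness theorem. Covariance propagates \<open>A\<^sub>-\<^sub>1 \<one> = 0\<close> to \<open>A(z) \<one> = 0\<close>, and
  locality moves \<open>A(z)\<close> past the field \<open>B(w)\<close> that creates a given vector from \<open>\<one>\<close>.\<close>

lemma field_zero_if_state_zero:
  assumes A: "is_field A" "translation_covariant T A" "creative one A"
    and loc: "\<And>B. B \<in> G \<Longrightarrow> mutually_local A B"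
    and zero: "A (- 1) one = 0"
  shows "A = 0"
proof -
  have neg: "A (- 1 - int k) one = 0" for k
  proof (induction k)
    case (Suc k)
    have "dz A (- 1 - int k) one = 0"
      using A(2) by (simp add: translation_covariant_def[THEN iffD1, rule_format, symmetric] Suc
        T_one clinear_zero[OF T_linear] clinear_zero[OF is_field_linear[OF A(1)]])
    then have "of_nat (Suc k) *\<^sub>C A (- 1 - int (Suc k)) one = 0"
      by (simp add: dz_def algebra_simps)
    then show ?case unfolding cvs.scale_eq_0_iff by (simp del: of_nat_Suc)
  qed (simp add: zero)
  have A_one: "A n one = 0" for n
  proof (cases "n \<ge> 0")
    case False
    then have "n = - 1 - int (nat (- 1 - n))" by simp
    then show ?thesis using neg by metis
  qed (use A(3) in \<open>simp add: creative_def\<close>)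
  have A_create: "A m (B (- 1) one) = 0" if B: "B \<in> G" for B m
  proof -
    obtain N where N: "(mult_z1_minus_z2 ^^ N) (commutator A B) = 0"
      using loc[OF B] by (auto simp: mutually_local_def)
    \<comment> \<open>Setting \<open>w = 0\<close> in \<open>(z - w)\<^sup>N D(z, w) \<one>\<close> leaves \<open>z\<^sup>N D(z, 0) \<one>\<close>.\<close>
    have limit: "(mult_z1_minus_z2 ^^ N) D m (- 1) one = D (m + int N) (- 1) one"
      if "\<And>m n. n \<ge> 0 \<Longrightarrow> D m n one = 0" for N m and D :: "int \<Rightarrow> int \<Rightarrow> 'v \<Rightarrow> 'v"
      using that
    proof (induction N arbitrary: D)
      case (Suc N)
      have "(mult_z1_minus_z2 ^^ N) (mult_z1_minus_z2 D) m (- 1) one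
          = mult_z1_minus_z2 D (m + int N) (- 1) one"
        by (rule Suc.IH) (simp add: mult_z1_minus_z2_def Suc.prems)
      also have "\<dots> = D (m + int (Suc N)) (- 1) one"
        by (simp add: mult_z1_minus_z2_def Suc.prems algebra_simps)
      finally show ?case by (simp only: funpow_Suc_right o_apply)
    qed simp
    have comm: "commutator A B m n one = A m (B n one)" for m n
      by (simp add: commutator_def A_one clinear_zero[OF is_field_linear[OF G_field[OF B]]])
    have "commutator A B (m - int N + int N) (- 1) one
        = (mult_z1_minus_z2 ^^ N) (commutator A B) (m - int N) (- 1) one"
      by (rule limit[symmetric]) (use G_creative[OF B] in \<open>simp add: comm creative_def
        clinear_zero[OF is_field_linear[OF A(1)]]\<close>)
    then show ?thesis by (simp add: N comm)
  qed
  have "A m v = 0" for m v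
    using is_field_linear[OF A(1)] _ G_span
    by (rule clinear_kernel_span) (use A_create in auto)
  then show ?thesis by (simp add: fun_eq_iff)
qed

text \<open>The identity field is adjoined because it is the field of the vacuum.\<close>

definition fields :: "'v distribution set" where
  "fields = cvs.span (insert id_field G)"

lemma G_subset_fields: "A \<in> G \<Longrightarrow> A \<in> fields"
  by (simp add: fields_def cvs.span_base)

lemma fields_induct:
  assumes "A \<in> fields" "cvs.subspace {A. P A}" "P id_field" "\<And>A. A \<in> G \<Longrightarrow> P A"
  shows "P A"
  using cvs.span_minimal[of "insert id_field G" "{A. P A}"] assms by (auto simp: fields_def)

lemma fields_field: "A \<in> fields \<Longrightarrow> is_field A"
  by (rule fields_induct[OF _ subspace_is_field])
    (simp_all add: G_field is_field_id_field)

lemma fields_covariant: "A \<in> fields \<Longrightarrow> translation_covariant T A"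
  by (rule fields_induct[OF _ subspace_translation_covariant[OF T_linear]])
    (simp_all add: G_covariant translation_covariant_id_field T_linear)

lemma fields_creative: "A \<in> fields \<Longrightarrow> creative one A"
  by (rule fields_induct[OF _ subspace_creative])
    (simp_all add: G_creative creative_id_field)

text \<open>Locality is linear in each argument separately, so it extends to the span in two steps.\<close>

lemma fields_local:
  assumes A: "A \<in> fields" and B: "B \<in> fields"
  shows "mutually_local A B"
proof -
  have "mutually_local A B" if A: "A \<in> fields" and B: "B \<in> insert id_field G" for A B
  proof -
    have "is_field B" using B fields_field cvs.span_base unfolding fields_def by blast
    show ?thesis
      using A subspace_mutually_local[OF \<open>is_field B\<close>]
    proof (rule fields_induct)
      show "mutually_local id_field B" by (rule mutually_local_id_field) fact
      show "mutually_local C B" if "C \<in> G" for C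
        using B G_local that G_field mutually_local_id_field mutually_local_sym by blast
    qed
  qed
  then have "mutually_local C A" if "C \<in> insert id_field G" for C
    using that A by (blast intro: mutually_local_sym)
  then have "mutually_local B A"
    by (intro fields_induct[OF B subspace_mutually_local[OF fields_field[OF A]]]) auto
  then show ?thesis by (rule mutually_local_sym)
qed

lemma ex1_field_of_state: "\<exists>!A. A \<in> fields \<and> A (- 1) one = v"
proof (rule ex_ex1I)
  have "cvs.subspace {v. \<exists>A\<in>fields. A (- 1) one = v}"
    unfolding cvs.subspace_def fields_def
    by (auto simp: scaleC_fun_def intro: bexI[OF _ cvs.span_zero] bexI[OF _ cvs.span_add]
      bexI[OF _ cvs.span_scale])
  moreover have "(\<lambda>A. A (- 1) one) ` G \<subseteq> {v. \<exists>A\<in>fields. A (- 1) one = v}"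
    using G_subset_fields by auto
  ultimately show "\<exists>A. A \<in> fields \<and> A (- 1) one = v"
    using cvs.span_minimal G_span[of v] by blast
next
  fix A B
  assume AB: "A \<in> fields \<and> A (- 1) one = v" "B \<in> fields \<and> B (- 1) one = v"
  then have "A - B \<in> fields" by (simp add: fields_def cvs.span_diff)
  then have "A - B = 0"
    by (intro field_zero_if_state_zero)
      (use AB in \<open>auto simp: fields_field fields_covariant fields_creative fields_local
        G_subset_fields\<close>)
  then show "A = B" by simp
qed

definition state_field :: "'v \<Rightarrow> 'v distribution" where
  "state_field v = (THE A. A \<in> fields \<and> A (- 1) one = v)"

lemma state_field_in_fields: "state_field v \<in> fields"
  and state_field_value: "state_field v (- 1) one = v"
  using theI'[OF ex1_field_of_state] unfolding state_field_def by auto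

lemma state_field_eqI: "A \<in> fields \<Longrightarrow> A (- 1) one = v \<Longrightarrow> state_field v = A"
  unfolding state_field_def using ex1_field_of_state by (intro the1_equality) auto

lemma clinear_state_field: "clinear state_field"
proof (rule clinearI)
  fix v w c
  show "state_field (v + w) = state_field v + state_field w"
  proof (rule state_field_eqI)
    show "state_field v + state_field w \<in> fields"
      using state_field_in_fields unfolding fields_def by (intro cvs.span_add)
  qed (simp add: state_field_value)
  show "state_field (c *\<^sub>C v) = c *\<^sub>C state_field v"
  proof (rule state_field_eqI)
    show "c *\<^sub>C state_field v \<in> fields"
      using state_field_in_fields unfolding fields_def by (intro cvs.span_scale)
  qed (simp add: state_field_value scaleC_fun_def)
qed

lemma vertex_algebra_state_field: "vertex_algebra one state_field"
proof (rule vertex_algebra.intro)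
  note Y = state_field_in_fields
  have T: "translation one state_field v = T v" for v
    using fields_covariant[OF Y, of v]
    by (simp add: translation_def translation_covariant_def[THEN iffD1, rule_format, symmetric]
      state_field_value T_one clinear_zero[OF is_field_linear[OF fields_field[OF Y]]])
  show "clinear state_field" by (rule clinear_state_field)
  show "state_field one = id_field"
    by (rule state_field_eqI) (simp_all add: fields_def cvs.span_base id_field_def)
  fix v w n
  show "is_field (state_field v)" by (rule fields_field[OF Y])
  show "state_field v n one = 0" if "n \<ge> 0"
    using fields_creative[OF Y] that by (simp add: creative_def)
  show "state_field v (- 1) one = v" by (rule state_field_value)
  show "translation one state_field (state_field v n w)
      - state_field v n (translation one state_field w) = dz (state_field v) n w"
    using fields_covariant[OF Y] by (simp add: T translation_covariant_def)
  show "\<exists>N. (mult_z1_minus_z2 ^^ N) (commutator (state_field v) (state_field w))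
      = (\<lambda>m n w. 0)"
    using fields_local[OF Y Y, of v w] unfolding mutually_local_def zero_fun_def .
qed

end

section \<open>The induced module and its universal property\<close>

lemma abs_V_torus_linear: "abs_V_torus (p + q) = abs_V_torus p + abs_V_torus q"
  "abs_V_torus (c *\<^sub>C p) = c *\<^sub>C abs_V_torus p" "abs_V_torus 0 = 0"
  by (simp_all add: plus_V_torus.abs_eq scaleC_V_torus.abs_eq zero_V_torus_def)

lemma abs_V_torus_eqI: "p - q \<in> ind_relators \<Longrightarrow> abs_V_torus p = abs_V_torus q"
  by (simp add: V_torus.abs_eq_iff ind_rel_def cvs.span_base)

lemma ind_tensor_bilinear:
  "ind_tensor (u + u') f = ind_tensor u f + ind_tensor u' f"
  "ind_tensor u (f + f') = ind_tensor u f + ind_tensor u f'"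
  "ind_tensor (c *\<^sub>C u) f = c *\<^sub>C ind_tensor u f"
  "ind_tensor u (c *\<^sub>C f) = c *\<^sub>C ind_tensor u f"
  unfolding ind_tensor_def abs_V_torus_linear[symmetric]
  by (rule abs_V_torus_eqI, unfold diff_diff_eq[symmetric] ind_relators_def, blast)+

lemma V_torus_tensor_induct [case_names zero add]:
  assumes "P 0" "\<And>c u f v. P v \<Longrightarrow> P (c *\<^sub>C ind_tensor u f + v)"
  shows "P (v :: V_torus)"
proof (rule V_torus.abs_induct)
  fix p
  show "P (abs_V_torus p)"
  proof (induction p rule: poly_mapping_add_induct)
    case zero
    then show ?case using assms(1) by (simp add: abs_V_torus_linear)
  next
    case (add k c p)
    have "Poly_Mapping.single k c = c *\<^sub>C bas k"
      by (simp add: scaleC_single scaleC_complex_def)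
    then show ?case
      using assms(2)[OF add, of c "fst k" "snd k"] by (simp add: abs_V_torus_linear ind_tensor_def)
  qed
qed

lemma clinear_V_act: "clinear (V_act u)"
proof (rule clinearI)
  show "V_act u (v + w) = V_act u v + V_act u w" for v w
    by (induction v; induction w)
      (simp add: V_act_abs abs_V_torus_linear[symmetric] lin_ext_add)
  show "V_act u (c *\<^sub>C v) = c *\<^sub>C V_act u v" for c v
    by (induction v) (simp add: V_act_abs abs_V_torus_linear[symmetric] lin_ext_scale)
qed

lemma uea_scale_mult: "(c *\<^sub>C u) * w = c *\<^sub>C (u * w :: 'l::lie_algebra uea)"
  by transfer (simp add: free_alg_scale_left uea_rel_def uea_ideal_def cvs.span_zero)

lemma clinear_V_act_left: "clinear (\<lambda>u. V_act u v)"
proof (induction v rule: V_torus_tensor_induct)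
  case zero
  then show ?case by (simp add: clinear_iff clinear_zero[OF clinear_V_act])
next
  case (add c u f v)
  then show ?case
    by (simp add: clinear_iff clinear_add[OF clinear_V_act] clinear_scale[OF clinear_V_act]
      V_act_tensor ind_tensor_bilinear distrib_right uea_scale_mult scaleC_add_right scaleC_scaleC
      mult.commute)
qed

lemma V_act_mult: "V_act (u * w) v = V_act u (V_act w v)"
  by (induction v rule: V_torus_tensor_induct)
    (simp_all add: clinear_simps[OF clinear_V_act] V_act_tensor mult.assoc)

lemma V_act_one: "V_act 1 v = v"
  by (induction v rule: V_torus_tensor_induct)
    (simp_all add: clinear_simps[OF clinear_V_act] V_act_tensor)

lemma uea_relators_uea_ideal: "r \<in> uea_relators \<Longrightarrow> r \<in> uea_ideal"
proof -
  assume "r \<in> uea_relators"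
  then have "1 * r * 1 \<in> {a * r * b | a r b. r \<in> uea_relators}" by blast
  then show ?thesis by (simp add: uea_ideal_def cvs.span_base)
qed

lemma clinear_uea_gen: "clinear uea_gen"
proof (rule clinearI)
  show "uea_gen (x + y) = uea_gen x + uea_gen y" for x y :: 'a
    by (transfer, unfold uea_rel_def, rule uea_relators_uea_ideal)
      (unfold diff_diff_eq[symmetric] uea_relators_def, blast)
  show "uea_gen (c *\<^sub>C x) = c *\<^sub>C uea_gen x" for c and x :: 'a
    by (transfer, unfold uea_rel_def, rule uea_relators_uea_ideal)
      (unfold uea_relators_def, blast)
qed

lemma clinear_V_act_gen: "clinear (\<lambda>x. V_act (uea_gen x) v)"
  by (rule clinear_compose[OF clinear_V_act_left clinear_uea_gen])

lemma V_act_commutator: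
  "V_act (uea_gen x) (V_act (uea_gen y) v) - V_act (uea_gen y) (V_act (uea_gen x) v)
    = V_act (uea_gen (lie x y)) v"
  by (simp add: uea_gen_lie[symmetric] clinear_diff[OF clinear_V_act_left] V_act_mult)

lemma clinear_of_C0: "clinear of_C0"
  by (simp add: clinear_iff of_C0_def ind_tensor_bilinear)

lemma V_act_pos_of_C0: "V_act (uea_gen (pos_incl h)) (of_C0 f) = of_C0 (C0_pos_act h f)"
proof -
  have "uea_pos_incl (uea_gen h) = uea_gen (pos_incl h)"
    by transfer (simp add: free_map_def scaleC_one uea_rel_def uea_ideal_def cvs.span_zero)
  moreover have "C0_uea_act (uea_gen h) f = C0_pos_act h f"
    by transfer (simp add: free_act_single scaleC_one)
  ultimately show ?thesis
    using ind_tensor_balanced[of 1 "uea_gen h" f] by (simp add: of_C0_def V_act_tensor)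
qed

lemma V_act_affine: "V_act (uea_gen x) v
  = (\<Sum>n\<in>Poly_Mapping.keys (loop_part x). act (Poly_Mapping.lookup (loop_part x) n) n v)
    + central_part x *\<^sub>C V_act (uea_gen affine_K) v"
proof -
  have sum: "Affine p c = (\<Sum>n\<in>Poly_Mapping.keys p. affine_mode (Poly_Mapping.lookup p n) n)
      + c *\<^sub>C affine_K" for p and c :: complex
  proof -
    have "(\<Sum>n\<in>A. affine_mode (Poly_Mapping.lookup p n) n)
        = Affine (\<Sum>n\<in>A. Poly_Mapping.single n (Poly_Mapping.lookup p n)) 0" for A
      by (induction A rule: infinite_finite_induct)
        (simp_all add: affine_mode_def zero_affine_def plus_affine_def)
    moreover have "(\<Sum>n\<in>Poly_Mapping.keys p. Poly_Mapping.single n (Poly_Mapping.lookup p n)) = p"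
      by (rule poly_mapping_eqI) (simp add: lookup_sum lookup_single when_def in_keys_iff)
    ultimately show ?thesis
      by (simp add: affine_K_def plus_affine_def scaleC_affine_def)
  qed
  have "V_act (uea_gen (Affine p c)) v
      = (\<Sum>n\<in>Poly_Mapping.keys p. act (Poly_Mapping.lookup p n) n v)
        + c *\<^sub>C V_act (uea_gen affine_K) v" for p c
    unfolding sum[of p c] clinear_add[OF clinear_V_act_gen] clinear_sum[OF clinear_V_act_gen]
      clinear_scale[OF clinear_V_act_gen] act_def ..
  from this[of "loop_part x" "central_part x"] show ?thesis by simp
qed

text \<open>The module is generated by \<open>C\<^sub>0\<close> under the action of the modes and of \<open>K\<close>. As \<open>K\<close> is central
  and acts by the identity on \<open>C\<^sub>0\<close>, this principle itself shows that \<open>K\<close> acts by the identity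
  everywhere; \<open>V_torus_induct\<close> below is the resulting principle for the modes alone.\<close>

lemma V_torus_span_act:
  assumes P: "cvs.subspace {v. P v}" and base: "\<And>f. P (of_C0 f)"
    and step: "\<And>a n v. P v \<Longrightarrow> P (act a n v)" and K: "\<And>v. P v \<Longrightarrow> P (V_act (uea_gen affine_K) v)"
  shows "P v"
proof -
  have gen: "P (V_act (uea_gen x) v)" if "P v" for x v
  proof -
    have "P (\<Sum>n\<in>A. act (Poly_Mapping.lookup (loop_part x) n) n v)" for A
      using cvs.subspace_sum[OF P, of A] step that by simp
    then show ?thesis
      using cvs.subspace_add[OF P] cvs.subspace_scale[OF P] K that
      by (subst V_act_affine) simp
  qed
  have words: "P (V_act (abs_uea (bas w)) (of_C0 f))" for w f
  proof (induction w)
    case Nil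
    have "abs_uea (bas []) = (1 :: torus_lie affine uea)"
      by (simp add: one_uea_def one_free_alg)
    then show ?case using base by (simp add: V_act_one)
  next
    case (Cons x w)
    have "abs_uea (bas (x # w)) = uea_gen x * abs_uea (bas w)"
      by (simp add: uea_gen.abs_eq times_uea.abs_eq bas_mult_bas)
    then show ?case using gen Cons by (simp add: V_act_mult)
  qed
  have "P (V_act (abs_uea p) (of_C0 f))" for p f
  proof (induction p rule: poly_mapping_add_induct)
    case zero
    then show ?case
      using cvs.subspace_0[OF P] by (simp add: zero_uea_def[symmetric] clinear_zero[OF clinear_V_act_left])
  next
    case (add w c p)
    have "Poly_Mapping.single w c = c *\<^sub>C bas w"
      by (simp add: scaleC_single scaleC_complex_def)
    then have "abs_uea (Poly_Mapping.single w c + p) = c *\<^sub>C abs_uea (bas w) + abs_uea p"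
      by (simp add: plus_uea.abs_eq scaleC_uea.abs_eq)
    then show ?case
      using cvs.subspace_add[OF P] cvs.subspace_scale[OF P] words add
      by (simp add: clinear_simps[OF clinear_V_act_left])
  qed
  then have "P (V_act u (of_C0 f))" for u f
    by (rule uea.abs_induct)
  then have "P (ind_tensor u f)" for u f
    by (simp add: of_C0_def V_act_tensor)
  then show ?thesis
    using cvs.subspace_add[OF P] cvs.subspace_scale[OF P] cvs.subspace_0[OF P]
    by (induction v rule: V_torus_tensor_induct) auto
qed

lemma V_act_K: "V_act (uea_gen affine_K) v = v"
proof (induction v rule: V_torus_span_act)
  case 1
  show ?case
    by (simp add: cvs.subspace_def clinear_simps[OF clinear_V_act])
next
  case (2 f)
  define K :: "torus_lie affine_pos" where "K = Abs_affine_pos affine_K"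
  have "pos_incl K = affine_K"
    unfolding K_def by (rule Abs_affine_pos_inverse) (simp add: affine_K_def)
  then show ?case
    using V_act_pos_of_C0[of K f]
    by (simp add: C0_pos_act_def affine_K_def C0_act_def zero_torus_lie_def scaleC_one)
next
  case (3 a n v)
  then show ?case
    using V_act_commutator[of affine_K "affine_mode a n" v]
    by (simp add: act_def lie_affine_K clinear_zero[OF clinear_V_act_gen])
qed simp

lemmas V_torus_induct [case_names subspace of_C0 act] =
  V_torus_span_act[unfolded V_act_K]

lemma clinear_act: "clinear (act a n)"
  unfolding act_def by (rule clinear_V_act)

lemmas act_simps = clinear_simps[OF clinear_act]

lemma clinear_act_left: "clinear (\<lambda>a. act a n v)"
proof -
  have "clinear (\<lambda>a::torus_lie. affine_mode a n)"
    by (simp add: clinear_iff affine_mode_def plus_affine_def scaleC_affine_def single_add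
      scaleC_single)
  from clinear_compose[OF clinear_V_act_gen this] show ?thesis
    by (simp add: act_def)
qed

lemma act_commutator:
  "act a m (act b n v) - act b n (act a m v)
    = act (lie a b) (m + n) v + (if m = - n then of_int m * bform a b else 0) *\<^sub>C v"
  unfolding act_def V_act_commutator lie_affine_mode clinear_add[OF clinear_V_act_gen]
    clinear_scale[OF clinear_V_act_gen] V_act_K ..

lemma act_of_C0:
  assumes "n \<ge> 0"
  shows "act a n (of_C0 f) = (if n = 0 then of_C0 (C0_act a f) else 0)"
proof -
  define h where "h = Abs_affine_pos (affine_mode a n)"
  have "pos_incl h = affine_mode a n"
    unfolding h_def
    by (rule Abs_affine_pos_inverse) (use assms in \<open>simp add: affine_mode_def lookup_single when_def\<close>)
  moreover have "C0_act 0 f = 0" by (simp add: C0_act_def zero_torus_lie_def)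
  ultimately show ?thesis
    using V_act_pos_of_C0[of h f]
    by (simp add: act_def C0_pos_act_def affine_mode_def lookup_single when_def
      clinear_zero[OF clinear_of_C0])
qed

text \<open>Frobenius reciprocity, in terms of modes: a level one module of the affine algebra together
  with a map from \<open>C\<^sub>0\<close> that intertwines the nonnegative modes.\<close>

locale level_one_module =
  fixes R :: "torus_lie \<Rightarrow> int \<Rightarrow> 'w::complex_vector \<Rightarrow> 'w" and \<phi> :: "torus_fun \<Rightarrow> 'w"
  assumes R_linear: "clinear (R a n)" and R_linear_left: "clinear (\<lambda>a. R a n w)"
    and R_commutator: "R a m (R b n w) - R b n (R a m w)
      = R (lie a b) (m + n) w + (if m = - n then of_int m * bform a b else 0) *\<^sub>C w"
    and \<phi>_linear: "clinear \<phi>"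
    and R_zero: "R a 0 (\<phi> f) = \<phi> (C0_act a f)"
    and R_pos: "n > 0 \<Longrightarrow> R a n (\<phi> f) = 0"
begin

definition loop_act :: "(int \<Rightarrow>\<^sub>0 torus_lie) \<Rightarrow> 'w \<Rightarrow> 'w" where
  "loop_act p w = (\<Sum>n\<in>Poly_Mapping.keys p. R (Poly_Mapping.lookup p n) n w)"

definition affine_act :: "torus_lie affine \<Rightarrow> 'w \<Rightarrow> 'w" where
  "affine_act x w = loop_act (loop_part x) w + central_part x *\<^sub>C w"

definition uea_act :: "torus_lie affine uea \<Rightarrow> 'w \<Rightarrow> 'w" where
  "uea_act u = free_act affine_act (rep_uea u)"

definition extension :: "V_torus \<Rightarrow> 'w" where
  "extension v = lin_ext (\<lambda>(u, f). uea_act u (\<phi> f)) (rep_V_torus v)"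

lemma loop_act_superset:
  assumes "finite A" "Poly_Mapping.keys p \<subseteq> A"
  shows "loop_act p w = (\<Sum>n\<in>A. R (Poly_Mapping.lookup p n) n w)"
  unfolding loop_act_def
  by (rule sum.mono_neutral_left)
    (use assms in \<open>auto simp: in_keys_iff clinear_zero[OF R_linear_left]\<close>)

lemma loop_act_add: "loop_act (p + q) w = loop_act p w + loop_act q w"
proof -
  let ?A = "Poly_Mapping.keys p \<union> Poly_Mapping.keys q"
  have "loop_act r w = (\<Sum>n\<in>?A. R (Poly_Mapping.lookup r n) n w)" if "r \<in> {p, q, p + q}" for r
    by (rule loop_act_superset) (use that Poly_Mapping.keys_add[of p q] in auto)
  then show ?thesis
    by (simp add: lookup_add clinear_add[OF R_linear_left] sum.distrib)
qed

lemma loop_act_scale: "loop_act (c *\<^sub>C p) w = c *\<^sub>C loop_act p w"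
proof -
  have "loop_act (c *\<^sub>C p) w
      = (\<Sum>n\<in>Poly_Mapping.keys p. R (Poly_Mapping.lookup (c *\<^sub>C p) n) n w)"
    by (rule loop_act_superset) (auto simp: in_keys_iff)
  then show ?thesis
    by (simp add: loop_act_def clinear_scale[OF R_linear_left] cvs.scale_sum_right)
qed

lemma loop_act_single: "loop_act (Poly_Mapping.single n a) w = R a n w"
  by (simp add: loop_act_def clinear_zero[OF R_linear_left])

lemma clinear_loop_act: "clinear (loop_act p)"
  by (simp add: clinear_iff loop_act_def clinear_add[OF R_linear] clinear_scale[OF R_linear]
    sum.distrib cvs.scale_sum_right)

lemma clinear_loop_act_left: "clinear (\<lambda>p. loop_act p w)"
  by (simp add: clinear_iff loop_act_add loop_act_scale)

lemmas loop_act_simps = clinear_simps[OF clinear_loop_act] clinear_simps[OF clinear_loop_act_left]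

lemma loop_act_commutator:
  "loop_act p (loop_act q w) - loop_act q (loop_act p w)
    = loop_act (loop_bracket p q) w + loop_cocycle p q *\<^sub>C w"
proof (induction p rule: poly_mapping_add_induct)
  case zero
  then show ?case by (simp add: loop_act_simps)
next
  case (add m a p)
  have "loop_act (Poly_Mapping.single m a) (loop_act q w)
      - loop_act q (loop_act (Poly_Mapping.single m a) w)
    = loop_act (loop_bracket (Poly_Mapping.single m a) q) w
      + loop_cocycle (Poly_Mapping.single m a) q *\<^sub>C w"
  proof (induction q rule: poly_mapping_add_induct)
    case zero
    then show ?case by (simp add: loop_act_simps)
  next
    case (add n b q)
    have "loop_act (Poly_Mapping.single m a) (loop_act (Poly_Mapping.single n b) w)
      - loop_act (Poly_Mapping.single n b) (loop_act (Poly_Mapping.single m a) w)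
      = loop_act (loop_bracket (Poly_Mapping.single m a) (Poly_Mapping.single n b)) w
      + loop_cocycle (Poly_Mapping.single m a) (Poly_Mapping.single n b) *\<^sub>C w"
      unfolding loop_act_single loop_bracket_single loop_cocycle_single by (rule R_commutator)
    with add show ?case
      unfolding loop_bracket_add_right loop_cocycle_add_right loop_act_add
        clinear_add[OF clinear_loop_act] scaleC_add_left
      by (simp add: algebra_simps)
  qed
  with add show ?case
    unfolding loop_bracket_add_left loop_cocycle_add_left loop_act_add
      clinear_add[OF clinear_loop_act] scaleC_add_left
    by (simp add: algebra_simps)
qed

lemma lie_rep_affine_act: "lie_rep affine_act"
  unfolding lie_rep_def
proof (intro conjI allI)
  fix x y w
  show "clinear (affine_act x)"
    by (simp add: clinear_iff affine_act_def loop_act_simps scaleC_add_right scaleC_scaleC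
      mult.commute)
  show "clinear (\<lambda>x. affine_act x w)"
    by (simp add: clinear_iff affine_act_def loop_act_simps scaleC_add_right scaleC_add_left
      scaleC_scaleC plus_affine_def scaleC_affine_def)
  show "affine_act (lie x y) w = affine_act x (affine_act y w) - affine_act y (affine_act x w)"
    using loop_act_commutator[of "loop_part x" "loop_part y" w, symmetric]
    by (simp add: affine_act_def lie_affine_def loop_act_simps scaleC_add_right scaleC_scaleC
      mult.commute)
qed

lemma clinear_affine_act: "clinear (affine_act x)"
  using lie_rep_affine_act by (simp add: lie_rep_def)

lemma uea_act_abs: "uea_act (abs_uea p) = free_act affine_act p"
proof
  fix w
  have "uea_rel (rep_uea (abs_uea p)) p"
    by (rule Quotient3_rep_abs[OF Quotient3_uea])
      (simp add: uea_rel_def uea_ideal_def cvs.span_zero)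
  then have "free_act affine_act (rep_uea (abs_uea p) - p) w = 0"
    unfolding uea_rel_def by (rule free_act_ideal[OF lie_rep_affine_act])
  then show "uea_act (abs_uea p) w = free_act affine_act p w"
    by (simp add: uea_act_def free_act_diff)
qed

lemma clinear_uea_act: "clinear (uea_act u)"
  unfolding uea_act_def by (rule clinear_free_act[OF clinear_affine_act])

lemma uea_act_add: "uea_act (u + u') w = uea_act u w + uea_act u' w"
  by (induction u; induction u') (simp add: plus_uea.abs_eq uea_act_abs free_act_add)

lemma uea_act_scale: "uea_act (c *\<^sub>C u) w = c *\<^sub>C uea_act u w"
  by (induction u) (simp add: scaleC_uea.abs_eq uea_act_abs free_act_scale)

lemma uea_act_mult: "uea_act (u * u') w = uea_act u (uea_act u' w)"
  by (induction u; induction u')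
    (simp add: times_uea.abs_eq uea_act_abs free_act_mult[OF clinear_affine_act])

lemma uea_act_one: "uea_act 1 w = w"
  by (simp add: one_uea_def uea_act_abs one_free_alg free_act_single scaleC_one)

lemma uea_act_mode: "uea_act (uea_gen (affine_mode a n)) w = R a n w"
  by (simp add: uea_gen.abs_eq uea_act_abs free_act_single scaleC_one affine_act_def
    affine_mode_def loop_act_single)

lemma affine_act_pos: "affine_act (pos_incl h) (\<phi> f) = \<phi> (C0_pos_act h f)"
proof -
  let ?p = "loop_part (pos_incl h)"
  have "Poly_Mapping.lookup ?p n = 0" if "n < 0" for n
    using pos_incl[of h] that by auto
  then have zero: "R (Poly_Mapping.lookup ?p n) n (\<phi> f)
      = (if n = 0 then R (Poly_Mapping.lookup ?p 0) 0 (\<phi> f) else 0)" for n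
    using R_pos[of n] by (cases n "0::int" rule: linorder_cases)
      (auto simp: clinear_zero[OF R_linear_left])
  have "loop_act ?p (\<phi> f)
      = (\<Sum>n\<in>insert 0 (Poly_Mapping.keys ?p). R (Poly_Mapping.lookup ?p n) n (\<phi> f))"
    by (rule loop_act_superset) auto
  also have "\<dots> = R (Poly_Mapping.lookup ?p 0) 0 (\<phi> f)"
    by (subst sum.cong[OF refl zero]) (simp add: sum.delta)
  finally show ?thesis
    by (simp add: affine_act_def C0_pos_act_def R_zero clinear_simps[OF \<phi>_linear])
qed

lemma uea_act_pos: "uea_act (uea_pos_incl h) (\<phi> f) = \<phi> (C0_uea_act h f)"
proof (rule uea.abs_induct[of _ h])
  fix p
  have words: "foldr affine_act (map pos_incl w) (\<phi> f) = \<phi> (foldr C0_pos_act w f)" for w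
    by (induction w) (simp_all add: affine_act_pos)
  have "free_act affine_act (free_map pos_incl p) (\<phi> f) = \<phi> (free_act C0_pos_act p f)"
  proof (induction p rule: poly_mapping_add_induct)
    case zero
    then show ?case by (simp add: free_map_def lin_ext_def free_act_zero clinear_zero[OF \<phi>_linear])
  next
    case (add w c p)
    then show ?case
      by (simp add: free_map_def lin_ext_add free_act_add free_act_scale free_act_single scaleC_one
        words clinear_simps[OF \<phi>_linear])
  qed
  then show "uea_act (uea_pos_incl (abs_uea p)) (\<phi> f) = \<phi> (C0_uea_act (abs_uea p) f)"
    by (simp add: uea_pos_incl.abs_eq C0_uea_act.abs_eq uea_act_abs)
qed

lemma extension_abs: "extension (abs_V_torus p) = lin_ext (\<lambda>(u, f). uea_act u (\<phi> f)) p"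
proof -
  let ?F = "lin_ext (\<lambda>(u, f). uea_act u (\<phi> f))"
  have "ind_rel (rep_V_torus (abs_V_torus p)) p"
    by (rule Quotient3_rep_abs[OF Quotient3_V_torus]) (simp add: ind_rel_def cvs.span_zero)
  then have "?F (rep_V_torus (abs_V_torus p) - p) = 0"
    unfolding ind_rel_def
  proof (rule clinear_kernel_span[OF clinear_lin_ext, rotated])
    fix r :: "torus_lie affine uea \<times> torus_fun \<Rightarrow>\<^sub>0 complex"
    assume "r \<in> ind_relators"
    then show "?F r = 0"
      unfolding ind_relators_def
      by (auto simp: lin_ext_diff lin_ext_scale scaleC_one uea_act_add uea_act_scale uea_act_mult
        uea_act_pos clinear_simps[OF \<phi>_linear] clinear_simps[OF clinear_uea_act])
  qed
  then show ?thesis by (simp add: extension_def lin_ext_diff)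
qed

lemma clinear_extension: "clinear extension"
proof (rule clinearI)
  show "extension (v + w) = extension v + extension w" for v w
    by (induction v; induction w)
      (simp add: abs_V_torus_linear[symmetric] extension_abs lin_ext_add)
  show "extension (c *\<^sub>C v) = c *\<^sub>C extension v" for c v
    by (induction v) (simp add: abs_V_torus_linear[symmetric] extension_abs lin_ext_scale)
qed

lemma extension_tensor: "extension (ind_tensor u f) = uea_act u (\<phi> f)"
  by (simp add: ind_tensor_def extension_abs scaleC_one)

lemma extension_of_C0: "extension (of_C0 f) = \<phi> f"
  by (simp add: of_C0_def extension_tensor uea_act_one)

lemma extension_act: "extension (act a n v) = R a n (extension v)"
proof (induction v rule: V_torus_tensor_induct)
  case zero
  then show ?case
    by (simp add: act_simps clinear_zero[OF clinear_extension] clinear_zero[OF R_linear])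
next
  case (add c u f v)
  have "extension (act a n (ind_tensor u f)) = R a n (extension (ind_tensor u f))"
    by (simp add: act_def V_act_tensor extension_tensor uea_act_mult uea_act_mode)
  with add show ?case
    by (simp add: act_simps clinear_simps[OF clinear_extension] clinear_simps[OF R_linear])
qed

end

section \<open>The shift operators\<close>

text \<open>The element \<open>2 \<pi> i \<rho>\<^sub>j \<alpha>\<^sup>j\<close> of the Lie algebra. It is orthogonal to all \<open>\<alpha>\<^sup>j\<close>, and
  \<open>\<langle>a, momentum \<rho>\<rangle>\<close> is the eigenvalue of \<open>a\<close> at \<open>expo \<rho>\<close>.\<close>

definition momentum :: "int ^ 3 \<Rightarrow> torus_lie" where
  "momentum \<rho> = (\<Sum>j\<in>UNIV. (2 * of_real pi * \<i> * of_int (\<rho> $ j)) *\<^sub>C alpha j)"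

lemma momentum_eq: "momentum \<rho> = Torus_Lie (\<chi> j. 2 * of_real pi * \<i> * of_int (\<rho> $ j)) 0"
  by (simp add: momentum_def sum_3 alpha_def scaleC_torus_lie_def plus_torus_lie_def vec_eq_iff
    forall_3 axis_def)

lemma lie_momentum: "lie a (momentum \<rho>) = 0" "lie (momentum \<rho>) a = 0"
  by (simp_all add: momentum_eq lie_torus_lie_def zero_torus_lie_def vec_eq_iff)

lemma bform_momentum:
  "bform a (momentum \<rho>) = (\<Sum>j\<in>UNIV. beta_part a $ j * (2 * of_real pi * \<i> * of_int (\<rho> $ j)))"
  by (simp add: momentum_eq bform_torus_lie_def)

lemma bform_lie_momentum: "bform (lie a b) (momentum \<rho>) = 0"
  by (simp add: bform_invariant lie_momentum)

lemma bform_momentum_alpha: "bform (alpha j) (momentum \<rho>) = 0"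
  and bform_momentum_momentum: "bform (momentum \<sigma>) (momentum \<rho>) = 0"
  by (simp_all add: alpha_def momentum_eq bform_torus_lie_def)

lemma bform_momentum_beta: "bform (beta j) (momentum \<rho>) = 2 * of_real pi * \<i> * of_int (\<rho> $ j)"
  using exhaust_3[of j] by (auto simp: bform_momentum beta_def axis_def sum_3)

lemma torus_lie_induct [case_names alpha beta add scale]:
  assumes "\<And>j. P (alpha j)" "\<And>j. P (beta j)" "\<And>a b. P a \<Longrightarrow> P b \<Longrightarrow> P (a + b)"
    "\<And>c a. P a \<Longrightarrow> P (c *\<^sub>C a)"
  shows "P a"
proof -
  have "P ((\<Sum>j\<in>UNIV. alpha_part a $ j *\<^sub>C alpha j) + (\<Sum>j\<in>UNIV. beta_part a $ j *\<^sub>C beta j))"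
    unfolding sum_3 by (intro assms)
  then show ?thesis by (simp add: torus_lie_basis[symmetric])
qed

lemma torus_fun_scale_mult: "(c *\<^sub>C f) * g = c *\<^sub>C (f * g :: torus_fun)"
  "f * (c *\<^sub>C g) = c *\<^sub>C (f * g :: torus_fun)"
  by (transfer, simp add: fun_eq_iff scaleC_fun_def scaleC_complex_def)+

lemma expo_mult: "expo \<rho> * expo \<sigma> = expo (\<rho> + \<sigma>)"
  by transfer (rule fourier_add)

lemma expo_zero: "expo 0 = 1"
  by transfer (simp add: fourier_zero one_fun_def)

lemma C0_act_expo: "C0_act a (expo \<rho>) = bform a (momentum \<rho>) *\<^sub>C expo \<rho>"
  by (simp add: C0_act_def torus_partial_expo bform_momentum cvs.scale_sum_left scaleC_scaleC)

lemma C0_act_expo_mult: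
  "C0_act a (expo \<rho> * f) = bform a (momentum \<rho>) *\<^sub>C (expo \<rho> * f) + expo \<rho> * C0_act a f"
proof (induction f rule: torus_fun_induct)
  case (expo \<sigma>)
  have "momentum (\<rho> + \<sigma>) = momentum \<rho> + momentum \<sigma>"
    by (simp add: momentum_def sum.distrib scaleC_add_left distrib_left)
  then show ?case
    by (simp add: expo_mult C0_act_expo bform_add_right scaleC_add_left torus_fun_scale_mult)
next
  case (add f g)
  then show ?case
    by (simp add: distrib_left C0_act_bilinear scaleC_add_right algebra_simps)
next
  case (scale c f)
  then show ?case
    by (simp add: torus_fun_scale_mult C0_act_bilinear scaleC_add_right scaleC_scaleC mult.commute)
qed

lemma is_shift_operator_act:
  assumes "is_shift_operator \<rho> E"
  shows "act a n (E v) = E (act a n v) + (if n = 0 then bform a (momentum \<rho>) else 0) *\<^sub>C E v"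
proof (induction a rule: torus_lie_induct)
  case (alpha j)
  then show ?case
    using assms by (simp add: is_shift_operator_def bform_momentum_alpha)
next
  case (beta j)
  have "act (beta j) n (E v) - E (act (beta j) n v)
      = (2 * of_real pi * \<i> * of_int (\<rho> $ j) * (if n = 0 then 1 else 0)) *\<^sub>C E v"
    using assms by (simp add: is_shift_operator_def)
  then show ?case
    by (auto simp: bform_momentum_beta algebra_simps split: if_splits)
next
  case (add a b)
  have "clinear E" using assms by (simp add: is_shift_operator_def)
  with add show ?case
    by (simp add: clinear_simps[OF clinear_act_left] clinear_simps bform_add_left scaleC_add_left)
next
  case (scale c a)
  have "clinear E" using assms by (simp add: is_shift_operator_def)
  with scale show ?case
    by (simp add: clinear_simps[OF clinear_act_left] clinear_simps bform_scale_left
      scaleC_add_right scaleC_scaleC)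
qed

text \<open>Replacing \<open>a\<^sub>0\<close> by \<open>a\<^sub>0 - \<langle>a, momentum \<rho>\<rangle>\<close> gives another module structure of level one, because
  \<open>momentum \<rho>\<close> is orthogonal to all commutators. The shift operator is the homomorphism into this
  module that extends multiplication by the exponential; the shift of the zero modes compensates
  the derivative of the exponential.\<close>

lemma ex1_shift_operator: "\<exists>!E. is_shift_operator \<rho> E"
proof (rule ex_ex1I)
  let ?R = "\<lambda>a n v. act a n v - (if n = 0 then bform a (momentum \<rho>) else 0) *\<^sub>C v"
  let ?\<phi> = "\<lambda>f. of_C0 (expo \<rho> * f)"
  interpret M: level_one_module ?R ?\<phi>
  proof (rule level_one_module.intro)
    fix a b :: torus_lie and m n :: int and v f
    show "clinear (?R a n)"
      by (simp add: clinear_iff act_simps scaleC_add_right scaleC_scaleC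
        cvs.scale_right_diff_distrib mult.commute)
    show "clinear (\<lambda>a. ?R a n v)"
      by (simp add: clinear_iff clinear_simps[OF clinear_act_left] bform_add_left bform_scale_left
        scaleC_add_left scaleC_scaleC cvs.scale_right_diff_distrib)
    have "?R a m (?R b n v) - ?R b n (?R a m v) = act a m (act b n v) - act b n (act a m v)"
      by (simp add: act_simps scaleC_scaleC cvs.scale_right_diff_distrib mult.commute algebra_simps)
    then show "?R a m (?R b n v) - ?R b n (?R a m v)
        = ?R (lie a b) (m + n) v + (if m = - n then of_int m * bform a b else 0) *\<^sub>C v"
      unfolding act_commutator bform_lie_momentum by simp
    show "clinear ?\<phi>"
      by (simp add: clinear_iff distrib_left torus_fun_scale_mult clinear_simps[OF clinear_of_C0])
    show "?R a 0 (?\<phi> f) = ?\<phi> (C0_act a f)"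
      by (simp add: act_of_C0 C0_act_expo_mult clinear_simps[OF clinear_of_C0])
    show "?R a n (?\<phi> f) = 0" if "n > 0"
      using that by (simp add: act_of_C0)
  qed
  have "is_shift_operator \<rho> M.extension"
    unfolding is_shift_operator_def
    using M.clinear_extension
    by (simp add: M.extension_of_C0 M.extension_act bform_momentum_alpha bform_momentum_beta)
  then show "\<exists>E. is_shift_operator \<rho> E" by (rule exI[of _ M.extension])
next
  fix E E'
  assume E: "is_shift_operator \<rho> E" and E': "is_shift_operator \<rho> E'"
  have lin: "clinear E" "clinear E'" and C0: "E (of_C0 f) = E' (of_C0 f)" for f
    using E E' by (simp_all add: is_shift_operator_def)
  have "E v = E' v" for v
  proof (induction v rule: V_torus_induct)
    case subspace
    show ?case
      by (simp add: cvs.subspace_def clinear_simps[OF lin(1)] clinear_simps[OF lin(2)])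
  next
    case (act a n v)
    then show ?case
      using is_shift_operator_act[OF E, of a n v] is_shift_operator_act[OF E', of a n v] by simp
  qed (rule C0)
  then show "E = E'" ..
qed

lemma is_shift_operator_shift_operator: "is_shift_operator \<rho> (shift_operator \<rho>)"
  unfolding shift_operator_def using ex1_shift_operator by (rule theI')

lemma clinear_shift_operator: "clinear (shift_operator \<rho>)"
  and shift_operator_of_C0: "shift_operator \<rho> (of_C0 f) = of_C0 (expo \<rho> * f)"
  using is_shift_operator_shift_operator by (simp_all add: is_shift_operator_def)

lemmas act_shift_operator = is_shift_operator_act[OF is_shift_operator_shift_operator]

section \<open>The translation operator\<close>

instantiation prod :: (complex_vector, complex_vector) complex_vector
begin
definition "c *\<^sub>C p = (c *\<^sub>C fst p, c *\<^sub>C snd p)"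
instance
  by standard (simp_all add: scaleC_prod_def plus_prod_def scaleC_add_right scaleC_add_left
    scaleC_scaleC scaleC_one)
end

text \<open>The value on \<open>C\<^sub>0\<close> is forced by \<open>T v = \<partial>\<^sub>z Y(v, z) \<one> |\<^bsub>z = 0\<^esub>\<close>: the linear coefficient of
  \<open>Y(expo \<rho>, z) \<one>\<close> is \<open>2 \<pi> i \<rho>\<^sub>j \<alpha>\<^sup>j\<^sub>-\<^sub>1 expo \<rho>\<close>.\<close>

definition is_translation_operator :: "(V_torus \<Rightarrow> V_torus) \<Rightarrow> bool" where
  "is_translation_operator T \<longleftrightarrow>
     clinear T \<and>
     (\<forall>f. T (of_C0 f) = (\<Sum>j\<in>UNIV. act (alpha j) (- 1) (of_C0 (torus_partial j f)))) \<and>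
     (\<forall>a n v. T (act a n v) = act a n (T v) - of_int n *\<^sub>C act a (n - 1) v)"

text \<open>The derivation \<open>a\<^sub>n \<mapsto> - n a\<^sub>n\<^sub>-\<^sub>1\<close> of the affine algebra makes \<open>V \<oplus> \<epsilon> V\<close>, with
  \<open>\<epsilon>\<^sup>2 = 0\<close>, a module on which \<open>a\<^sub>n\<close> acts as \<open>a\<^sub>n - \<epsilon> n a\<^sub>n\<^sub>-\<^sub>1\<close>; a homomorphism
  \<open>v \<mapsto> v + \<epsilon> T v\<close> into it is the same as an operator \<open>T\<close> that is compatible with the
  derivation.\<close>

lemma ex_translation_operator: "\<exists>T. is_translation_operator T"
proof -
  define \<tau> where "\<tau> f = (\<Sum>j\<in>UNIV. act (alpha j) (- 1) (of_C0 (torus_partial j f)))" for f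
  define R where "R a n p = (act a n (fst p), act a n (snd p) - of_int n *\<^sub>C act a (n - 1) (fst p))"
    for a n and p :: "V_torus \<times> V_torus"
  have R_components: "fst (R a n p) = act a n (fst p)"
    "snd (R a n p) = act a n (snd p) - of_int n *\<^sub>C act a (n - 1) (fst p)" for a n p
    by (simp_all add: R_def)
  have \<tau>_linear: "clinear \<tau>"
    by (simp add: clinear_iff \<tau>_def clinear_simps[OF clinear_torus_partial]
      clinear_simps[OF clinear_of_C0] act_simps sum.distrib cvs.scale_sum_right)
  have act_\<tau>: "act a n (\<tau> f) = (\<Sum>j\<in>UNIV. act (alpha j) (- 1) (act a n (of_C0 (torus_partial j f)))
      + (if n = 1 then beta_part a $ j else 0) *\<^sub>C of_C0 (torus_partial j f))" for a n f
  proof -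
    have "act a n (act (alpha j) (- 1) v)
        = act (alpha j) (- 1) (act a n v) + (if n = 1 then beta_part a $ j else 0) *\<^sub>C v" for j v
    proof -
      have "bform a (alpha j) = beta_part a $ j"
        using exhaust_3[of j] by (auto simp: bform_torus_lie_def alpha_def axis_def sum_3)
      moreover have "n = - (- 1) \<longleftrightarrow> n = 1" by simp
      ultimately show ?thesis
        using act_commutator[of a n "alpha j" "- 1" v]
        by (simp add: lie_alpha_beta clinear_zero[OF clinear_act_left] algebra_simps)
    qed
    then show ?thesis by (simp add: \<tau>_def act_simps)
  qed
  interpret M: level_one_module R "\<lambda>f. (of_C0 f, \<tau> f)"
  proof (rule level_one_module.intro)
    fix a b :: torus_lie and m n :: int and p :: "V_torus \<times> V_torus" and f
    show "clinear (R a n)"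
      by (simp add: clinear_iff R_def act_simps scaleC_prod_def plus_prod_def scaleC_add_right
        scaleC_scaleC cvs.scale_right_diff_distrib mult.commute)
    show "clinear (\<lambda>a. R a n p)"
      by (simp add: clinear_iff R_def clinear_simps[OF clinear_act_left] scaleC_prod_def
        plus_prod_def scaleC_add_right scaleC_scaleC cvs.scale_right_diff_distrib mult.commute)
    show "R a m (R b n p) - R b n (R a m p)
        = R (lie a b) (m + n) p + (if m = - n then of_int m * bform a b else 0) *\<^sub>C p"
    proof -
      obtain v w where p: "p = (v, w)" by fastforce
      \<comment> \<open>The central terms of \<open>c1\<close> and \<open>c2\<close> occur only for \<open>m + n = 1\<close>, where they cancel.\<close>
      have c1: "act a m (act b (n - 1) v) = act b (n - 1) (act a m v) + act (lie a b) (m + n - 1) v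
          + (if m + n = 1 then of_int m * bform a b else 0) *\<^sub>C v"
        using act_commutator[of a m b "n - 1" v] by (simp add: algebra_simps)
      have c2: "act a (m - 1) (act b n v) = act b n (act a (m - 1) v) + act (lie a b) (m + n - 1) v
          + (if m + n = 1 then (of_int m - 1) * bform a b else 0) *\<^sub>C v"
        using act_commutator[of a "m - 1" b n v] by (auto simp: algebra_simps)
      have c3: "act a m (act b n x) = act b n (act a m x) + act (lie a b) (m + n) x
          + (if m = - n then of_int m * bform a b else 0) *\<^sub>C x" for x
        using act_commutator[of a m b n x] by (simp add: algebra_simps)
      have "(of_int n :: complex) = 1 - of_int m" if "m + n = 1"
        using that by (metis add_diff_cancel_left' of_int_1 of_int_diff)
      then have cancel: "of_int n *\<^sub>C ((if m + n = 1 then of_int m * bform a b else 0) *\<^sub>C v)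
          + of_int m *\<^sub>C ((if m + n = 1 then (of_int m - 1) * bform a b else 0) *\<^sub>C v) = 0"
        by (cases "m + n = 1") (simp_all add: scaleC_scaleC scaleC_add_left[symmetric],
          simp add: left_diff_distrib right_diff_distrib)
      have "act a m (act b n w - of_int n *\<^sub>C act b (n - 1) v)
          - of_int m *\<^sub>C act a (m - 1) (act b n v)
          - (act b n (act a m w - of_int m *\<^sub>C act a (m - 1) v)
          - of_int n *\<^sub>C act b (n - 1) (act a m v))
        = act (lie a b) (m + n) w - of_int (m + n) *\<^sub>C act (lie a b) (m + n - 1) v
          + (if m = - n then of_int m * bform a b else 0) *\<^sub>C w
          - (of_int n *\<^sub>C ((if m + n = 1 then of_int m * bform a b else 0) *\<^sub>C v)
          + of_int m *\<^sub>C ((if m + n = 1 then (of_int m - 1) * bform a b else 0) *\<^sub>C v))"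
        unfolding act_simps c1 c2 c3[of w] scaleC_add_right of_int_add scaleC_add_left by simp
      then show ?thesis
        unfolding cancel using act_commutator[of a m b n v]
        by (simp add: p R_def scaleC_prod_def)
    qed
    show "clinear (\<lambda>f. (of_C0 f, \<tau> f))"
      using \<tau>_linear clinear_of_C0 by (simp add: clinear_iff scaleC_prod_def)
    have "C0_act a (torus_partial j f) = torus_partial j (C0_act a f)" for j
      using C0_act_commute[of a "beta j" f] by (simp add: C0_act_beta)
    then show "R a 0 (of_C0 f, \<tau> f) = (of_C0 (C0_act a f), \<tau> (C0_act a f))"
      by (simp add: R_def act_of_C0 act_\<tau>) (simp add: \<tau>_def)
    show "R a n (of_C0 f, \<tau> f) = 0" if "n > 0"
      using that by (cases "n = 1") (simp_all add: R_def act_\<tau> act_of_C0 act_simps C0_act_def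
        clinear_simps[OF clinear_of_C0] zero_prod_def scaleC_one)
  qed
  let ?F = M.extension
  have fst: "fst (?F v) = v" for v
  proof (induction v rule: V_torus_induct)
    case subspace
    show ?case
      by (simp add: cvs.subspace_def clinear_simps[OF M.clinear_extension] scaleC_prod_def)
  qed (simp_all add: M.extension_of_C0 M.extension_act R_components)
  have "is_translation_operator (\<lambda>v. snd (?F v))"
    unfolding is_translation_operator_def
  proof (intro conjI allI)
    show "clinear (\<lambda>v. snd (?F v))"
      by (simp add: clinear_iff clinear_simps[OF M.clinear_extension] scaleC_prod_def)
  qed (simp_all add: M.extension_of_C0 M.extension_act R_components fst, simp add: \<tau>_def)
  then show ?thesis by (rule exI[of _ "\<lambda>v. snd (?F v)"])
qed

definition T_torus :: "V_torus \<Rightarrow> V_torus" where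
  "T_torus = (SOME T. is_translation_operator T)"

lemma is_translation_operator_T_torus: "is_translation_operator T_torus"
  unfolding T_torus_def using ex_translation_operator by (rule someI_ex)

lemma clinear_T_torus: "clinear T_torus"
  and T_torus_of_C0:
    "T_torus (of_C0 f) = (\<Sum>j\<in>UNIV. act (alpha j) (- 1) (of_C0 (torus_partial j f)))"
  and T_torus_act: "T_torus (act a n v) = act a n (T_torus v) - of_int n *\<^sub>C act a (n - 1) v"
  using is_translation_operator_T_torus by (simp_all add: is_translation_operator_def)

lemma T_torus_vac: "T_torus vac = 0"
proof -
  have "torus_partial j 1 = 0" for j
    using torus_partial_expo[of j 0] by (simp add: expo_zero)
  then show ?thesis
    by (simp add: vac_def T_torus_of_C0 clinear_zero[OF clinear_of_C0] act_simps)
qed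

section \<open>The current fields\<close>

lemma is_field_act: "is_field (act a)"
proof (rule is_fieldI)
  fix v
  have "\<forall>a. \<exists>N. \<forall>n\<ge>N. act a n v = 0"
  proof (induction v rule: V_torus_induct)
    case subspace
    show ?case
      unfolding cvs.subspace_def
    proof (intro conjI allI ballI; clarsimp)
      show "\<exists>N. \<forall>n\<ge>N. act a n 0 = 0" for a by (simp add: act_simps)
      fix x y a
      assume "\<forall>a. \<exists>N. \<forall>n\<ge>N. act a n x = 0" "\<forall>a. \<exists>N. \<forall>n\<ge>N. act a n y = 0"
      then obtain M N where "\<forall>n\<ge>M. act a n x = 0" "\<forall>n\<ge>N. act a n y = 0" by blast
      then show "\<exists>N. \<forall>n\<ge>N. act a n (x + y) = 0"
        by (intro exI[of _ "max M N"]) (simp add: act_simps)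
    next
      fix c x a
      assume "\<forall>a. \<exists>N. \<forall>n\<ge>N. act a n x = 0"
      then obtain N where "\<forall>n\<ge>N. act a n x = 0" by blast
      then show "\<exists>N. \<forall>n\<ge>N. act a n (c *\<^sub>C x) = 0"
        by (intro exI[of _ N]) (simp add: act_simps)
    qed
  next
    case (of_C0 f)
    show ?case by (intro allI exI[of _ 1]) (simp add: act_of_C0)
  next
    case (act b m v)
    show ?case
    proof
      fix a
      obtain M where M: "\<forall>n\<ge>M. act a n v = 0" using act by blast
      obtain N where N: "\<forall>n\<ge>N. act (lie a b) n v = 0" using act by blast
      have "act a n (act b m v) = 0" if n: "n \<ge> max M (max (N - m) (1 - m))" for n
      proof -
        have "act a n v = 0" "act (lie a b) (n + m) v = 0" "n \<noteq> - m"
          using M N n by auto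
        then show ?thesis
          using act_commutator[of a n b m v] by (simp add: act_simps)
      qed
      then show "\<exists>N. \<forall>n\<ge>N. act a n (act b m v) = 0" by blast
    qed
  qed
  then show "\<exists>N. \<forall>n\<ge>N. act a n v = 0" by blast
qed (rule clinear_act)

lemma translation_covariant_act: "translation_covariant T_torus (act a)"
  by (simp add: translation_covariant_def T_torus_act dz_def cvs.scale_minus_left)

lemma creative_act: "creative vac (act a)"
proof -
  have "C0_act a 1 = 0"
    using C0_act_expo[of a 0] by (simp add: expo_zero bform_momentum)
  then show ?thesis
    by (simp add: creative_def vac_def act_of_C0 clinear_zero[OF clinear_of_C0])
qed

text \<open>The commutator is a term in \<open>m + n\<close>, killed by one factor \<open>z\<^sub>1 - z\<^sub>2\<close>, plus the derivative of a
  delta distribution, killed by two.\<close>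

lemma mutually_local_act: "mutually_local (act a) (act b)"
  unfolding mutually_local_def
proof (rule exI[of _ 2])
  have comm: "commutator (act a) (act b) = (\<lambda>m n v. act (lie a b) (m + n) v
      + (if m = - n then of_int m * bform a b else 0) *\<^sub>C v)"
    by (simp add: fun_eq_iff commutator_def act_commutator)
  have diff: "mult_z1_minus_z2 (commutator (act a) (act b))
      = (\<lambda>m n v. (if m + n + 1 = 0 then bform a b else 0) *\<^sub>C v)"
  proof (intro ext)
    fix m n :: int and v
    have "(m + 1 = - n) = (m + n + 1 = 0)"
      "(m = - (n + 1)) = (m + n + 1 = 0)" by auto
    then show "mult_z1_minus_z2 (commutator (act a) (act b)) m n v
        = (if m + n + 1 = 0 then bform a b else 0) *\<^sub>C v"
      by (cases "m + n + 1 = 0") (simp_all add: comm mult_z1_minus_z2_def distrib_right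
        scaleC_add_left add.assoc add.commute[of n 1])
  qed
  have "(m + 1 + n + 1 = 0) = (m + (n + 1) + 1 = 0)" for m n :: int by simp
  then have "mult_z1_minus_z2 (mult_z1_minus_z2 (commutator (act a) (act b))) = 0"
    unfolding diff by (simp only: fun_eq_iff mult_z1_minus_z2_def) simp
  then show "(mult_z1_minus_z2 ^^ 2) (commutator (act a) (act b)) = 0"
    by (simp only: numeral_2_eq_2 funpow.simps o_apply id_apply)
qed

section \<open>Exponentials of power series of commuting operators\<close>

lemma sum_triangle_swap:
  "(\<Sum>i\<le>m. \<Sum>j\<le>m - i. f i j) = (\<Sum>j\<le>m. \<Sum>i\<le>m - j. f i j :: 'a::comm_monoid_add)"
  for m :: nat
proof -
  have l: "(\<Sum>j\<le>m - i. f i j) = (\<Sum>j\<le>m. if i + j \<le> m then f i j else 0)" if "i \<le> m" for i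
    by (rule sum.mono_neutral_cong_left) (use that in auto)
  have r: "(\<Sum>i\<le>m - j. f i j) = (\<Sum>i\<le>m. if i + j \<le> m then f i j else 0)" if "j \<le> m" for j
    by (rule sum.mono_neutral_cong_left) (use that in auto)
  have "(\<Sum>i\<le>m. \<Sum>j\<le>m - i. f i j) = (\<Sum>i\<le>m. \<Sum>j\<le>m. if i + j \<le> m then f i j else 0)"
    by (rule sum.cong) (simp_all add: l)
  also have "\<dots> = (\<Sum>j\<le>m. \<Sum>i\<le>m. if i + j \<le> m then f i j else 0)"
    by (rule sum.swap)
  also have "\<dots> = (\<Sum>j\<le>m. \<Sum>i\<le>m - j. f i j)"
    by (rule sum.cong) (simp_all add: r)
  finally show ?thesis .
qed

locale commuting_series =
  fixes A :: "nat \<Rightarrow> 'v \<Rightarrow> 'v::complex_vector"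
  assumes A_linear: "clinear (A i)"
    and A_commute: "A i (A j v) = A j (A i v)"
    and A_zero: "A 0 v = 0"
begin

lemmas A_simps = clinear_simps[OF A_linear]

lemma clinear_series_power: "clinear (series_power A k m)"
proof (induction k arbitrary: m)
  case 0
  then show ?case by (simp add: clinear_iff)
next
  case (Suc k)
  then show ?case
    by (simp add: clinear_iff clinear_add[OF Suc] clinear_scale[OF Suc] A_simps sum.distrib
      cvs.scale_sum_right)
qed

lemma series_power_eq_0: "k > m \<Longrightarrow> series_power A k m v = 0"
proof (induction k arbitrary: m)
  case (Suc k)
  have "A i (series_power A k (m - i) v) = 0" if "i \<le> m" for i
  proof (cases "i = 0")
    case False
    then have "m - i < k" using that Suc.prems by linarith
    then show ?thesis by (simp add: Suc.IH A_simps)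
  qed (simp add: A_zero)
  then show ?case by simp
qed simp

text \<open>The derivation \<open>w \<partial>\<^sub>w\<close> applied to \<open>A(w)\<^sup>k\<close>.\<close>

lemma series_power_derivative:
  "of_nat m *\<^sub>C series_power A k m v
    = of_nat k *\<^sub>C (\<Sum>i\<le>m. of_nat i *\<^sub>C A i (series_power A (k - 1) (m - i) v))"
proof (induction k arbitrary: m)
  case 0
  then show ?case by simp
next
  case (Suc k)
  let ?S = "\<Sum>i\<le>m. of_nat i *\<^sub>C A i (series_power A k (m - i) v)"
  have "of_nat m *\<^sub>C series_power A (Suc k) m v
      = (\<Sum>i\<le>m. of_nat i *\<^sub>C A i (series_power A k (m - i) v)
          + A i (of_nat (m - i) *\<^sub>C series_power A k (m - i) v))"
    unfolding series_power.simps cvs.scale_sum_right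
    by (rule sum.cong) (simp_all add: A_simps scaleC_add_left[symmetric] of_nat_add[symmetric])
  also have "\<dots> = ?S + (\<Sum>i\<le>m. of_nat k *\<^sub>C (\<Sum>j\<le>m - i.
      of_nat j *\<^sub>C A j (A i (series_power A (k - 1) (m - i - j) v))))"
    unfolding Suc sum.distrib by (simp add: A_simps A_commute)
  also have "(\<Sum>i\<le>m. of_nat k *\<^sub>C (\<Sum>j\<le>m - i.
      of_nat j *\<^sub>C A j (A i (series_power A (k - 1) (m - i - j) v))))
    = of_nat k *\<^sub>C (\<Sum>j\<le>m. of_nat j *\<^sub>C A j (\<Sum>i\<le>m - j. A i (series_power A (k - 1) (m - j - i) v)))"
    unfolding cvs.scale_sum_right[symmetric] sum_triangle_swap[of _ m]
    by (simp add: A_simps cvs.scale_sum_right diff_diff_add add.commute)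
  also have "\<dots> = of_nat k *\<^sub>C ?S"
    by (cases k) simp_all
  finally show ?case by (simp add: scaleC_add_left scaleC_one)
qed

lemma series_exp_bound:
  assumes "m \<le> N"
  shows "series_exp A m v = (\<Sum>k\<le>N. (1 / fact k) *\<^sub>C series_power A k m v)"
  unfolding series_exp_def
  by (rule sum.mono_neutral_left) (use assms in \<open>auto simp: series_power_eq_0\<close>)

lemma clinear_series_exp: "clinear (series_exp A m)"
  by (simp add: clinear_iff series_exp_def clinear_add[OF clinear_series_power]
    clinear_scale[OF clinear_series_power] scaleC_add_right sum.distrib cvs.scale_sum_right
    scaleC_scaleC mult.commute)

lemma series_exp_0: "series_exp A 0 v = v"
  by (simp add: series_exp_def scaleC_one)

text \<open>The differential equation \<open>w \<partial>\<^sub>w exp(A(w)) = (w \<partial>\<^sub>w A(w)) exp(A(w))\<close>, which together with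
  the constant coefficient determines the exponential.\<close>

lemma series_exp_recursion:
  "of_nat m *\<^sub>C series_exp A m v
    = (\<Sum>i<m. of_nat (Suc i) *\<^sub>C A (Suc i) (series_exp A (m - Suc i) v))"
proof (cases m)
  case (Suc l)
  let ?P = "\<lambda>k i. (1 / fact k) *\<^sub>C (of_nat i *\<^sub>C A i (series_power A k (m - i) v))"
  have "of_nat m *\<^sub>C series_exp A m v
      = (\<Sum>k\<le>m. (of_nat k / fact k) *\<^sub>C
          (\<Sum>i\<le>m. of_nat i *\<^sub>C A i (series_power A (k - 1) (m - i) v)))"
    unfolding series_exp_def cvs.scale_sum_right[of "of_nat m"]
  proof (rule sum.cong)
    fix k
    have "of_nat m *\<^sub>C (1 / fact k) *\<^sub>C series_power A k m v
        = (1 / fact k) *\<^sub>C of_nat m *\<^sub>C series_power A k m v"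
      by (simp add: scaleC_scaleC mult.commute)
    then show "of_nat m *\<^sub>C (1 / fact k) *\<^sub>C series_power A k m v
        = (of_nat k / fact k) *\<^sub>C
          (\<Sum>i\<le>m. of_nat i *\<^sub>C A i (series_power A (k - 1) (m - i) v))"
      by (simp add: series_power_derivative scaleC_scaleC)
  qed simp
  also have "\<dots> = (\<Sum>k\<le>l. \<Sum>i\<le>m. ?P k i)"
  proof -
    have "(of_nat (Suc k) / fact (Suc k) :: complex) = 1 / fact k" for k
      by (simp add: divide_simps del: of_nat_Suc)
    then show ?thesis
      unfolding Suc sum.atMost_Suc_shift[of _ l]
      by (simp add: cvs.scale_sum_right del: of_nat_Suc sum.atMost_Suc fact_Suc)
  qed
  also have "\<dots> = (\<Sum>i\<le>m. \<Sum>k\<le>l. ?P k i)"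
    by (rule sum.swap)
  also have "\<dots> = (\<Sum>i<m. \<Sum>k\<le>l. ?P k (Suc i))"
    unfolding lessThan_Suc_atMost[symmetric]
    by (subst sum.lessThan_Suc_shift) (simp del: of_nat_Suc sum.lessThan_Suc)
  also have "\<dots> = (\<Sum>i<m. of_nat (Suc i) *\<^sub>C A (Suc i) (series_exp A (m - Suc i) v))"
  proof (rule sum.cong)
    fix i
    have "series_exp A (m - Suc i) v = (\<Sum>k\<le>l. (1 / fact k) *\<^sub>C series_power A k (m - Suc i) v)"
      by (rule series_exp_bound) (use Suc in simp)
    then show "(\<Sum>k\<le>l. ?P k (Suc i))
        = of_nat (Suc i) *\<^sub>C A (Suc i) (series_exp A (m - Suc i) v)"
      by (simp add: A_simps cvs.scale_sum_right scaleC_scaleC mult.commute del: of_nat_Suc)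
  qed simp
  finally show ?thesis .
qed simp

end

text \<open>An operator that commutes with the coefficients of the logarithmic derivative up to one
  scalar commutes with the exponential up to one shifted copy of the exponential.\<close>

lemma exponential_commutator:
  fixes B :: "'v::complex_vector \<Rightarrow> 'v" and X e :: "nat \<Rightarrow> 'v \<Rightarrow> 'v"
  assumes B: "clinear B" and X: "\<And>i. clinear (X i)"
    and e_0: "\<And>v. e 0 v = v"
    and rec: "\<And>p v. of_nat p *\<^sub>C e p v = (\<Sum>i<p. X (Suc i) (e (p - Suc i) v))"
    and comm: "\<And>i v. B (X (Suc i) v)
      = X (Suc i) (B v) + (if Suc i = k then c * of_nat k else 0) *\<^sub>C v"
  shows "B (e p v) = e p (B v) + (if 1 \<le> k \<and> k \<le> p then c else 0) *\<^sub>C e (p - k) v"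
proof (induction p rule: less_induct)
  case (less p)
  show ?case
  proof (cases "p = 0")
    case False
    let ?d = "\<lambda>p. if 1 \<le> k \<and> k \<le> p then c else 0"
    have shifted: "(\<Sum>i<p. X (Suc i) (?d (p - Suc i) *\<^sub>C e (p - Suc i - k) v))
        = ?d p *\<^sub>C (of_nat (p - k) *\<^sub>C e (p - k) v)"
    proof (cases "1 \<le> k \<and> k \<le> p")
      case True
      have "(\<Sum>i<p. X (Suc i) (?d (p - Suc i) *\<^sub>C e (p - Suc i - k) v))
          = (\<Sum>i<p - k. c *\<^sub>C X (Suc i) (e (p - k - Suc i) v))"
        by (rule sum.mono_neutral_cong_right)
          (use True in \<open>auto simp: clinear_simps[OF X] diff_commute add.commute\<close>)
      also have "\<dots> = c *\<^sub>C (of_nat (p - k) *\<^sub>C e (p - k) v)"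
        by (simp only: rec cvs.scale_sum_right)
      finally show ?thesis using True by simp
    qed (auto simp: clinear_simps[OF X] intro!: sum.neutral)
    have delta: "(\<Sum>i<p. (if Suc i = k then c * of_nat k else 0) *\<^sub>C e (p - Suc i) v)
        = ?d p *\<^sub>C (of_nat k *\<^sub>C e (p - k) v)"
    proof (cases k)
      case (Suc l)
      have "(\<Sum>i<p. (if Suc i = k then c * of_nat k else 0) *\<^sub>C e (p - Suc i) v)
          = (\<Sum>i<p. if i = l then (c * of_nat k) *\<^sub>C e (p - k) v else 0)"
        by (rule sum.cong) (auto simp: Suc)
      then show ?thesis by (auto simp: Suc scaleC_scaleC)
    qed simp
    have "of_nat p *\<^sub>C B (e p v) = (\<Sum>i<p. B (X (Suc i) (e (p - Suc i) v)))"
      by (simp only: clinear_scale[OF B, symmetric] rec clinear_sum[OF B])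
    also have "\<dots> = (\<Sum>i<p. X (Suc i) (e (p - Suc i) (B v))
        + X (Suc i) (?d (p - Suc i) *\<^sub>C e (p - Suc i - k) v)
        + (if Suc i = k then c * of_nat k else 0) *\<^sub>C e (p - Suc i) v)"
    proof (rule sum.cong)
      fix i assume "i \<in> {..<p}"
      then have "p - Suc i < p" by simp
      from less[OF this] show "B (X (Suc i) (e (p - Suc i) v)) = X (Suc i) (e (p - Suc i) (B v))
        + X (Suc i) (?d (p - Suc i) *\<^sub>C e (p - Suc i - k) v)
        + (if Suc i = k then c * of_nat k else 0) *\<^sub>C e (p - Suc i) v"
        by (simp only: comm clinear_add[OF X])
    qed simp
    also have "\<dots> = of_nat p *\<^sub>C e p (B v) + ?d p *\<^sub>C (of_nat (p - k) *\<^sub>C e (p - k) v)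
        + ?d p *\<^sub>C (of_nat k *\<^sub>C e (p - k) v)"
      by (simp only: sum.distrib shifted delta rec)
    also have "\<dots> = of_nat p *\<^sub>C e p (B v) + ?d p *\<^sub>C (of_nat p *\<^sub>C e (p - k) v)"
    proof (cases "1 \<le> k \<and> k \<le> p")
      case True
      then have "of_nat p = (of_nat (p - k) + of_nat k :: complex)"
        by (simp add: of_nat_add[symmetric] del: of_nat_add)
      then show ?thesis by (simp only: scaleC_add_left scaleC_add_right add.assoc)
    qed (simp only: if_False cvs.scale_zero_left add_0_right)
    also have "\<dots> = of_nat p *\<^sub>C (e p (B v) + ?d p *\<^sub>C e (p - k) v)"
      by (simp add: scaleC_add_right scaleC_scaleC mult.commute)
    finally show ?thesis
      using False cvs.scale_left_imp_eq[of "of_nat p"] by simp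
  qed (auto simp: e_0)
qed

section \<open>The exponential fields\<close>

lemma rho_x_eq: "rho_x \<rho> n v = (- 1 / of_int n) *\<^sub>C act (momentum \<rho>) n v"
  by (simp add: rho_x_def x_mode_def momentum_def clinear_simps[OF clinear_act_left]
    cvs.scale_sum_right scaleC_scaleC mult.commute)

lemma scale_rho_x:
  "of_nat (Suc i) *\<^sub>C rho_x \<rho> (- int (Suc i)) v = act (momentum \<rho>) (- int (Suc i)) v"
  "of_nat (Suc i) *\<^sub>C rho_x \<rho> (int (Suc i)) v = - act (momentum \<rho>) (int (Suc i)) v"
  by (simp_all add: rho_x_eq scaleC_scaleC scaleC_one del: of_nat_Suc)

lemma act_momentum_commute:
  "act (momentum \<rho>) m (act (momentum \<sigma>) n v) = act (momentum \<sigma>) n (act (momentum \<rho>) m v)"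
  using act_commutator[of "momentum \<rho>" m "momentum \<sigma>" n v,
    unfolded lie_momentum bform_momentum_momentum]
  by (cases "m = - n") (simp_all add: clinear_zero[OF clinear_act_left])

lemma commuting_series_rho_x:
  "commuting_series (\<lambda>m v. if m = 0 then 0 else rho_x \<rho> (s m) v)"
proof (rule commuting_series.intro)
  show "clinear (\<lambda>v. if m = 0 then 0 else rho_x \<rho> (s m) v)" for m
    by (simp add: clinear_iff rho_x_eq act_simps scaleC_add_right scaleC_scaleC mult.commute)
qed (simp_all add: rho_x_eq act_simps scaleC_scaleC act_momentum_commute mult.commute)

lemma exp_neg_0: "exp_neg \<rho> 0 v = v"
  and clinear_exp_neg: "clinear (exp_neg \<rho> p)"
  and exp_neg_recursion: "of_nat p *\<^sub>C exp_neg \<rho> p v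
    = (\<Sum>i<p. act (momentum \<rho>) (- int (Suc i)) (exp_neg \<rho> (p - Suc i) v))"
proof -
  interpret commuting_series "\<lambda>m v. if m = 0 then 0 else rho_x \<rho> (- int m) v"
    by (rule commuting_series_rho_x)
  show "exp_neg \<rho> 0 v = v" unfolding exp_neg_def by (rule series_exp_0)
  show "clinear (exp_neg \<rho> p)" unfolding exp_neg_def by (rule clinear_series_exp)
  show "of_nat p *\<^sub>C exp_neg \<rho> p v
    = (\<Sum>i<p. act (momentum \<rho>) (- int (Suc i)) (exp_neg \<rho> (p - Suc i) v))"
    unfolding exp_neg_def series_exp_recursion
    by (simp only: scale_rho_x nat.distinct if_False)
qed

lemma exp_pos_0: "exp_pos \<rho> 0 v = v"
  and clinear_exp_pos: "clinear (exp_pos \<rho> p)"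
  and exp_pos_recursion: "of_nat p *\<^sub>C exp_pos \<rho> p v
    = (\<Sum>i<p. - act (momentum \<rho>) (int (Suc i)) (exp_pos \<rho> (p - Suc i) v))"
proof -
  interpret commuting_series "\<lambda>m v. if m = 0 then 0 else rho_x \<rho> (int m) v"
    by (rule commuting_series_rho_x)
  show "exp_pos \<rho> 0 v = v" unfolding exp_pos_def by (rule series_exp_0)
  show "clinear (exp_pos \<rho> p)" unfolding exp_pos_def by (rule clinear_series_exp)
  show "of_nat p *\<^sub>C exp_pos \<rho> p v
    = (\<Sum>i<p. - act (momentum \<rho>) (int (Suc i)) (exp_pos \<rho> (p - Suc i) v))"
    unfolding exp_pos_def series_exp_recursion
    by (simp only: scale_rho_x nat.distinct if_False)
qed

text \<open>With coefficients indexed by all integers, the field of the exponential is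
  \<open>E\<^sub>\<rho> \<Sum>\<^sub>q neg (q - 1 - n) pos q\<close>.\<close>

definition neg_coeff :: "int ^ 3 \<Rightarrow> int \<Rightarrow> V_torus \<Rightarrow> V_torus" where
  "neg_coeff \<rho> p v = (if p \<ge> 0 then exp_neg \<rho> (nat p) v else 0)"

definition pos_coeff :: "int ^ 3 \<Rightarrow> int \<Rightarrow> V_torus \<Rightarrow> V_torus" where
  "pos_coeff \<rho> q v = (if q \<ge> 0 then exp_pos \<rho> (nat q) v else 0)"

lemma clinear_neg_coeff: "clinear (neg_coeff \<rho> p)"
  and clinear_pos_coeff: "clinear (pos_coeff \<rho> q)"
  by (simp_all add: clinear_iff neg_coeff_def pos_coeff_def clinear_add[OF clinear_exp_neg]
    clinear_scale[OF clinear_exp_neg] clinear_add[OF clinear_exp_pos]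
    clinear_scale[OF clinear_exp_pos])

lemmas coeff_simps = clinear_simps[OF clinear_neg_coeff] clinear_simps[OF clinear_pos_coeff]

lemma neg_coeff_commute:
  assumes "clinear B" "\<And>n v. B (act (momentum \<rho>) n v) = act (momentum \<rho>) n (B v)"
  shows "B (neg_coeff \<rho> p v) = neg_coeff \<rho> p (B v)"
proof -
  have "B (exp_neg \<rho> p v) = exp_neg \<rho> p (B v)" for p
    using exponential_commutator[where B = B and e = "exp_neg \<rho>" and k = 0 and p = p and v = v
      and c = 0 and X = "\<lambda>i. act (momentum \<rho>) (- int i)"]
    by (simp add: assms clinear_act exp_neg_0 exp_neg_recursion del: of_nat_Suc)
  then show ?thesis by (simp add: neg_coeff_def clinear_zero[OF assms(1)])
qed

lemma act_neg_coeff: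
  "act b m (neg_coeff \<rho> p v) = neg_coeff \<rho> p (act b m v)
    + (if m \<ge> 1 then bform b (momentum \<rho>) else 0) *\<^sub>C neg_coeff \<rho> (p - m) v"
proof -
  let ?c = "bform b (momentum \<rho>)"
  have "act b m (exp_neg \<rho> p v) = exp_neg \<rho> p (act b m v)
      + (if 1 \<le> nat m \<and> nat m \<le> p then ?c else 0) *\<^sub>C exp_neg \<rho> (p - nat m) v" for p
  proof (rule exponential_commutator[where X = "\<lambda>i. act (momentum \<rho>) (- int i)"])
    show "act b m (act (momentum \<rho>) (- int (Suc i)) v) = act (momentum \<rho>) (- int (Suc i)) (act b m v)
        + (if Suc i = nat m then ?c * of_nat (nat m) else 0) *\<^sub>C v" for i v
    proof -
      have "act b m (act (momentum \<rho>) (- int (Suc i)) v)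
          = act (momentum \<rho>) (- int (Suc i)) (act b m v)
            + (if m = - (- int (Suc i)) then of_int m * ?c else 0) *\<^sub>C v"
        using act_commutator[of b m "momentum \<rho>" "- int (Suc i)" v]
        by (simp add: lie_momentum clinear_zero[OF clinear_act_left] algebra_simps)
      also have "(if m = - (- int (Suc i)) then of_int m * ?c else 0)
          = (if Suc i = nat m then ?c * of_nat (nat m) else 0)"
        by (auto simp: mult.commute)
      finally show ?thesis .
    qed
  qed (simp_all add: clinear_act exp_neg_0 exp_neg_recursion del: of_nat_Suc)
  note main = this
  show ?thesis
  proof (cases "p \<ge> 0")
    case True
    have "(1 \<le> nat m \<and> nat m \<le> nat p) = (1 \<le> m \<and> m \<le> p)" using True by auto
    moreover have "nat p - nat m = nat (p - m)" if "1 \<le> m" using that by simp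
    ultimately show ?thesis
      using True main[of "nat p"] by (cases "1 \<le> m \<and> m \<le> p") (auto simp: neg_coeff_def)
  qed (simp add: neg_coeff_def act_simps)
qed

lemma act_pos_coeff:
  "act b m (pos_coeff \<rho> q v) = pos_coeff \<rho> q (act b m v)
    + (if m \<le> - 1 then bform b (momentum \<rho>) else 0) *\<^sub>C pos_coeff \<rho> (q + m) v"
proof -
  let ?c = "bform b (momentum \<rho>)"
  have "act b m (exp_pos \<rho> p v) = exp_pos \<rho> p (act b m v)
      + (if 1 \<le> nat (- m) \<and> nat (- m) \<le> p then ?c else 0) *\<^sub>C exp_pos \<rho> (p - nat (- m)) v" for p
  proof (rule exponential_commutator[where X = "\<lambda>i v. - act (momentum \<rho>) (int i) v"])
    show "act b m (- act (momentum \<rho>) (int (Suc i)) v) = - act (momentum \<rho>) (int (Suc i)) (act b m v)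
        + (if Suc i = nat (- m) then ?c * of_nat (nat (- m)) else 0) *\<^sub>C v" for i v
    proof -
      have "act b m (- act (momentum \<rho>) (int (Suc i)) v)
          = - act (momentum \<rho>) (int (Suc i)) (act b m v)
            + (- (if m = - int (Suc i) then of_int m * ?c else 0)) *\<^sub>C v"
        using act_commutator[of b m "momentum \<rho>" "int (Suc i)" v]
        by (simp add: lie_momentum clinear_zero[OF clinear_act_left] act_simps
          cvs.scale_minus_left algebra_simps)
      also have "- (if m = - int (Suc i) then of_int m * ?c else 0)
          = (if Suc i = nat (- m) then ?c * of_nat (nat (- m)) else 0)"
        by (auto simp: mult.commute)
      finally show ?thesis .
    qed
    show "clinear (\<lambda>v. - act (momentum \<rho>) (int i) v)" for i
      by (simp add: clinear_iff act_simps cvs.scale_minus_right)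
  qed (simp_all add: clinear_act exp_pos_0 exp_pos_recursion del: of_nat_Suc)
  note main = this
  show ?thesis
  proof (cases "q \<ge> 0")
    case True
    have "(1 \<le> nat (- m) \<and> nat (- m) \<le> nat q) = (m \<le> - 1 \<and> - m \<le> q)" using True by auto
    moreover have "nat q - nat (- m) = nat (q + m)" if "m \<le> - 1" using that by simp
    ultimately show ?thesis
      using True main[of "nat q"] by (cases "m \<le> - 1 \<and> - m \<le> q") (auto simp: pos_coeff_def)
  qed (simp add: pos_coeff_def act_simps)
qed

lemma exp_pos_of_C0: "q \<ge> 1 \<Longrightarrow> exp_pos \<rho> q (of_C0 f) = 0"
proof (induction q rule: less_induct)
  case (less q)
  have "act (momentum \<rho>) (int (Suc i)) (exp_pos \<rho> (q - Suc i) (of_C0 f)) = 0" if "i < q" for i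
  proof (cases "Suc i = q")
    case True
    then show ?thesis by (auto simp: exp_pos_0 act_of_C0)
  next
    case False
    with that less.IH[of "q - Suc i"] show ?thesis by (simp add: act_simps)
  qed
  then have "of_nat q *\<^sub>C exp_pos \<rho> q (of_C0 f) = 0"
    unfolding exp_pos_recursion by (intro sum.neutral) simp
  with less.prems show ?case by simp
qed

text \<open>The nonzero coefficients stop on \<open>C\<^sub>0\<close> at \<open>q = 0\<close>, and each mode moves this bound only by its
  index.\<close>

lemma pos_coeff_eventually_0: "\<exists>Q. \<forall>q\<ge>Q. pos_coeff \<rho> q v = 0"
proof (induction v rule: V_torus_induct)
  case subspace
  show ?case
    unfolding cvs.subspace_def
  proof (intro conjI allI ballI; clarsimp)
    show "\<exists>Q. \<forall>q\<ge>Q. pos_coeff \<rho> q 0 = 0" by (simp add: coeff_simps)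
    fix x y M N
    assume "\<forall>q\<ge>M. pos_coeff \<rho> q x = 0" "\<forall>q\<ge>N. pos_coeff \<rho> q y = 0"
    then show "\<exists>Q. \<forall>q\<ge>Q. pos_coeff \<rho> q (x + y) = 0"
      by (intro exI[of _ "max M N"]) (simp add: coeff_simps)
  next
    fix c x N
    assume "\<forall>q\<ge>N. pos_coeff \<rho> q x = 0"
    then show "\<exists>Q. \<forall>q\<ge>Q. pos_coeff \<rho> q (c *\<^sub>C x) = 0"
      by (intro exI[of _ N]) (simp add: coeff_simps)
  qed
next
  case (of_C0 f)
  show ?case
    by (intro exI[of _ 1]) (simp add: pos_coeff_def exp_pos_of_C0)
next
  case (act b m v)
  then obtain Q where Q: "\<forall>q\<ge>Q. pos_coeff \<rho> q v = 0" by blast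
  have "pos_coeff \<rho> q (act b m v) = 0" if "q \<ge> Q + \<bar>m\<bar>" for q
  proof -
    have "pos_coeff \<rho> q v = 0" "pos_coeff \<rho> (q + m) v = 0" using Q that by auto
    then show ?thesis using act_pos_coeff[of b m \<rho> q v] by (simp add: act_simps)
  qed
  then show ?case by blast
qed

lemma expo_field_eventually:
  "\<forall>\<^sub>F K in sequentially. expo_field \<rho> n v
    = shift_operator \<rho> (\<Sum>q<K. neg_coeff \<rho> (int q - 1 - n) (pos_coeff \<rho> (int q) v))"
proof -
  obtain Q where Q: "\<forall>q\<ge>Q. pos_coeff \<rho> q v = 0" using pos_coeff_eventually_0 by blast
  have "expo_field \<rho> n v
    = shift_operator \<rho> (\<Sum>q<K. neg_coeff \<rho> (int q - 1 - n) (pos_coeff \<rho> (int q) v))"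
    if K: "K \<ge> nat Q" for K
  proof -
    let ?f = "\<lambda>q. neg_coeff \<rho> (int q - 1 - n) (pos_coeff \<rho> (int q) v)"
    have "{q. ?f q \<noteq> 0} \<subseteq> {..<K}"
    proof
      fix q assume "q \<in> {q. ?f q \<noteq> 0}"
      then have "pos_coeff \<rho> (int q) v \<noteq> 0" by (auto simp: coeff_simps)
      then have "int q < Q" using Q by (meson not_le)
      then show "q \<in> {..<K}" using K by simp
    qed
    then have "Sum_any ?f = (\<Sum>q<K. ?f q)"
      by (rule Sum_any.expand_superset[rotated]) simp
    then show ?thesis by (simp add: expo_field_def neg_coeff_def pos_coeff_def)
  qed
  then show ?thesis unfolding eventually_sequentially by blast
qed

lemma clinear_expo_field: "clinear (expo_field \<rho> n)"
proof (rule clinearI)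
  note ev = expo_field_eventually[of \<rho> n]
  note E = clinear_simps[OF clinear_shift_operator]
  fix u v c
  have "\<forall>\<^sub>F K in sequentially. expo_field \<rho> n (u + v) = expo_field \<rho> n u + expo_field \<rho> n v"
    using ev[of "u + v"] ev[of u] ev[of v]
    by eventually_elim (simp add: coeff_simps E sum.distrib)
  then show "expo_field \<rho> n (u + v) = expo_field \<rho> n u + expo_field \<rho> n v" by simp
  have "\<forall>\<^sub>F K in sequentially. expo_field \<rho> n (c *\<^sub>C v) = c *\<^sub>C expo_field \<rho> n v"
    using ev[of "c *\<^sub>C v"] ev[of v]
    by eventually_elim (simp add: coeff_simps E cvs.scale_sum_right)
  then show "expo_field \<rho> n (c *\<^sub>C v) = c *\<^sub>C expo_field \<rho> n v" by simp
qed

lemmas expo_field_simps = clinear_simps[OF clinear_expo_field]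

text \<open>The operators \<open>E\<^sub>\<rho>\<close>, \<open>neg\<close> and \<open>pos\<close> account for the commutators with the modes of
  index zero, of positive index and of negative index. Together they say that a current acts on
  the exponential field by its eigenvalue on the exponential.\<close>

lemma act_expo_field:
  "act b m (expo_field \<rho> n v)
    = expo_field \<rho> n (act b m v) + bform b (momentum \<rho>) *\<^sub>C expo_field \<rho> (n + m) v"
proof -
  let ?c = "bform b (momentum \<rho>)"
  let ?E = "shift_operator \<rho>"
  let ?S = "\<lambda>K n v. \<Sum>q<K. neg_coeff \<rho> (int q - 1 - n) (pos_coeff \<rho> (int q) v)"
  define j where "j = nat (- m)"
  let ?extra = "\<lambda>K. (if m = 0 then ?c else 0) *\<^sub>C ?S K n v
    + (if m \<ge> 1 then ?c else 0) *\<^sub>C ?S K (n + m) v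
    + (if m \<le> - 1 then ?c else 0) *\<^sub>C
      (\<Sum>q<K. neg_coeff \<rho> (int q - 1 - n) (pos_coeff \<rho> (int q + m) v))"
  have comm: "act b m (?E (?S K n v)) = ?E (?S K n (act b m v) + ?extra K)" for K
  proof -
    have "act b m (?S K n v) = ?S K n (act b m v) + (if m \<ge> 1 then ?c else 0) *\<^sub>C ?S K (n + m) v
      + (if m \<le> - 1 then ?c else 0) *\<^sub>C
      (\<Sum>q<K. neg_coeff \<rho> (int q - 1 - n) (pos_coeff \<rho> (int q + m) v))"
      unfolding clinear_sum[OF clinear_act] act_neg_coeff act_pos_coeff coeff_simps sum.distrib
        cvs.scale_sum_right
      by (simp add: diff_diff_eq add.commute add.left_commute)
    then show ?thesis
      unfolding act_shift_operator
      by (simp only: clinear_add[OF clinear_shift_operator]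
        clinear_scale[OF clinear_shift_operator] ac_simps)
  qed
  \<comment> \<open>For negative \<open>m\<close> the summation index moves by \<open>j = - m\<close>, so that the two sums have different
    lengths; both lengths are eventually long enough.\<close>
  have extra: "?extra (K + j) = ?c *\<^sub>C ?S (if m \<le> - 1 then K else K + j) (n + m) v" for K
  proof (cases "m \<le> - 1")
    case True
    then have j: "int j = - m" by (simp add: j_def)
    let ?g = "\<lambda>q. neg_coeff \<rho> (int q - 1 - n) (pos_coeff \<rho> (int q + m) v)"
    have "sum ?g {..<K + j} = ?S K (n + m) v"
    proof (induction K)
      case 0
      have "?g q = 0" if "q < j" for q
        using that j by (simp add: pos_coeff_def coeff_simps)
      then show ?case by simp
    next
      case (Suc K)
      have "?g (K + j) = neg_coeff \<rho> (int K - 1 - (n + m)) (pos_coeff \<rho> (int K) v)"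
        using j by (simp add: algebra_simps)
      with Suc show ?case by simp
    qed
    with True show ?thesis by simp
  qed (cases "m = 0"; simp add: j_def)
  have ev_shift: "\<forall>\<^sub>F K in sequentially. expo_field \<rho> k w = ?E (?S (K + j) k w)" for k w
    using expo_field_eventually[of \<rho> k w] by (subst eventually_sequentially_seg)
  have "\<forall>\<^sub>F K in sequentially. act b m (expo_field \<rho> n v)
      = expo_field \<rho> n (act b m v) + ?c *\<^sub>C expo_field \<rho> (n + m) v"
    using ev_shift[of n v] ev_shift[of n "act b m v"] ev_shift[of "n + m" v]
      expo_field_eventually[of \<rho> "n + m" v]
  proof eventually_elim
    case (elim K)
    have "expo_field \<rho> (n + m) v = ?E (?S (if m \<le> - 1 then K else K + j) (n + m) v)"
      using elim(3,4) by simp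
    moreover have "act b m (expo_field \<rho> n v) = ?E (?S (K + j) n (act b m v) + ?extra (K + j))"
      unfolding elim(1) by (rule comm)
    ultimately show ?case
      unfolding extra elim(2)
      by (simp only: clinear_add[OF clinear_shift_operator] clinear_scale[OF clinear_shift_operator])
  qed
  then show ?thesis by simp
qed

lemma shift_operator_neg_coeff:
  "shift_operator \<rho> (neg_coeff \<sigma> p v) = neg_coeff \<sigma> p (shift_operator \<rho> v)"
proof (rule neg_coeff_commute[OF clinear_shift_operator])
  fix n :: int and v
  have "(if n = 0 then bform (momentum \<sigma>) (momentum \<rho>) else 0) = 0"
    by (simp add: bform_momentum_momentum)
  then show "shift_operator \<rho> (act (momentum \<sigma>) n v)
      = act (momentum \<sigma>) n (shift_operator \<rho> v)"
    by (simp add: act_shift_operator)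
qed

lemma expo_field_of_C0:
  "expo_field \<rho> n (of_C0 f) = neg_coeff \<rho> (- 1 - n) (of_C0 (expo \<rho> * f))"
proof -
  have pos: "pos_coeff \<rho> (int (Suc q)) (of_C0 f) = 0" "pos_coeff \<rho> 0 (of_C0 f) = of_C0 f" for q
    by (simp_all add: pos_coeff_def exp_pos_of_C0 exp_pos_0)
  have "\<forall>\<^sub>F K in sequentially. K \<ge> Suc 0" by (rule eventually_ge_at_top)
  then have "\<forall>\<^sub>F K in sequentially.
      expo_field \<rho> n (of_C0 f) = neg_coeff \<rho> (- 1 - n) (of_C0 (expo \<rho> * f))"
    using expo_field_eventually[of \<rho> n "of_C0 f"]
  proof eventually_elim
    case (elim K)
    then obtain K' where "K = Suc K'" by (cases K) auto
    then show ?case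
      unfolding elim(2)
      by (simp add: sum.lessThan_Suc_shift pos coeff_simps shift_operator_neg_coeff
        shift_operator_of_C0 del: sum.lessThan_Suc int_Suc of_nat_Suc)
  qed
  then show ?thesis by simp
qed

lemma is_field_expo_field: "is_field (expo_field \<rho>)"
proof (rule is_fieldI)
  fix v
  show "\<exists>N. \<forall>n\<ge>N. expo_field \<rho> n v = 0"
  proof (induction v rule: V_torus_induct)
    case subspace
    show ?case
      unfolding cvs.subspace_def
    proof (intro conjI allI ballI; clarsimp)
      show "\<exists>N. \<forall>n\<ge>N. expo_field \<rho> n 0 = 0" by (simp add: expo_field_simps)
      fix x y M N
      assume "\<forall>n\<ge>M. expo_field \<rho> n x = 0" "\<forall>n\<ge>N. expo_field \<rho> n y = 0"
      then show "\<exists>N. \<forall>n\<ge>N. expo_field \<rho> n (x + y) = 0"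
        by (intro exI[of _ "max M N"]) (simp add: expo_field_simps)
    next
      fix c x N
      assume "\<forall>n\<ge>N. expo_field \<rho> n x = 0"
      then show "\<exists>N. \<forall>n\<ge>N. expo_field \<rho> n (c *\<^sub>C x) = 0"
        by (intro exI[of _ N]) (simp add: expo_field_simps)
    qed
  next
    case (of_C0 f)
    show ?case by (intro exI[of _ 0]) (simp add: expo_field_of_C0 neg_coeff_def)
  next
    case (act b m v)
    then obtain N where N: "\<forall>n\<ge>N. expo_field \<rho> n v = 0" by blast
    have "expo_field \<rho> n (act b m v) = 0" if "n \<ge> N + \<bar>m\<bar>" for n
    proof -
      have "expo_field \<rho> n v = 0" "expo_field \<rho> (n + m) v = 0" using N that by auto
      then show ?thesis using act_expo_field[of b m \<rho> n v] by (simp add: act_simps)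
    qed
    then show ?case by blast
  qed
qed (rule clinear_expo_field)

lemma creative_expo_field: "creative vac (expo_field \<rho>)"
  and expo_field_vac: "expo_field \<rho> (- 1) vac = of_C0 (expo \<rho>)"
  by (simp_all add: creative_def vac_def expo_field_of_C0 neg_coeff_def exp_neg_0)

lemma mutually_local_act_expo_field: "mutually_local (act b) (expo_field \<rho>)"
  unfolding mutually_local_def
proof (rule exI[of _ 1])
  have "commutator (act b) (expo_field \<rho>)
      = (\<lambda>m n v. bform b (momentum \<rho>) *\<^sub>C expo_field \<rho> (n + m) v)"
    by (simp add: fun_eq_iff commutator_def act_expo_field)
  then show "(mult_z1_minus_z2 ^^ 1) (commutator (act b) (expo_field \<rho>)) = 0"
    by (simp add: fun_eq_iff mult_z1_minus_z2_def add.commute add.left_commute)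
qed

lemma neg_coeff_neg_coeff:
  "neg_coeff \<rho> p (neg_coeff \<sigma> q v) = neg_coeff \<sigma> q (neg_coeff \<rho> p v)"
proof (rule neg_coeff_commute[OF clinear_neg_coeff])
  fix n :: int and v
  have "(if n \<ge> 1 then bform (momentum \<sigma>) (momentum \<rho>) else 0) = 0"
    by (simp add: bform_momentum_momentum)
  then show "neg_coeff \<rho> p (act (momentum \<sigma>) n v) = act (momentum \<sigma>) n (neg_coeff \<rho> p v)"
    by (simp add: act_neg_coeff)
qed

lemma expo_field_neg_coeff:
  "expo_field \<rho> m (neg_coeff \<sigma> p v) = neg_coeff \<sigma> p (expo_field \<rho> m v)"
  by (rule neg_coeff_commute[OF clinear_expo_field])
    (simp add: act_expo_field bform_momentum_momentum)

text \<open>The exponential fields commute: their commutators commute with the currents up to such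
  commutators with shifted indices, and hence vanish everywhere once they vanish on \<open>C\<^sub>0\<close>.\<close>

lemma expo_field_commute:
  "expo_field \<rho> m (expo_field \<sigma> n v) = expo_field \<sigma> n (expo_field \<rho> m v)"
proof -
  have "\<forall>m n. expo_field \<rho> m (expo_field \<sigma> n v) = expo_field \<sigma> n (expo_field \<rho> m v)"
  proof (induction v rule: V_torus_induct)
    case subspace
    show ?case by (simp add: cvs.subspace_def expo_field_simps)
  next
    case (of_C0 f)
    show ?case
      by (simp add: expo_field_of_C0 expo_field_neg_coeff neg_coeff_neg_coeff[of \<rho> _ \<sigma>]
        mult.left_commute[of "expo \<rho>"])
  next
    case (act b k v)
    have move: "expo_field \<tau> i (act b k w) = act b k (expo_field \<tau> i w)
        - bform b (momentum \<tau>) *\<^sub>C expo_field \<tau> (i + k) w" for \<tau> i w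
      by (simp add: act_expo_field)
    show ?case
    proof (intro allI)
      fix m n
      show "expo_field \<rho> m (expo_field \<sigma> n (act b k v))
          = expo_field \<sigma> n (expo_field \<rho> m (act b k v))"
        unfolding move expo_field_simps act[rule_format] by simp
    qed
  qed
  then show ?thesis by blast
qed

lemma mutually_local_expo_field: "mutually_local (expo_field \<rho>) (expo_field \<sigma>)"
  unfolding mutually_local_def
  by (rule exI[of _ 0]) (simp add: fun_eq_iff commutator_def expo_field_commute[of \<rho> _ \<sigma>])

text \<open>In terms of \<open>A(w) = \<Sum>\<^sub>i w\<^sup>i \<gamma>\<^sub>-\<^sub>i / i\<close>, with \<open>\<gamma> = momentum \<rho>\<close>, this is
  \<open>[T, exp(A(w))] = \<partial>\<^sub>w exp(A(w)) - \<gamma>\<^sub>-\<^sub>1 exp(A(w))\<close>: the operator \<open>T\<close> differentiates \<open>A(w)\<close>, except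
  that the constant term \<open>\<gamma>\<^sub>-\<^sub>1\<close> of the derivative is missing.\<close>

lemma T_torus_exp_neg:
  "T_torus (exp_neg \<rho> p v) = exp_neg \<rho> p (T_torus v)
    + of_nat (Suc p) *\<^sub>C exp_neg \<rho> (Suc p) v - act (momentum \<rho>) (- 1) (exp_neg \<rho> p v)"
proof (induction p rule: less_induct)
  case (less p)
  let ?\<gamma> = "\<lambda>i. act (momentum \<rho>) (- int i)"
  let ?e = "exp_neg \<rho>"
  show ?case
  proof (cases "p = 0")
    case True
    then show ?thesis
      using exp_neg_recursion[of 1 \<rho> v] by (simp add: exp_neg_0 scaleC_one)
  next
    case False
    define h where "h i = ?\<gamma> (Suc i) (?e (p - i) v)" for i
    have "of_nat p *\<^sub>C T_torus (?e p v) = (\<Sum>i<p. T_torus (?\<gamma> (Suc i) (?e (p - Suc i) v)))"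
      by (simp only: clinear_scale[OF clinear_T_torus, symmetric] exp_neg_recursion
        clinear_sum[OF clinear_T_torus])
    also have "\<dots> = (\<Sum>i<p. ?\<gamma> (Suc i) (?e (p - Suc i) (T_torus v))
        - act (momentum \<rho>) (- 1) (?\<gamma> (Suc i) (?e (p - Suc i) v))
        + (of_nat (p - i) *\<^sub>C h i + of_nat (Suc i) *\<^sub>C h (Suc i)))"
    proof (rule sum.cong)
      fix i assume "i \<in> {..<p}"
      then have i: "p - Suc i < p" "Suc (p - Suc i) = p - i" by auto
      have n: "- int (Suc i) - 1 = - int (Suc (Suc i))" "of_int (- int (Suc i)) = - of_nat (Suc i)"
        by simp_all
      show "T_torus (?\<gamma> (Suc i) (?e (p - Suc i) v)) = ?\<gamma> (Suc i) (?e (p - Suc i) (T_torus v))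
        - act (momentum \<rho>) (- 1) (?\<gamma> (Suc i) (?e (p - Suc i) v))
        + (of_nat (p - i) *\<^sub>C h i + of_nat (Suc i) *\<^sub>C h (Suc i))"
        unfolding T_torus_act less[OF i(1)] i(2) n h_def act_simps
          act_momentum_commute[of \<rho> "- int (Suc i)" \<rho> "- 1"]
        by (simp del: of_nat_Suc)
    qed simp
    also have "\<dots> = of_nat p *\<^sub>C ?e p (T_torus v) - of_nat p *\<^sub>C act (momentum \<rho>) (- 1) (?e p v)
        + ((\<Sum>i<p. of_nat (p - i) *\<^sub>C h i) + (\<Sum>i<p. of_nat (Suc i) *\<^sub>C h (Suc i)))"
      by (simp only: sum.distrib sum_subtractf exp_neg_recursion clinear_sum[OF clinear_act]
        clinear_scale[OF clinear_act, symmetric])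
    also have "(\<Sum>i<p. of_nat (p - i) *\<^sub>C h i) = (\<Sum>i<Suc p. of_nat (p - i) *\<^sub>C h i)"
      by simp
    also have "(\<Sum>i<p. of_nat (Suc i) *\<^sub>C h (Suc i)) = (\<Sum>i<Suc p. of_nat i *\<^sub>C h i)"
      by (simp add: sum.lessThan_Suc_shift del: sum.lessThan_Suc of_nat_Suc)
    also have "(\<Sum>i<Suc p. of_nat (p - i) *\<^sub>C h i) + (\<Sum>i<Suc p. of_nat i *\<^sub>C h i)
        = (\<Sum>i<Suc p. of_nat p *\<^sub>C h i)"
      unfolding sum.distrib[symmetric]
      by (rule sum.cong)
        (simp_all add: scaleC_add_left[symmetric] of_nat_add[symmetric] del: of_nat_add)
    also have "\<dots> = of_nat p *\<^sub>C (of_nat (Suc p) *\<^sub>C ?e (Suc p) v)"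
      unfolding exp_neg_recursion cvs.scale_sum_right by (simp only: h_def diff_Suc_Suc)
    finally have "of_nat p *\<^sub>C T_torus (?e p v) = of_nat p *\<^sub>C (?e p (T_torus v)
        + of_nat (Suc p) *\<^sub>C ?e (Suc p) v - act (momentum \<rho>) (- 1) (?e p v))"
      by (simp only: scaleC_add_right cvs.scale_right_diff_distrib) (simp only: algebra_simps)
    then show ?thesis
      using False cvs.scale_left_imp_eq[of "of_nat p"] by simp
  qed
qed

lemma T_torus_neg_coeff:
  "T_torus (neg_coeff \<rho> p v) = neg_coeff \<rho> p (T_torus v)
    + of_int (p + 1) *\<^sub>C neg_coeff \<rho> (p + 1) v - act (momentum \<rho>) (- 1) (neg_coeff \<rho> p v)"
proof (cases "p \<ge> 0")
  case True
  then have "nat (p + 1) = Suc (nat p)" "(of_int (p + 1) :: complex) = of_nat (Suc (nat p))"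
    by simp_all
  with True show ?thesis
    using T_torus_exp_neg[of \<rho> "nat p" v] by (simp add: neg_coeff_def del: of_nat_Suc of_int_add)
next
  case False
  then show ?thesis
    by (cases "p = - 1") (simp_all add: neg_coeff_def act_simps clinear_zero[OF clinear_T_torus])
qed

text \<open>Again it suffices to look at \<open>C\<^sub>0\<close>. There the derivative of the exponential in \<open>T\<close> supplies the
  term \<open>\<gamma>\<^sub>-\<^sub>1\<close> that is missing in the commutator of \<open>T\<close> with \<open>exp(A(w))\<close>.\<close>

lemma T_torus_expo_field:
  "T_torus (expo_field \<rho> n v) = expo_field \<rho> n (T_torus v) - of_int n *\<^sub>C expo_field \<rho> (n - 1) v"
proof -
  note T = clinear_simps[OF clinear_T_torus]
  have "\<forall>n. T_torus (expo_field \<rho> n v)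
    = expo_field \<rho> n (T_torus v) - of_int n *\<^sub>C expo_field \<rho> (n - 1) v"
  proof (induction v rule: V_torus_induct)
    case subspace
    show ?case
      by (simp add: cvs.subspace_def expo_field_simps T scaleC_add_right
        cvs.scale_right_diff_distrib scaleC_scaleC mult.commute)
  next
    case (of_C0 f)
    show ?case
    proof
      fix n
      let ?g = "of_C0 (expo \<rho> * f)"
      let ?N = "neg_coeff \<rho> (- 1 - n)"
      have N_alpha: "?N (act (alpha j) (- 1) w) = act (alpha j) (- 1) (?N w)" for j w
        by (simp add: act_neg_coeff)
      have momentum_g: "act (momentum \<rho>) (- 1) ?g = (\<Sum>j\<in>UNIV.
          (2 * of_real pi * \<i> * of_int (\<rho> $ j)) *\<^sub>C act (alpha j) (- 1) ?g)"
        by (simp add: momentum_def clinear_simps[OF clinear_act_left])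
      have "T_torus ?g = act (momentum \<rho>) (- 1) ?g
          + (\<Sum>j\<in>UNIV. act (alpha j) (- 1) (of_C0 (expo \<rho> * torus_partial j f)))"
        unfolding T_torus_of_C0 C0_act_beta[symmetric] C0_act_expo_mult bform_momentum_beta
          clinear_add[OF clinear_of_C0] clinear_scale[OF clinear_of_C0] act_simps sum.distrib
          momentum_g ..
      moreover have "?N (act (momentum \<rho>) (- 1) ?g) = act (momentum \<rho>) (- 1) (?N ?g)"
        by (simp add: act_neg_coeff)
      ultimately have "T_torus (?N ?g)
          = (\<Sum>j\<in>UNIV. act (alpha j) (- 1) (?N (of_C0 (expo \<rho> * torus_partial j f))))
            - of_int n *\<^sub>C neg_coeff \<rho> (- n) ?g"
        unfolding T_torus_neg_coeff by (simp add: coeff_simps N_alpha cvs.scale_minus_left)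
      moreover have "expo_field \<rho> n (T_torus (of_C0 f))
          = (\<Sum>j\<in>UNIV. act (alpha j) (- 1) (?N (of_C0 (expo \<rho> * torus_partial j f))))"
      proof -
        have "expo_field \<rho> n (act (alpha j) (- 1) w) = act (alpha j) (- 1) (expo_field \<rho> n w)" for j w
          by (simp add: act_expo_field bform_momentum_alpha)
        then show ?thesis by (simp add: T_torus_of_C0 expo_field_simps expo_field_of_C0)
      qed
      ultimately show "T_torus (expo_field \<rho> n (of_C0 f)) = expo_field \<rho> n (T_torus (of_C0 f))
          - of_int n *\<^sub>C expo_field \<rho> (n - 1) (of_C0 f)"
        by (simp add: expo_field_of_C0)
    qed
  next
    case (act b m v)
    show ?case
    proof
      fix n
      let ?c = "bform b (momentum \<rho>)"
      have move: "expo_field \<rho> i (act b k w) = act b k (expo_field \<rho> i w)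
          - ?c *\<^sub>C expo_field \<rho> (i + k) w" for i k w
        by (simp add: act_expo_field)
      have idx: "n + (m - 1) = n + m - 1" "n - 1 + m = n + m - 1" by simp_all
      show "T_torus (expo_field \<rho> n (act b m v)) = expo_field \<rho> n (T_torus (act b m v))
          - of_int n *\<^sub>C expo_field \<rho> (n - 1) (act b m v)"
        unfolding move T T_torus_act act[rule_format] expo_field_simps act_simps idx
        by (simp add: cvs.scale_right_diff_distrib scaleC_scaleC scaleC_add_left scaleC_add_right
          ac_simps)
    qed
  qed
  then show ?thesis by blast
qed

lemma translation_covariant_expo_field: "translation_covariant T_torus (expo_field \<rho>)"
  by (simp add: translation_covariant_def T_torus_expo_field dz_def cvs.scale_minus_left)

section \<open>The state-field correspondence\<close>

text \<open>The normally ordered products belong to the generating set because the states of its members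
  have to span the module.\<close>

inductive_set generating_fields :: "V_torus distribution set" where
  act: "act a \<in> generating_fields"
| expo: "expo_field \<rho> \<in> generating_fields"
| normal: "F \<in> generating_fields \<Longrightarrow> normal_product (dz_divided k (act a)) F \<in> generating_fields"

lemma generating_fields_properties:
  assumes "F \<in> generating_fields"
  shows "is_field F" "translation_covariant T_torus F" "creative vac F"
  using assms
proof induction
  case (normal F k a)
  note D = is_field_dz_divided[OF is_field_act, of k a]
  show "is_field (normal_product (dz_divided k (act a)) F)"
    by (rule is_field_normal_product[OF D normal.IH(1)])
  show "translation_covariant T_torus (normal_product (dz_divided k (act a)) F)"
    by (rule translation_covariant_normal_product[OF D normal.IH(1) clinear_T_torus
      translation_covariant_dz_divided[OF clinear_T_torus translation_covariant_act] normal.IH(2)])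
  show "creative vac (normal_product (dz_divided k (act a)) F)"
    by (rule creative_normal_product[OF D normal.IH(1) creative_dz_divided[OF creative_act]
      normal.IH(3)])
qed (simp_all add: is_field_act translation_covariant_act creative_act is_field_expo_field
  translation_covariant_expo_field creative_expo_field)

lemma mutually_local_act_generating:
  assumes "F \<in> generating_fields"
  shows "mutually_local (act a) F"
  using assms
proof (induction arbitrary: a)
  case (normal F k b)
  have "mutually_local (normal_product (dz_divided k (act b)) F) (act a)"
    using is_field_dz_divided[OF is_field_act] generating_fields_properties(1)[OF normal.hyps]
      is_field_act
      mutually_local_dz_divided[OF generating_fields_properties(1)[OF normal.hyps] normal.IH]
      mutually_local_dz_divided[OF is_field_act mutually_local_act]
      mutually_local_sym[OF normal.IH]
    by (rule mutually_local_normal_product)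
  then show ?case by (rule mutually_local_sym)
qed (simp_all add: mutually_local_act mutually_local_act_expo_field)

lemma mutually_local_normal_generating:
  assumes F: "F \<in> generating_fields" and C: "C \<in> generating_fields" and "mutually_local F C"
  shows "mutually_local (normal_product (dz_divided k (act a)) F) C"
  using is_field_dz_divided[OF is_field_act] generating_fields_properties(1)[OF F]
    generating_fields_properties(1)[OF C]
    mutually_local_dz_divided[OF generating_fields_properties(1)[OF F]
      mutually_local_act_generating[OF F]]
    mutually_local_dz_divided[OF generating_fields_properties(1)[OF C]
      mutually_local_act_generating[OF C]]
    assms(3)
  by (rule mutually_local_normal_product)

lemma mutually_local_generating_fields:
  assumes "F \<in> generating_fields" "C \<in> generating_fields"
  shows "mutually_local F C"
proof -
  have local_expo: "mutually_local F (expo_field \<rho>)" if "F \<in> generating_fields" for F \<rho>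
    using that
  proof induction
    case (normal F k a)
    then show ?case
      by (intro mutually_local_normal_generating generating_fields.expo)
  qed (simp_all add: mutually_local_act_expo_field mutually_local_expo_field)
  show ?thesis
    using assms(1)
  proof induction
    case (expo \<rho>)
    show ?case using local_expo[OF assms(2)] by (rule mutually_local_sym)
  next
    case (normal F k a)
    then show ?case using assms(2) by (intro mutually_local_normal_generating)
  qed (rule mutually_local_act_generating[OF assms(2)])
qed

definition monomial :: "(torus_lie \<times> nat) list \<Rightarrow> int ^ 3 \<Rightarrow> V_torus" where
  "monomial as \<rho> = foldr (\<lambda>(a, n). act a (- int n)) as (of_C0 (expo \<rho>))"

definition monomial_field :: "(torus_lie \<times> nat) list \<Rightarrow> int ^ 3 \<Rightarrow> V_torus distribution" where
  "monomial_field as \<rho>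
    = foldr (\<lambda>(a, n). normal_product (dz_divided (n - 1) (act a))) as (expo_field \<rho>)"

definition creation_monomials :: "V_torus set" where
  "creation_monomials = {monomial as \<rho> | as \<rho>. \<forall>(a, n)\<in>set as. n \<ge> 1}"

lemma monomial_field_generating: "monomial_field as \<rho> \<in> generating_fields"
  unfolding monomial_field_def
  by (induction as) (auto intro: generating_fields.intros)

lemma monomial_field_vac:
  "\<forall>(a, n)\<in>set as. n \<ge> 1 \<Longrightarrow> monomial_field as \<rho> (- 1) vac = monomial as \<rho>"
proof (induction as)
  case Nil
  then show ?case by (simp add: monomial_field_def monomial_def expo_field_vac)
next
  case (Cons p as)
  obtain a n where p: "p = (a, n)" by fastforce
  let ?F = "monomial_field as \<rho>"
  have "monomial_field (p # as) \<rho> (- 1) vac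
      = normal_product (dz_divided (n - 1) (act a)) ?F (- 1) vac"
    by (simp add: monomial_field_def p)
  also have "\<dots> = dz_divided (n - 1) (act a) (- 1) (?F (- 1) vac)"
    using generating_fields_properties[OF monomial_field_generating]
    by (intro creative_normal_product(2) is_field_dz_divided is_field_act creative_dz_divided
      creative_act)
  also have "\<dots> = act a (- int n) (monomial as \<rho>)"
    using Cons by (simp add: dz_divided_minus_one p of_nat_diff)
  finally show ?case by (simp add: monomial_def p)
qed

text \<open>Modes of negative index can be moved to the left of those of nonnegative index, which act
  on \<open>C\<^sub>0\<close> by scalars on each exponential.\<close>

lemma act_monomial_span:
  assumes "\<forall>(b, k)\<in>set as. k \<ge> 1"
  shows "act a n (monomial as \<rho>) \<in> cvs.span creation_monomials"
proof -
  have base: "monomial as \<rho> \<in> cvs.span creation_monomials" if "\<forall>(b, k)\<in>set as. k \<ge> 1" for as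
    using that by (intro cvs.span_base) (auto simp: creation_monomials_def)
  have create: "act b (- int k) v \<in> cvs.span creation_monomials"
    if "v \<in> cvs.span creation_monomials" "k \<ge> 1" for b k v
    using clinear_act _ that(1)
  proof (rule clinear_preserves_span)
    fix x assume "x \<in> creation_monomials"
    then obtain as \<sigma> where "x = monomial as \<sigma>" "\<forall>(a, n)\<in>set as. n \<ge> 1"
      by (auto simp: creation_monomials_def)
    then have "act b (- int k) x = monomial ((b, k) # as) \<sigma>" "\<forall>(a, n)\<in>set ((b, k) # as). n \<ge> 1"
      using that(2) by (simp_all add: monomial_def)
    then show "act b (- int k) x \<in> cvs.span creation_monomials"
      by (intro cvs.span_base) (auto simp only: creation_monomials_def mem_Collect_eq)
  qed
  show ?thesis
    using assms
  proof (induction as arbitrary: a n)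
    case Nil
    show ?case
    proof (cases "n \<ge> 0")
      case True
      have "of_C0 (expo \<rho>) \<in> cvs.span creation_monomials"
        using base[of "[]"] by (simp add: monomial_def)
      with True show ?thesis
        by (simp add: monomial_def act_of_C0 C0_act_expo clinear_scale[OF clinear_of_C0]
          cvs.span_scale cvs.span_zero)
    next
      case False
      then show ?thesis using create[OF base[of "[]"], of "nat (- n)" a] by simp
    qed
  next
    case (Cons p as)
    obtain b k where p: "p = (b, k)" by fastforce
    have as: "\<forall>(b, k)\<in>set as. k \<ge> 1" and k: "k \<ge> 1" using Cons.prems p by auto
    have "act a n (monomial (p # as) \<rho>)
        = act b (- int k) (act a n (monomial as \<rho>)) + (act (lie a b) (n - int k) (monomial as \<rho>)
          + (if n = int k then of_int n * bform a b else 0) *\<^sub>C monomial as \<rho>)"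
      using act_commutator[of a n b "- int k" "monomial as \<rho>"]
      by (simp add: monomial_def p diff_eq_eq add.commute)
    also have "\<dots> \<in> cvs.span creation_monomials"
      using create[OF Cons.IH[OF as] k] Cons.IH[OF as] base[OF as]
      by (intro cvs.span_add cvs.span_scale)
    finally show ?case .
  qed
qed

lemma creation_monomials_span: "v \<in> cvs.span creation_monomials"
proof (induction v rule: V_torus_induct)
  case subspace
  show ?case by (simp add: cvs.subspace_span)
next
  case (of_C0 f)
  show ?case
  proof (induction f rule: torus_fun_induct)
    case (expo \<rho>)
    have "of_C0 (expo \<rho>) = monomial [] \<rho>" by (simp add: monomial_def)
    then have "of_C0 (expo \<rho>) \<in> creation_monomials"
      unfolding creation_monomials_def by fastforce
    then show ?case by (rule cvs.span_base)
  qed (simp_all add: clinear_simps[OF clinear_of_C0] cvs.span_add cvs.span_scale)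
next
  case (act a n v)
  from clinear_act _ act show ?case
  proof (rule clinear_preserves_span)
    fix x assume "x \<in> creation_monomials"
    then obtain as \<rho> where "x = monomial as \<rho>" "\<forall>(b, k)\<in>set as. k \<ge> 1"
      unfolding creation_monomials_def by blast
    then show "act a n x \<in> cvs.span creation_monomials" by (simp only: act_monomial_span)
  qed
qed

interpretation torus: field_system vac T_torus generating_fields
proof (rule field_system.intro)
  show "v \<in> cvs.span ((\<lambda>F. F (- 1) vac) ` generating_fields)" for v
  proof -
    have "creation_monomials \<subseteq> (\<lambda>F. F (- 1) vac) ` generating_fields"
    proof
      fix x assume "x \<in> creation_monomials"
      then obtain as \<rho> where "x = monomial as \<rho>" "\<forall>(b, k)\<in>set as. k \<ge> 1"
        unfolding creation_monomials_def by blast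
      then have "x = monomial_field as \<rho> (- 1) vac" by (simp only: monomial_field_vac)
      then show "x \<in> (\<lambda>F. F (- 1) vac) ` generating_fields"
        using monomial_field_generating by (rule image_eqI)
    qed
    then show ?thesis using creation_monomials_span cvs.span_mono by blast
  qed
qed (simp_all add: clinear_T_torus T_torus_vac generating_fields_properties
  mutually_local_generating_fields)

text \<open>The prescribed fields of the generators determine those of all monomials.\<close>

lemma is_state_field_monomial:
  assumes Y: "is_state_field Y" and as: "\<forall>(a, n)\<in>set as. n \<ge> 1"
  shows "Y (monomial as \<rho>) = monomial_field as \<rho>"
proof -
  have lin: "clinear Y" using Y by (simp add: is_state_field_def)
  have act: "Y (act a (- 1) vac) = act a" for a
  proof (induction a rule: torus_lie_induct)
    case (add a b)
    then show ?case
      by (simp add: clinear_add[OF clinear_act_left] clinear_add[OF lin] fun_eq_iff)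
  next
    case (scale c a)
    then show ?case
      by (simp add: clinear_scale[OF clinear_act_left] clinear_scale[OF lin] fun_eq_iff
        scaleC_fun_def)
  qed (use Y in \<open>simp_all add: is_state_field_def\<close>)
  have "Y (monomial as \<rho>) = foldr (\<lambda>(a, n). normal_product (dz_divided (n - 1)
      (Y (act a (- 1) vac)))) as (Y (of_C0 (expo \<rho>)))"
    using Y as unfolding is_state_field_def monomial_def by blast
  then show ?thesis
    using Y by (simp add: monomial_field_def act is_state_field_def)
qed

lemma is_state_field_torus: "is_state_field torus.state_field"
proof -
  let ?Y = "torus.state_field"
  have act: "?Y (act a (- 1) vac) = act a" for a
    by (rule torus.state_field_eqI) (simp_all add: torus.G_subset_fields generating_fields.act)
  have mono: "?Y (monomial as \<rho>) = monomial_field as \<rho>" if "\<forall>(a, n)\<in>set as. n \<ge> 1" for as \<rho>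
    by (rule torus.state_field_eqI)
      (simp_all add: torus.G_subset_fields monomial_field_generating monomial_field_vac[OF that])
  have expo: "?Y (of_C0 (expo \<rho>)) = expo_field \<rho>" for \<rho>
    using mono[of "[]"] by (simp add: monomial_def monomial_field_def)
  show ?thesis
    unfolding is_state_field_def act expo
    using torus.clinear_state_field mono unfolding monomial_def monomial_field_def by blast
qed

lemma is_state_field_unique:
  assumes "is_state_field Y"
  shows "Y = torus.state_field"
proof
  fix v
  have "clinear Y" using assms by (simp add: is_state_field_def)
  then have "clinear (\<lambda>v. Y v - torus.state_field v)"
    by (simp add: clinear_iff clinear_simps[OF torus.clinear_state_field]
      cvs.scale_right_diff_distrib)
  then have "Y v - torus.state_field v = 0"
    using _ creation_monomials_span
    by (rule clinear_kernel_span)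
      (auto simp: creation_monomials_def is_state_field_monomial[OF assms]
        is_state_field_monomial[OF is_state_field_torus])
  then show "Y v = torus.state_field v" by simp
qed

theorem theorem5p1:
  shows "(\<forall>\<rho>. \<exists>!E. is_shift_operator \<rho> E) \<and>
    (\<exists>!Y. is_state_field Y) \<and>
    vertex_algebra vac Y_torus"
proof (intro conjI allI)
  show "\<exists>!E. is_shift_operator \<rho> E" for \<rho> by (rule ex1_shift_operator)
  show ex1: "\<exists>!Y. is_state_field Y"
    using is_state_field_torus is_state_field_unique by (rule ex1I)
  have "Y_torus = torus.state_field"
    unfolding Y_torus_def using is_state_field_torus is_state_field_unique by (rule the_equality)
  then show "vertex_algebra vac Y_torus"
    by (rule ssubst) (rule torus.vertex_algebra_state_field)
qed

end
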